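(* Let $A\Rightarrow M$ be a Lie algebroid with a bundle of ideals $\mathfrak k$ and an IM connection $(\mathcal C,v)\in\mathcal A(A;\mathfrak k)$. The horizontal exterior covariant derivative $D^{(\mathcal C,v)}=h^*\mathrm d^\nabla\colon W^{p,q}(A;\mathfrak k)\to W^{p,q+1}(A;\mathfrak k)$ is a cochain map, that is, $$\delta D^{(\mathcal C,v)}=D^{(\mathcal C,v)}\delta$$ (for all $p,q\ge0$). In particular, $D^{(\mathcal C,v)}$ maps IM forms to IM forms.
   Context: $\rho$ is the anchor of $A$. A bundle of ideals is a vector subbundle $\mathfrak k\subset A$ with $\mathfrak k\subset\ker\rho$ and $[\alpha,\xi]\in\Gamma(\mathfrak k)$ for $\alpha\in\Gamma(A),\xi\in\Gamma(\mathfrak k)$; it is a representation of $A$ via $\nabla^A_\alpha\xi=[\alpha,\xi]$. Weil cochains: $W^{p,q}(A;\mathfrak k)$ is the set of sequences $c=(c_0,\dots,c_p)$ of $\mathbb R$-multilinear alternating maps $c_k\colon\Gamma(A)^{p-k}\to\Omega^{q-k}(M;S^k(A^* )\otimes\mathfrak k)$ (negative-degree forms are zero), written $c_k(\alpha_1,\dots,\alpha_{p-k}|\beta_1,\dots,\beta_k)\in\Omega^{q-k}(M;\mathfrak k)$, with $c_k(f\alpha_1,\alpha_2,\dots|\cdot)=fc_k(\alpha_1,\alpha_2,\dots|\cdot)+\mathrm df\wedge c_{k+1}(\alpha_2,\dots|\alpha_1,\cdot)$; $c_{-1}=c_{p+1}=0$. For $\gamma\in\Omega^m(M;S^n(A^*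 )\otimes\mathfrak k)$: $(\mathcal L^A_\alpha\gamma)(\underline\beta)(\underline X)=[\alpha,\gamma(\underline\beta)(\underline X)]-\sum_i\gamma(\dots,[\alpha,\beta_i],\dots)(\underline X)-\sum_j\gamma(\underline\beta)(\dots,[\rho(\alpha),X_j],\dots)$. Simplicial differential $\delta\colon W^{p,q}\to W^{p+1,q}$: $$(-1)^k(\delta c)_k(\alpha_0,\dots,\alpha_{p-k}|\underline\beta)=\sum_i(-1)^i\mathcal L^A_{\alpha_i}\big(c_k(\dots,\widehat{\alpha_i},\dots|\cdot)\big)(\underline\beta)+\sum_{i<j}(-1)^{i+j}c_k([\alpha_i,\alpha_j],\dots,\widehat{\alpha_i},\dots,\widehat{\alpha_j},\dots|\underline\beta)-\sum_{j=1}^k\iota_{\rho(\beta_j)}c_{k-1}(\underline\alpha|\beta_1,\dots,\widehat{\beta_j},\dots,\beta_k).$$ IM forms: $\Omega^q_{im}(A;\mathfrak k)=\ker\delta\subset W^{1,q}(A;\mathfrak k)$. An IM connection is $(\mathcal C,v)\in\Omega^1_{im}(A;\mathfrak k)$ with $v|_{\mathfrak k}=\mathrm{id}_{\mathfrak k}$ ($\mathcal C=c_0$, $v=c_1\colon A\to\mathfrak k$); the set of these is $\mathcal A(A;\mathfrak k)$. Put $h=\mathrm{id}_A-v\colon A\to\ker v$. The induced linear connection on $\mathfrak k$ is $\nabla_X\xi=\mathcal C(\xi)(X)$. Exterior covariant derivative $\mathrm d^\nabla\colon W^{p,q}\to W^{p,q+1}$: $(-1)^k(\mathrm d^\nabla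 c)_k(\underline\alpha|\underline\beta)=\mathrm d^\nabla(c_k(\underline\alpha|\underline\beta))-\sum_{i=1}^kc_{k-1}(\beta_i,\underline\alpha|\beta_1,\dots,\widehat{\beta_i},\dots,\beta_k)$. Pairing: for $\gamma\in\Omega^m(M;S^j(A^* )\otimes\mathfrak k)$ and $\vartheta_1,\dots,\vartheta_\ell\in\Omega^1(M;\mathfrak k)$, $\ell\le j$, let $\gamma\,\dot\wedge\,(\vartheta_1,\dots,\vartheta_\ell)\in\Omega^{m+\ell}(M;S^{j-\ell}(A^* )\otimes\mathfrak k)$ be $$\big(\gamma\dot\wedge(\vartheta_1,\dots,\vartheta_\ell)\big)(\cdot)(X_1,\dots,X_{m+\ell})=\tfrac1{m!}\sum_{\sigma\in S_{m+\ell}}\mathrm{sgn}(\sigma)\,\gamma\big(\vartheta_1(X_{\sigma(1)}),\dots,\vartheta_\ell(X_{\sigma(\ell)}),\cdot\big)(X_{\sigma(\ell+1)},\dots,X_{\sigma(\ell+m)}).$$ Horizontal projection $h^*\colon W^{p,q}(A;\mathfrak k)\to W^{p,q}(A;\mathfrak k)$: for $0\le k\le p$, $$(h^*c)_k(\alpha_1,\dots,\alpha_{p-k}|\beta_1,\dots,\beta_k)=\sum_{j=k}^p(-1)^{j-k}\sum_{\sigma\in S_{(j-k,p-j)}}\mathrm{sgn}(\sigma)\,c_j(\alpha_{\sigma(j-k+1)},\dots,\alpha_{\sigma(p-k)}|h\beta_1,\dots,h\beta_k,\cdot)\dot\wedge(\mathcal C\alpha_{\sigma(1)},\dots,\mathcal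 C\alpha_{\sigma(j-k)}),$$ where $S_{(a,b)}$ is the set of $(a,b)$-shuffles. *)

theory Defs
  imports
    "HOL-Analysis.Analysis"
    "HOL-Combinatorics.Permutations"
    "HOL-Library.Function_Algebras"
    "HOL-Library.Multiset"
begin

section \<open>Smooth manifolds\<close>

text \<open>The model space is a finite-dimensional real normed space, so dimension 0 is allowed.
  \<open>Ck_on k S f\<close> is only meant for open \<open>S\<close>.\<close>

fun Ck_on :: "nat \<Rightarrow> 'e::real_normed_vector set \<Rightarrow> ('e \<Rightarrow> 'b::real_normed_vector) \<Rightarrow> bool" where
  "Ck_on 0 S f \<longleftrightarrow> continuous_on S f"
| "Ck_on (Suc k) S f \<longleftrightarrow>
     (\<forall>x\<in>S. f differentiable (at x)) \<and> (\<forall>v. Ck_on k S (\<lambda>x. frechet_derivative f (at x) v))"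

definition smooth_on :: "'e::real_normed_vector set \<Rightarrow> ('e \<Rightarrow> 'b::real_normed_vector) \<Rightarrow> bool" where
  "smooth_on S f \<longleftrightarrow> (\<forall>k. Ck_on k S f)"

text \<open>The manifold is the whole Hausdorff, second countable type \<open>'m\<close>;
  the atlas need not be maximal.\<close>

type_synonym ('m, 'e) atlas = "('m set \<times> ('m \<Rightarrow> 'e)) set"

definition smooth_atlas ::
    "('m::{t2_space,second_countable_topology}, 'e::real_normed_vector) atlas \<Rightarrow> bool" where
  "smooth_atlas \<A> \<longleftrightarrow>
     (\<exists>B::'e set. finite B \<and> span B = UNIV) \<and>
     (\<Union>(fst ` \<A>) = UNIV) \<and>
     (\<forall>(U, \<phi>)\<in>\<A>. open U \<and> open (\<phi> ` U) \<and> homeomorphism U (\<phi> ` U) \<phi> (inv_into U \<phi>)) \<and>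
     (\<forall>(U, \<phi>)\<in>\<A>. \<forall>(V, \<psi>)\<in>\<A>. smooth_on (\<phi> ` (U \<inter> V)) (\<psi> \<circ> inv_into U \<phi>))"

definition smooth_fun_on :: "('m, 'e::real_normed_vector) atlas \<Rightarrow> 'm set \<Rightarrow> ('m \<Rightarrow> real) \<Rightarrow> bool" where
  "smooth_fun_on \<A> W f \<longleftrightarrow> (\<forall>(U, \<phi>)\<in>\<A>. smooth_on (\<phi> ` (U \<inter> W)) (f \<circ> inv_into U \<phi>))"

definition smooth_funs :: "('m, 'e::real_normed_vector) atlas \<Rightarrow> ('m \<Rightarrow> real) set" where
  "smooth_funs \<A> = {f. smooth_fun_on \<A> UNIV f}"

text \<open>Tangent vectors at \<open>x\<close> are the derivations at \<open>x\<close> of the algebra of smooth functions.  They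
  are set to 0 on functions that are not smooth, so that equality of tangent vectors and of vector
  fields is equality in HOL.  A vector field is written as the operator it induces on functions;
  its value at \<open>x\<close> is \<open>\<lambda>f. X f x\<close>.\<close>

type_synonym 'm vfield = "('m \<Rightarrow> real) \<Rightarrow> 'm \<Rightarrow> real"

definition tangent_space ::
    "('m, 'e::real_normed_vector) atlas \<Rightarrow> 'm \<Rightarrow> (('m \<Rightarrow> real) \<Rightarrow> real) set" where
  "tangent_space \<A> x = {w.
     (\<forall>f\<in>smooth_funs \<A>. \<forall>g\<in>smooth_funs \<A>. \<forall>a b.
        w (\<lambda>y. a * f y + b * g y) = a * w f + b * w g \<and>
        w (\<lambda>y. f y * g y) = f x * w g + g x * w f) \<and>
     (\<forall>f. f \<notin> smooth_funs \<A> \<longrightarrow> w f = 0)}"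

definition vector_fields :: "('m, 'e::real_normed_vector) atlas \<Rightarrow> 'm vfield set" where
  "vector_fields \<A> = {X. (\<forall>x. (\<lambda>f. X f x) \<in> tangent_space \<A> x) \<and>
     (\<forall>f\<in>smooth_funs \<A>. X f \<in> smooth_funs \<A>)}"

definition vbracket :: "'m vfield \<Rightarrow> 'm vfield \<Rightarrow> 'm vfield" where
  "vbracket X Y = (\<lambda>f. X (Y f) - Y (X f))"

definition vscale :: "('m \<Rightarrow> real) \<Rightarrow> 'm vfield \<Rightarrow> 'm vfield" where
  "vscale f X = (\<lambda>g. f * X g)"


section \<open>Vector bundles and Lie algebroids\<close>

text \<open>A vector bundle is a family of linear subspaces \<open>fibre L x\<close> of some ambient real vector space
  \<open>'a\<close> (the direct sum of abstract fibres, say; \<open>'a\<close> carries no topology and no condition relates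
  different fibres inside it), together with a family of local frames whose domains cover the base
  and whose transition matrices are smooth.  A frame over \<open>U\<close> is the same thing as a local
  trivialisation over \<open>U\<close>; its length is the rank over \<open>U\<close>, which may be 0.\<close>

type_synonym ('m, 'a) sect = "'m \<Rightarrow> 'a"

record ('m, 'e, 'a) algebroid =
  charts :: "('m, 'e) atlas"
  fibre :: "'m \<Rightarrow> 'a set"
  frames :: "('m set \<times> ('m, 'a) sect list) set"
  anchor :: "'m \<Rightarrow> 'a \<Rightarrow> ('m \<Rightarrow> real) \<Rightarrow> real"
  lie :: "('m, 'a) sect \<Rightarrow> ('m, 'a) sect \<Rightarrow> ('m, 'a) sect"

definition fscale :: "('m \<Rightarrow> real) \<Rightarrow> ('m, 'a::real_vector) sect \<Rightarrow> ('m, 'a) sect" (infixr "\<odot>" 75) where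
  "f \<odot> s = (\<lambda>x. f x *\<^sub>R s x)"

definition rscale :: "real \<Rightarrow> ('m, 'a::real_vector) sect \<Rightarrow> ('m, 'a) sect" (infixr "\<cdot>" 75) where
  "r \<cdot> s = (\<lambda>x. r *\<^sub>R s x)"

definition is_basis :: "'a::real_vector list \<Rightarrow> 'a set \<Rightarrow> bool" where
  "is_basis vs V \<longleftrightarrow> distinct vs \<and> independent (set vs) \<and> span (set vs) = V"

definition smooth_coeffs_on :: "('m, 'e::real_normed_vector) atlas \<Rightarrow> 'm set \<Rightarrow>
    ('m, 'a::real_vector) sect list \<Rightarrow> ('m, 'a) sect \<Rightarrow> bool" where
  "smooth_coeffs_on \<A> W es s \<longleftrightarrow>
     (\<exists>cs. length cs = length es \<and> (\<forall>c\<in>set cs. smooth_fun_on \<A> W c) \<and>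
       (\<forall>x\<in>W. s x = (\<Sum>i<length es. (cs ! i) x *\<^sub>R (es ! i) x)))"

definition vector_bundle ::
    "('m::{t2_space,second_countable_topology}, 'e::real_normed_vector, 'a::real_vector) algebroid \<Rightarrow> bool"
  where
  "vector_bundle L \<longleftrightarrow>
     (\<forall>x. subspace (fibre L x)) \<and>
     \<Union>(fst ` frames L) = UNIV \<and>
     (\<forall>(U, es)\<in>frames L. open U \<and> (\<forall>x\<in>U. is_basis (map (\<lambda>e. e x) es) (fibre L x))) \<and>
     (\<forall>(U, es)\<in>frames L. \<forall>(V, fs)\<in>frames L. \<forall>f\<in>set fs.
        smooth_coeffs_on (charts L) (U \<inter> V) es f)"

definition section_on ::
    "('m, 'e::real_normed_vector, 'a::real_vector) algebroid \<Rightarrow> 'm set \<Rightarrow> ('m, 'a) sect \<Rightarrow> bool" where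
  "section_on L W s \<longleftrightarrow> (\<forall>x\<in>W. s x \<in> fibre L x) \<and>
     (\<forall>(U, es)\<in>frames L. smooth_coeffs_on (charts L) (U \<inter> W) es s)"

definition sections ::
    "('m, 'e::real_normed_vector, 'a::real_vector) algebroid \<Rightarrow> ('m, 'a) sect set" where
  "sections L = {s. section_on L UNIV s}"

definition rho :: "('m, 'e, 'a) algebroid \<Rightarrow> ('m, 'a) sect \<Rightarrow> 'm vfield" where
  "rho L \<alpha> = (\<lambda>f x. anchor L x (\<alpha> x) f)"

definition lie_algebroid ::
    "('m::{t2_space,second_countable_topology}, 'e::real_normed_vector, 'a::real_vector) algebroid \<Rightarrow> bool"
  where
  "lie_algebroid L \<longleftrightarrow>
     smooth_atlas (charts L) \<and> vector_bundle L \<and>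
     (\<forall>x. \<forall>u\<in>fibre L x. anchor L x u \<in> tangent_space (charts L) x) \<and>
     (\<forall>x f. \<forall>u\<in>fibre L x. \<forall>w\<in>fibre L x. \<forall>a b.
        anchor L x (a *\<^sub>R u + b *\<^sub>R w) f = a * anchor L x u f + b * anchor L x w f) \<and>
     (\<forall>\<alpha>\<in>sections L. rho L \<alpha> \<in> vector_fields (charts L)) \<and>
     (\<forall>\<alpha>\<in>sections L. \<forall>\<beta>\<in>sections L. lie L \<alpha> \<beta> \<in> sections L) \<and>
     (\<forall>\<alpha>\<in>sections L. \<forall>\<beta>\<in>sections L. \<forall>\<gamma>\<in>sections L. \<forall>a b.
        lie L (a \<cdot> \<alpha> + b \<cdot> \<beta>) \<gamma> = a \<cdot> lie L \<alpha> \<gamma> + b \<cdot> lie L \<beta> \<gamma>) \<and>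
     (\<forall>\<alpha>\<in>sections L. \<forall>\<beta>\<in>sections L. lie L \<alpha> \<beta> = - lie L \<beta> \<alpha>) \<and>
     (\<forall>\<alpha>\<in>sections L. \<forall>\<beta>\<in>sections L. \<forall>\<gamma>\<in>sections L.
        lie L \<alpha> (lie L \<beta> \<gamma>) + lie L \<beta> (lie L \<gamma> \<alpha>) + lie L \<gamma> (lie L \<alpha> \<beta>) = 0) \<and>
     \<comment> \<open>that the anchor preserves brackets is implied by the other conditions; as usual it is listed\<close>
     (\<forall>\<alpha>\<in>sections L. \<forall>\<beta>\<in>sections L. rho L (lie L \<alpha> \<beta>) = vbracket (rho L \<alpha>) (rho L \<beta>)) \<and>
     (\<forall>\<alpha>\<in>sections L. \<forall>\<beta>\<in>sections L. \<forall>f\<in>smooth_funs (charts L).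
        lie L \<alpha> (f \<odot> \<beta>) = f \<odot> lie L \<alpha> \<beta> + rho L \<alpha> f \<odot> \<beta>)"

definition vector_subbundle ::
    "('m::topological_space, 'e::real_normed_vector, 'a::real_vector) algebroid \<Rightarrow> ('m \<Rightarrow> 'a set) \<Rightarrow> bool"
  where
  "vector_subbundle L K \<longleftrightarrow>
     (\<forall>x. subspace (K x) \<and> K x \<subseteq> fibre L x) \<and>
     (\<forall>x. \<exists>U es. open U \<and> x \<in> U \<and> (\<forall>e\<in>set es. section_on L U e) \<and>
        (\<forall>y\<in>U. is_basis (map (\<lambda>e. e y) es) (K y)))"

definition sub_sections :: "('m, 'e::real_normed_vector, 'a::real_vector) algebroid \<Rightarrow>
    ('m \<Rightarrow> 'a set) \<Rightarrow> ('m, 'a) sect set" where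
  "sub_sections L K = {\<xi>\<in>sections L. \<forall>x. \<xi> x \<in> K x}"

definition bundle_of_ideals ::
    "('m::topological_space, 'e::real_normed_vector, 'a::real_vector) algebroid \<Rightarrow> ('m \<Rightarrow> 'a set) \<Rightarrow> bool"
  where
  "bundle_of_ideals L K \<longleftrightarrow>
     vector_subbundle L K \<and>
     (\<forall>x. \<forall>u\<in>K x. anchor L x u = 0) \<and>
     (\<forall>\<alpha>\<in>sections L. \<forall>\<xi>\<in>sub_sections L K. lie L \<alpha> \<xi> \<in> sub_sections L K)"


section \<open>Weil cochains\<close>

text \<open>Tuples are lists, indexed from 0; \<open>nths xs (- {i})\<close> is \<open>xs\<close> with its \<open>i\<close>-th entry omitted.\<close>

definition tuples :: "nat \<Rightarrow> 'b set \<Rightarrow> 'b list set" where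
  "tuples n S = {xs. length xs = n \<and> set xs \<subseteq> S}"

text \<open>Linearity in each of the \<open>n\<close> arguments from \<open>S\<close>, with respect to scalars in \<open>R\<close> acting through
  \<open>sc\<close> on arguments and \<open>sc'\<close> on values.\<close>

definition multilinear ::
    "'r set \<Rightarrow> ('r \<Rightarrow> 'b \<Rightarrow> 'b) \<Rightarrow> ('r \<Rightarrow> 'c \<Rightarrow> 'c) \<Rightarrow> nat \<Rightarrow> 'b::plus set \<Rightarrow> ('b list \<Rightarrow> 'c::plus) \<Rightarrow> bool"
  where
  "multilinear R sc sc' n S F \<longleftrightarrow>
     (\<forall>xs\<in>tuples n S. \<forall>i<n. \<forall>r\<in>R. \<forall>y\<in>S. \<forall>z\<in>S.
        F (xs[i := sc r y + z]) = sc' r (F (xs[i := y])) + F (xs[i := z]))"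

definition alternating :: "nat \<Rightarrow> 'b set \<Rightarrow> ('b list \<Rightarrow> 'c::zero) \<Rightarrow> bool" where
  "alternating n S F \<longleftrightarrow> (\<forall>xs\<in>tuples n S. \<not> distinct xs \<longrightarrow> F xs = 0)"

definition symmetric :: "nat \<Rightarrow> 'b set \<Rightarrow> ('b list \<Rightarrow> 'c) \<Rightarrow> bool" where
  "symmetric n S F \<longleftrightarrow> (\<forall>xs\<in>tuples n S. \<forall>ys. mset xs = mset ys \<longrightarrow> F xs = F ys)"

text \<open>\<open>forms L K m n\<close> is the space of \<open>m\<close>-forms with values in the tensor product of the \<open>n\<close>-th
  symmetric power of the dual of \<open>L\<close> with \<open>K\<close>, written as maps on sections and vector fields that are
  multilinear over the smooth functions.  They are 0 outside their domain, so that
  equality of forms is equality in HOL; the same convention is used for cochains.\<close>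

type_synonym ('m, 'a) form = "('m, 'a) sect list \<Rightarrow> 'm vfield list \<Rightarrow> ('m, 'a) sect"
type_synonym ('m, 'a) cochain = "nat \<Rightarrow> ('m, 'a) sect list \<Rightarrow> ('m, 'a) form"

definition forms :: "('m, 'e::real_normed_vector, 'a::real_vector) algebroid \<Rightarrow> ('m \<Rightarrow> 'a set) \<Rightarrow>
    nat \<Rightarrow> nat \<Rightarrow> ('m, 'a) form set" where
  "forms L K m n = {\<gamma>.
     (\<forall>\<beta>s Xs. if \<beta>s \<in> tuples n (sections L) \<and> Xs \<in> tuples m (vector_fields (charts L))
        then \<gamma> \<beta>s Xs \<in> sub_sections L K else \<gamma> \<beta>s Xs = 0) \<and>
     (\<forall>Xs\<in>tuples m (vector_fields (charts L)).
        multilinear (smooth_funs (charts L)) (\<odot>) (\<odot>) n (sections L) (\<lambda>\<beta>s. \<gamma> \<beta>s Xs) \<and>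
        symmetric n (sections L) (\<lambda>\<beta>s. \<gamma> \<beta>s Xs)) \<and>
     (\<forall>\<beta>s\<in>tuples n (sections L).
        multilinear (smooth_funs (charts L)) vscale (\<odot>) m (vector_fields (charts L)) (\<gamma> \<beta>s) \<and>
        alternating m (vector_fields (charts L)) (\<gamma> \<beta>s))}"

definition df_wedge :: "('m \<Rightarrow> real) \<Rightarrow> ('m vfield list \<Rightarrow> ('m, 'a::real_vector) sect) \<Rightarrow>
    'm vfield list \<Rightarrow> ('m, 'a) sect" where
  "df_wedge f \<eta> Xs = (\<Sum>i<length Xs. (-1) ^ i \<cdot> (Xs ! i) f \<odot> \<eta> (nths Xs (- {i})))"

definition weil :: "('m, 'e::real_normed_vector, 'a::real_vector) algebroid \<Rightarrow> ('m \<Rightarrow> 'a set) \<Rightarrow>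
    nat \<Rightarrow> nat \<Rightarrow> ('m, 'a) cochain set" where
  "weil L K p q = {c.
     (\<forall>k \<alpha>s. if k \<le> p \<and> k \<le> q \<and> \<alpha>s \<in> tuples (p - k) (sections L)
        then c k \<alpha>s \<in> forms L K (q - k) k else c k \<alpha>s = 0) \<and>
     (\<forall>k\<le>p. \<forall>\<beta>s Xs.
        multilinear UNIV (\<cdot>) (\<cdot>) (p - k) (sections L) (\<lambda>\<alpha>s. c k \<alpha>s \<beta>s Xs) \<and>
        alternating (p - k) (sections L) (\<lambda>\<alpha>s. c k \<alpha>s \<beta>s Xs)) \<and>
     (\<forall>k<p. \<forall>f\<in>smooth_funs (charts L). \<forall>\<alpha>\<in>sections L. \<forall>\<alpha>s\<in>tuples (p - k - 1) (sections L).
        \<forall>\<beta>s\<in>tuples k (sections L). \<forall>Xs\<in>tuples (q - k) (vector_fields (charts L)).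
          c k (f \<odot> \<alpha> # \<alpha>s) \<beta>s Xs =
            f \<odot> c k (\<alpha> # \<alpha>s) \<beta>s Xs + df_wedge f (c (Suc k) \<alpha>s (\<alpha> # \<beta>s)) Xs)}"

text \<open>The arguments at which the \<open>k\<close>-th term of a cochain of bidegree \<open>(p, q)\<close> may be nonzero.\<close>

definition args :: "('m, 'e::real_normed_vector, 'a::real_vector) algebroid \<Rightarrow> nat \<Rightarrow> nat \<Rightarrow> nat \<Rightarrow>
    ('m, 'a) sect list \<Rightarrow> ('m, 'a) sect list \<Rightarrow> 'm vfield list \<Rightarrow> bool" where
  "args L p q k \<alpha>s \<beta>s Xs \<longleftrightarrow> k \<le> p \<and> k \<le> q \<and> \<alpha>s \<in> tuples (p - k) (sections L) \<and>
     \<beta>s \<in> tuples k (sections L) \<and> Xs \<in> tuples (q - k) (vector_fields (charts L))"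

definition lie_deriv :: "('m, 'e, 'a::real_vector) algebroid \<Rightarrow> ('m, 'a) sect \<Rightarrow> ('m, 'a) form \<Rightarrow>
    ('m, 'a) form" where
  "lie_deriv L \<alpha> \<gamma> \<beta>s Xs =
     lie L \<alpha> (\<gamma> \<beta>s Xs)
     - (\<Sum>i<length \<beta>s. \<gamma> (\<beta>s[i := lie L \<alpha> (\<beta>s ! i)]) Xs)
     - (\<Sum>j<length Xs. \<gamma> \<beta>s (Xs[j := vbracket (rho L \<alpha>) (Xs ! j)]))"

text \<open>The differential on cochains of bidegree \<open>(p, q)\<close>.  The convention that
  the components with index \<open>-1\<close> and \<open>p + 1\<close> vanish holds automatically: the last sum is empty for
  \<open>k = 0\<close>, and the first two are empty for \<open>k = p + 1\<close>.\<close>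

definition delta :: "('m, 'e::real_normed_vector, 'a::real_vector) algebroid \<Rightarrow> nat \<Rightarrow> nat \<Rightarrow>
    ('m, 'a) cochain \<Rightarrow> ('m, 'a) cochain" where
  "delta L p q c = (\<lambda>k \<alpha>s \<beta>s Xs. if args L (p + 1) q k \<alpha>s \<beta>s Xs then
     (-1) ^ k \<cdot>
       ((\<Sum>i<length \<alpha>s. (-1) ^ i \<cdot> lie_deriv L (\<alpha>s ! i) (c k (nths \<alpha>s (- {i}))) \<beta>s Xs)
        + (\<Sum>j<length \<alpha>s. \<Sum>i<j.
             (-1) ^ (i + j) \<cdot> c k (lie L (\<alpha>s ! i) (\<alpha>s ! j) # nths \<alpha>s (- {i, j})) \<beta>s Xs)
        - (\<Sum>j<k. c (k - 1) \<alpha>s (nths \<beta>s (- {j})) (rho L (\<beta>s ! j) # Xs)))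
     else 0)"


section \<open>IM forms and IM connections\<close>

definition IM_forms :: "('m, 'e::real_normed_vector, 'a::real_vector) algebroid \<Rightarrow> ('m \<Rightarrow> 'a set) \<Rightarrow>
    nat \<Rightarrow> ('m, 'a) cochain set" where
  "IM_forms L K q = {c\<in>weil L K 1 q. delta L 1 q c = 0}"

definition conn_C :: "('m, 'a) cochain \<Rightarrow> ('m, 'a) sect \<Rightarrow> 'm vfield \<Rightarrow> ('m, 'a) sect" where
  "conn_C \<omega> \<alpha> X = \<omega> 0 [\<alpha>] [] [X]"

definition conn_v :: "('m, 'a) cochain \<Rightarrow> ('m, 'a) sect \<Rightarrow> ('m, 'a) sect" where
  "conn_v \<omega> \<alpha> = \<omega> 1 [] [\<alpha>] []"

definition IM_connections :: "('m, 'e::real_normed_vector, 'a::real_vector) algebroid \<Rightarrow>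
    ('m \<Rightarrow> 'a set) \<Rightarrow> ('m, 'a) cochain set" where
  "IM_connections L K = {\<omega>\<in>IM_forms L K 1. \<forall>\<xi>\<in>sub_sections L K. conn_v \<omega> \<xi> = \<xi>}"

definition conn_h :: "('m, 'a::real_vector) cochain \<Rightarrow> ('m, 'a) sect \<Rightarrow> ('m, 'a) sect" where
  "conn_h \<omega> \<alpha> = \<alpha> - conn_v \<omega> \<alpha>"

definition nabla :: "('m, 'a) cochain \<Rightarrow> 'm vfield \<Rightarrow> ('m, 'a) sect \<Rightarrow> ('m, 'a) sect" where
  "nabla \<omega> X \<xi> = conn_C \<omega> \<xi> X"


section \<open>The horizontal exterior covariant derivative\<close>

definition d_nabla_form :: "('m, 'a::real_vector) cochain \<Rightarrow> ('m vfield list \<Rightarrow> ('m, 'a) sect) \<Rightarrow>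
    'm vfield list \<Rightarrow> ('m, 'a) sect" where
  "d_nabla_form \<omega> \<eta> Xs =
     (\<Sum>i<length Xs. (-1) ^ i \<cdot> nabla \<omega> (Xs ! i) (\<eta> (nths Xs (- {i}))))
     + (\<Sum>j<length Xs. \<Sum>i<j.
          (-1) ^ (i + j) \<cdot> \<eta> (vbracket (Xs ! i) (Xs ! j) # nths Xs (- {i, j})))"

definition d_nabla :: "('m, 'e::real_normed_vector, 'a::real_vector) algebroid \<Rightarrow>
    ('m, 'a) cochain \<Rightarrow> nat \<Rightarrow> nat \<Rightarrow> ('m, 'a) cochain \<Rightarrow> ('m, 'a) cochain" where
  "d_nabla L \<omega> p q c = (\<lambda>k \<alpha>s \<beta>s Xs. if args L p (q + 1) k \<alpha>s \<beta>s Xs then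
     (-1) ^ k \<cdot> (d_nabla_form \<omega> (c k \<alpha>s \<beta>s) Xs
        - (\<Sum>i<k. c (k - 1) (\<beta>s ! i # \<alpha>s) (nths \<beta>s (- {i})) Xs))
     else 0)"

text \<open>The pairing of \<open>\<gamma>\<close> with a tuple of one-forms; \<open>permute_list \<sigma> Xs\<close> has \<open>i\<close>-th entry
  \<open>Xs ! \<sigma> i\<close>.\<close>

definition pairing :: "('m, 'a::real_vector) form \<Rightarrow> ('m vfield \<Rightarrow> ('m, 'a) sect) list \<Rightarrow> ('m, 'a) form"
  where
  "pairing \<gamma> \<theta>s \<beta>s Xs =
     (1 / fact (length Xs - length \<theta>s)) \<cdot>
       (\<Sum>\<sigma> | \<sigma> permutes {..<length Xs}. of_int (sign \<sigma>) \<cdot>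
          \<gamma> (map2 (\<lambda>\<theta> X. \<theta> X) \<theta>s (take (length \<theta>s) (permute_list \<sigma> Xs)) @ \<beta>s)
            (drop (length \<theta>s) (permute_list \<sigma> Xs)))"

definition shuffle_perms :: "nat \<Rightarrow> nat \<Rightarrow> (nat \<Rightarrow> nat) set" where
  "shuffle_perms a b =
     {\<sigma>. \<sigma> permutes {..<a + b} \<and> strict_mono_on {..<a} \<sigma> \<and> strict_mono_on {a..<a + b} \<sigma>}"

definition hproj :: "('m, 'e::real_normed_vector, 'a::real_vector) algebroid \<Rightarrow>
    ('m, 'a) cochain \<Rightarrow> nat \<Rightarrow> nat \<Rightarrow> ('m, 'a) cochain \<Rightarrow> ('m, 'a) cochain" where
  "hproj L \<omega> p q c = (\<lambda>k \<alpha>s \<beta>s Xs. if args L p q k \<alpha>s \<beta>s Xs then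
     (\<Sum>j=k..p. (-1) ^ (j - k) \<cdot>
        (\<Sum>\<sigma>\<in>shuffle_perms (j - k) (p - j). of_int (sign \<sigma>) \<cdot>
           pairing
             (\<lambda>\<beta>s'. c j (map (\<lambda>i. \<alpha>s ! \<sigma> i) [j - k..<p - k]) (map (conn_h \<omega>) \<beta>s @ \<beta>s'))
             (map (\<lambda>i. conn_C \<omega> (\<alpha>s ! \<sigma> i)) [0..<j - k]) [] Xs))
     else 0)"

definition D_hor :: "('m, 'e::real_normed_vector, 'a::real_vector) algebroid \<Rightarrow>
    ('m, 'a) cochain \<Rightarrow> nat \<Rightarrow> nat \<Rightarrow> ('m, 'a) cochain \<Rightarrow> ('m, 'a) cochain" where
  "D_hor L \<omega> p q c = hproj L \<omega> p (q + 1) (d_nabla L \<omega> p q c)"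

end

theory Submission
  imports Defs
begin

text \<open>
  Weil cochains are alternating multilinear maps on sections of the Lie algebroid \<open>T[1]A \<Rightarrow> T[1]M\<close>,
  and \<open>h^*\<close> is precomposition in every slot with \<open>1 - \<nu>\<close>, where the projection \<open>\<nu>\<close> sends a complete
  lift \<open>\<alpha>\<close> to \<open>\<C> \<alpha>\<close> and a core section \<open>\<beta>\<close> to \<open>v \<beta>\<close>.  Let \<open>N\<close> be the extension of \<open>\<nu>\<close> to cochains as a
  derivation.  Since \<open>\<nu>\<close> acts slotwise and is idempotent, \<open>N\<close> has eigenvalues \<open>0, \<dots>, p\<close> on cochains with
  \<open>p\<close> arguments, so that \<open>h^* = (1 - N) (1 - N/2) \<cdots> (1 - N/p)\<close> and \<open>N h^* = 0\<close>.  The conditions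
  \<open>\<delta>(\<C>, v) = 0\<close> say exactly that \<open>N\<close> commutes with \<open>\<delta>\<close>; hence so does \<open>h^*\<close>.  The commutator of
  \<open>d^\<nabla>\<close> and \<open>\<delta>\<close> is the bracket product \<open>M\<close> with \<open>(\<C>, v)\<close>, which satisfies \<open>N M = M (N + 1)\<close>, and
  therefore \<open>h^* M = M (-N) (1 - N) \<cdots> = 0\<close>.
\<close>

section \<open>Sums over deleted entries of a list\<close>

text \<open>Why a polynomial in \<open>N\<close>: the formula for h^* inserts (C, v) many times,
  spread over shuffles and pairings, whereas \<open>N\<close> inserts it once, so that commuting
  with \<delta> uses each of the two IM equations once. The shuffle formula is compared only with
  the polynomial, never with \<delta>. The eigenvalues of \<open>N\<close> are not found by
  diagonalising. Contraction with a core section in the kernel or the image of v, or with a complete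
  lift, turns a polynomial in \<open>N\<close> into itself or into its shift to
  \<open>N + 1\<close>, and induction on the number p of arguments does the rest. Once n is at least
  p, further normalised factors change nothing, so one polynomial of degree p + 1 serves both before
  and after \<delta>, which raises p. The term \<open>M\<close> has two sources: nabla is invariant
  under the action of A on K only up to the inner term [C a X, k], and [b, k] differs from nabla
  along the anchor of b by [v b, k]. The end is then \<delta> h^* d = h^* \<delta> d = h^* (d
  \<delta> - M) = h^* d \<delta>, where d is the exterior covariant derivative.\<close>

instantiation "fun" :: (type, real_vector) real_vector
begin
definition scaleR_fun_def: "r *\<^sub>R f = (\<lambda>x. r *\<^sub>R f x)"
instance
  by standard (simp_all add: scaleR_fun_def fun_eq_iff scaleR_add_right scaleR_add_left)
end

lemma scaleR_fun_apply [simp]: "(r *\<^sub>R f) x = r *\<^sub>R f x"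
  by (simp add: scaleR_fun_def)

text \<open>The alternating (\<open>e = -1\<close>) or plain (\<open>e = 1\<close>) sum of \<open>F (xs ! i) (xs without its i-th entry)\<close>;
  \<open>bsum br\<close> is the bracket term of the Chevalley-Eilenberg differential.\<close>

fun dsum :: "real \<Rightarrow> ('b \<Rightarrow> 'b list \<Rightarrow> 'v::real_vector) \<Rightarrow> 'b list \<Rightarrow> 'v" where
  "dsum e F [] = 0"
| "dsum e F (x # xs) = F x xs + e *\<^sub>R dsum e (\<lambda>y ys. F y (x # ys)) xs"

fun bsum :: "('b \<Rightarrow> 'b \<Rightarrow> 'b) \<Rightarrow> ('b \<Rightarrow> 'b list \<Rightarrow> 'v::real_vector) \<Rightarrow> 'b list \<Rightarrow> 'v" where
  "bsum br F [] = 0"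
| "bsum br F (x # xs) = bsum br (\<lambda>y ys. F y (x # ys)) xs - dsum (-1) (\<lambda>y. F (br x y)) xs"

lemma dsum_add: "dsum e (\<lambda>x xs. F x xs + G x xs) xs = dsum e F xs + dsum e G xs"
  by (induction xs arbitrary: F G) (simp_all add: scaleR_add_right)

lemma dsum_linear:
  assumes "linear f"
  shows "f (dsum e F xs) = dsum e (\<lambda>x xs. f (F x xs)) xs"
  by (induction xs arbitrary: F)
    (simp_all add: linear_0[OF assms] linear_add[OF assms] linear_scale[OF assms])

lemma dsum_scaleR: "dsum e (\<lambda>x xs. r *\<^sub>R F x xs) xs = r *\<^sub>R dsum e F xs"
  by (rule dsum_linear[symmetric]) (simp add: linear_iff scaleR_add_right)

lemma dsum_minus: "dsum e (\<lambda>x xs. - F x xs) xs = - dsum e F xs"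
  using dsum_scaleR[of e "-1" F xs] by simp

lemma dsum_diff: "dsum e (\<lambda>x xs. F x xs - G x xs) xs = dsum e F xs - dsum e G xs"
  using dsum_add[of e F "\<lambda>x xs. - G x xs" xs] by (simp add: dsum_minus)

lemma dsum_zero [simp]: "dsum e (\<lambda>x xs. 0) xs = 0"
  using dsum_scaleR[of e 0 "\<lambda>x xs. 0" xs] by simp

lemmas dsum_simps = dsum_add dsum_scaleR dsum_minus dsum_diff

lemma bsum_add: "bsum br (\<lambda>x xs. F x xs + G x xs) xs = bsum br F xs + bsum br G xs"
  by (induction xs arbitrary: F G) (simp_all add: dsum_add)

lemma bsum_linear:
  assumes "linear f"
  shows "f (bsum br F xs) = bsum br (\<lambda>x xs. f (F x xs)) xs"
  by (induction xs arbitrary: F)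
    (simp_all add: linear_0[OF assms] linear_diff[OF assms] dsum_linear[OF assms])

lemma bsum_scaleR: "bsum br (\<lambda>x xs. r *\<^sub>R F x xs) xs = r *\<^sub>R bsum br F xs"
  by (rule bsum_linear[symmetric]) (simp add: linear_iff scaleR_add_right)

lemma bsum_minus: "bsum br (\<lambda>x xs. - F x xs) xs = - bsum br F xs"
  using bsum_scaleR[of br "-1" F xs] by simp

lemma bsum_diff: "bsum br (\<lambda>x xs. F x xs - G x xs) xs = bsum br F xs - bsum br G xs"
  using bsum_add[of br F "\<lambda>x xs. - G x xs" xs] by (simp add: bsum_minus)

lemma bsum_zero [simp]: "bsum br (\<lambda>x xs. 0) xs = 0"
  using bsum_scaleR[of br 0 "\<lambda>x xs. 0" xs] by simp

lemmas bsum_simps = bsum_add bsum_scaleR bsum_minus bsum_diff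

section \<open>Exchange of iterated deletion and bracket sums\<close>

lemma dsum_dsum_comm:
  "dsum e (\<lambda>x xs. dsum e' (\<lambda>y ys. G x xs y ys) ys0) xs0 =
   dsum e' (\<lambda>y ys. dsum e (\<lambda>x xs. G x xs y ys) xs0) ys0"
  by (induction xs0 arbitrary: G) (simp_all add: dsum_simps)

lemma dsum_bsum_comm:
  "dsum e (\<lambda>x xs. bsum br (\<lambda>y ys. G x xs y ys) ys0) xs0 =
   bsum br (\<lambda>y ys. dsum e (\<lambda>x xs. G x xs y ys) xs0) ys0"
  by (induction xs0 arbitrary: G) (simp_all add: bsum_simps)

lemma bsum_bsum_comm:
  "bsum br' (\<lambda>x xs. bsum br (\<lambda>y ys. G x xs y ys) ys0) xs0 =
   bsum br (\<lambda>y ys. bsum br' (\<lambda>x xs. G x xs y ys) xs0) ys0"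
  by (induction xs0 arbitrary: G) (simp_all add: bsum_simps dsum_bsum_comm)

text \<open>Of two deleted entries, the later one moves down by one position if the earlier is
  deleted first, so exchanging their roles costs one factor \<open>e\<close>.\<close>

lemma dsum_swap:
  assumes "e * e = 1"
  shows "dsum e (\<lambda>y. dsum e (\<lambda>z zs. G y z zs)) xs = e *\<^sub>R dsum e (\<lambda>y. dsum e (\<lambda>z zs. G z y zs)) xs"
proof (induction xs arbitrary: G)
  case (Cons x xs)
  show ?case
    unfolding dsum.simps dsum_add dsum_scaleR scaleR_add_right scaleR_scaleR assms
      Cons[of "\<lambda>y z zs. G y z (x # zs)"]
    by (simp add: add_ac)
qed simp

lemma eq_neg_imp_zero:
  fixes x :: "'v::real_vector"
  assumes "x = - x" shows "x = 0"
proof -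
  have "2 *\<^sub>R x = x + - x" unfolding scaleR_2 using assms by (rule arg_cong)
  then show ?thesis by simp
qed

lemma dsum_dsum_sym_zero:
  assumes "\<And>y z zs. G z y zs = - e *\<^sub>R G y z zs" "e * e = 1"
  shows "dsum e (\<lambda>y. dsum e (\<lambda>z zs. G y z zs)) xs = 0"
proof -
  let ?S = "dsum e (\<lambda>y. dsum e (\<lambda>z zs. G y z zs)) xs"
  have sw: "(\<lambda>z zs. G z y zs) = (\<lambda>z zs. (-e) *\<^sub>R G y z zs)" for y
    by (intro ext) (rule assms(1))
  have "?S = e *\<^sub>R dsum e (\<lambda>y. dsum e (\<lambda>z zs. G z y zs)) xs"
    by (rule dsum_swap[OF assms(2)])
  also have "\<dots> = e *\<^sub>R dsum e (\<lambda>y ys. (-e) *\<^sub>R dsum e (\<lambda>z zs. G y z zs) ys) xs"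
    unfolding dsum_scaleR[symmetric] sw ..
  also have "\<dots> = (e * - e) *\<^sub>R ?S"
    unfolding dsum_scaleR scaleR_scaleR ..
  also have "\<dots> = - ?S"
    using assms(2) by simp
  finally show ?thesis by (rule eq_neg_imp_zero)
qed

text \<open>Moving the deletion of \<open>z\<close> past a bracket term costs no sign, since the
  bracket removes two entries.\<close>

lemma bsum_dsum:
  "bsum br (\<lambda>g. dsum (-1) (\<lambda>z zs. G g z zs)) xs = dsum (-1) (\<lambda>z. bsum br (\<lambda>g gs. G g z gs)) xs"
proof (induction xs arbitrary: G)
  case (Cons x xs)
  show ?case
    unfolding dsum.simps bsum.simps dsum_simps bsum_simps Cons[of "\<lambda>g z zs. G g z (x # zs)"]
    by (subst dsum_swap) simp_all
qed simp

text \<open>The double sum sees only the part of \<open>Psi\<close> that is antisymmetric in its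
  first two arguments. Through this rule bracket identities become identities of sums:
  \<open>im0\<close> in \<open>del1_N\<close>, the Jacobi identity in \<open>d1_lied\<close>, the
  action of a bracket on functions in \<open>ce_dw\<close>. The minus sign appears because the
  second entry of a pair stands at position j - 1 once the first is gone.\<close>

lemma dsum_dsum_bsum:
  assumes "\<And>x y ys. Psi x y ys - Psi y x ys = Phi (br x y) ys"
  shows "dsum (-1) (\<lambda>x. dsum (-1) (\<lambda>y ys. Psi x y ys)) xs = - bsum br Phi xs"
  using assms
proof (induction xs arbitrary: Psi Phi)
  case (Cons x xs)
  have "dsum (-1) (\<lambda>y ys. Psi x y ys) xs - dsum (-1) (\<lambda>y ys. Psi y x ys) xs
    = dsum (-1) (\<lambda>y. Phi (br x y)) xs"
    unfolding dsum_diff[symmetric] Cons.prems ..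
  then show ?case
    using Cons.IH[of "\<lambda>y z zs. Psi y z (x # zs)" "\<lambda>g gs. Phi g (x # gs)"] Cons.prems
    by (simp add: dsum_simps)
qed simp

text \<open>Covers all lengths at once. Linearity is required in the head only; adjacent swaps carry
  it to the other slots. For e = -1 such functions vanish on lists with repeated entries
  (\<open>esym_alternating\<close>).\<close>

definition esym :: "real \<Rightarrow> ('b::real_vector list \<Rightarrow> 'v::real_vector) \<Rightarrow> bool" where
  "esym e F \<longleftrightarrow> (\<forall>xs. linear (\<lambda>x. F (x # xs))) \<and>
     (\<forall>xs y z ys. F (xs @ y # z # ys) = e *\<^sub>R F (xs @ z # y # ys))"

lemma esym_linear: "esym e F \<Longrightarrow> linear (\<lambda>x. F (x # xs))"
  by (simp add: esym_def)

lemma esymI: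
  assumes "\<And>xs. linear (\<lambda>x. F (x # xs))"
    and "\<And>xs y z ys. F (xs @ y # z # ys) = e *\<^sub>R F (xs @ z # y # ys)"
  shows "esym e F"
  using assms unfolding esym_def by blast

lemma esymD:
  assumes "esym e F"
  shows "F (xs @ y # z # ys) = e *\<^sub>R F (xs @ z # y # ys)"
  using assms unfolding esym_def by blast

lemma esym_swap:
  assumes "esym e F" shows "F (x # y # xs) = e *\<^sub>R F (y # x # xs)"
  using esymD[OF assms, of "[]" x y xs] unfolding append_Nil .

lemma linear_scaleR_fun: "linear f \<Longrightarrow> linear (\<lambda>x. r *\<^sub>R f x)"
  by (simp add: linear_iff scaleR_add_right)

lemma esym_Cons:
  assumes "esym e F"
  shows "esym e (\<lambda>xs. F (x # xs))"
  unfolding esym_def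
proof (intro conjI allI)
  fix xs
  show "linear (\<lambda>y. F (x # y # xs))"
    unfolding esym_swap[OF assms, of x] by (intro linear_scaleR_fun esym_linear[OF assms])
next
  fix xs y z ys
  show "F (x # xs @ y # z # ys) = e *\<^sub>R F (x # xs @ z # y # ys)"
    using esymD[OF assms, of "x # xs" y z ys] by simp
qed

lemma esym_add:
  assumes "esym e F" "esym e G" shows "esym e (\<lambda>xs. F xs + G xs)"
proof (rule esymI)
  fix xs
  show "linear (\<lambda>x. F (x # xs) + G (x # xs))"
    by (intro linear_compose_add esym_linear[OF assms(1)] esym_linear[OF assms(2)])
next
  fix xs y z ys
  show "F (xs @ y # z # ys) + G (xs @ y # z # ys) = e *\<^sub>R (F (xs @ z # y # ys) + G (xs @ z # y # ys))"
    unfolding scaleR_add_right using esymD[OF assms(1)] esymD[OF assms(2)] by (rule arg_cong2[where f = "(+)"])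
qed

lemma esym_scaleR:
  assumes "esym e F" shows "esym e (\<lambda>xs. r *\<^sub>R F xs)"
proof (rule esymI)
  fix xs
  show "linear (\<lambda>x. r *\<^sub>R F (x # xs))"
    by (intro linear_scaleR_fun esym_linear[OF assms])
next
  fix xs y z ys
  show "r *\<^sub>R F (xs @ y # z # ys) = e *\<^sub>R r *\<^sub>R F (xs @ z # y # ys)"
    by (subst esymD[OF assms]) simp
qed

lemma esym_minus: "esym e F \<Longrightarrow> esym e (\<lambda>xs. - F xs)"
  using esym_scaleR[of e F "-1"] by simp

lemma esym_diff: "esym e F \<Longrightarrow> esym e G \<Longrightarrow> esym e (\<lambda>xs. F xs - G xs)"
  using esym_add[of e F "\<lambda>xs. - G xs"] esym_minus[of e G] by simp

lemma esym_zero: "esym e (\<lambda>xs. 0)"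
  unfolding esym_def by (simp add: linear_iff)

lemma esym_compose:
  assumes "linear f" "esym e F" shows "esym e (\<lambda>xs. f (F xs))"
proof (rule esymI)
  fix xs
  show "linear (\<lambda>x. f (F (x # xs)))"
    using linear_compose[OF esym_linear[OF assms(2)] assms(1)] by (simp add: o_def)
next
  fix xs y z ys
  show "f (F (xs @ y # z # ys)) = e *\<^sub>R f (F (xs @ z # y # ys))"
    by (subst esymD[OF assms(2)]) (rule linear_scale[OF assms(1)])
qed

lemma esym_dsum_other:
  "(\<And>x xs. esym e (F x xs)) \<Longrightarrow> esym e (\<lambda>ys. dsum e' (\<lambda>x xs. F x xs ys) xs0)"
proof (induction xs0 arbitrary: F)
  case Nil
  then show ?case by (simp add: esym_zero)
next
  case (Cons x xs)
  have "esym e (\<lambda>ys. dsum e' (\<lambda>y zs. F y (x # zs) ys) xs)"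
    by (rule Cons.IH) (rule Cons.prems)
  then show ?case
    unfolding dsum.simps by (intro esym_add esym_scaleR Cons.prems)
qed

lemma esym_bsum_other:
  "(\<And>x xs. esym e (F x xs)) \<Longrightarrow> esym e (\<lambda>ys. bsum br (\<lambda>x xs. F x xs ys) xs0)"
proof (induction xs0 arbitrary: F)
  case Nil
  then show ?case by (simp add: esym_zero)
next
  case (Cons x xs)
  have "esym e (\<lambda>ys. bsum br (\<lambda>y zs. F y (x # zs) ys) xs)"
    by (rule Cons.IH) (rule Cons.prems)
  then show ?case
    unfolding bsum.simps by (intro esym_diff esym_dsum_other Cons.prems)
qed

lemma linear_dsum:
  "(\<And>y ys. linear (\<lambda>x. F x y ys)) \<Longrightarrow> linear (\<lambda>x. dsum e (F x) ys)"
proof (induction ys arbitrary: F)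
  case Nil
  then show ?case by (simp add: linear_iff)
next
  case (Cons y ys)
  have "linear (\<lambda>x. dsum e (\<lambda>z zs. F x z (y # zs)) ys)"
    by (rule Cons.IH) (rule Cons.prems)
  then show ?case
    unfolding dsum.simps by (intro linear_compose_add linear_scaleR_fun Cons.prems)
qed

lemma linear_bsum:
  "(\<And>y ys. linear (\<lambda>x. F x y ys)) \<Longrightarrow> linear (\<lambda>x. bsum br (F x) ys)"
proof (induction ys arbitrary: F)
  case Nil
  then show ?case by (simp add: linear_iff)
next
  case (Cons y ys)
  have "linear (\<lambda>x. bsum br (\<lambda>z zs. F x z (y # zs)) ys)"
    by (rule Cons.IH) (rule Cons.prems)
  then show ?case
    unfolding bsum.simps by (intro linear_compose_sub linear_dsum Cons.prems)
qed

text \<open>Swapping two neighbours of the list exchanges the two summands in which one of them is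
  deleted, at the cost of exactly \<open>e\<close>; in all other summands the swap takes place
  inside \<open>F x\<close>.\<close>

lemma esym_dsum:
  assumes "e * e = 1" "\<And>x. esym e (F x)" "\<And>xs. linear (\<lambda>x. F x xs)"
  shows "esym e (dsum e F)"
  unfolding esym_def
proof (intro conjI allI)
  fix xs
  show "linear (\<lambda>x. dsum e F (x # xs))"
    unfolding dsum.simps
    by (intro linear_compose_add linear_scaleR_fun linear_dsum esym_linear[OF assms(2)] assms(3))
next
  fix xs y z ys
  show "dsum e F (xs @ y # z # ys) = e *\<^sub>R dsum e F (xs @ z # y # ys)"
    using assms(2,3)
  proof (induction xs arbitrary: F)
    case Nil
    have "dsum e (\<lambda>x xs. F x (y # z # xs)) ys = e *\<^sub>R dsum e (\<lambda>x xs. F x (z # y # xs)) ys"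
      unfolding dsum_scaleR[symmetric] by (simp add: esym_swap[OF Nil(1), of _ y z])
    with assms(1) show ?case by (simp add: algebra_simps)
  next
    case (Cons x xs)
    have "F x (xs @ y # z # ys) = e *\<^sub>R F x (xs @ z # y # ys)"
      by (rule esymD[OF Cons.prems(1)])
    moreover have "dsum e (\<lambda>y ys. F y (x # ys)) (xs @ y # z # ys) =
        e *\<^sub>R dsum e (\<lambda>y ys. F y (x # ys)) (xs @ z # y # ys)"
      by (rule Cons.IH) (rule esym_Cons[OF Cons.prems(1)], rule Cons.prems(2))
    ultimately show ?case by (simp add: algebra_simps)
  qed
qed

lemma esym_bsum:
  assumes "\<And>x. esym (-1) (F x)" "\<And>xs. linear (\<lambda>x. F x xs)"
    and "\<And>x y. br x y = - br y x" "\<And>x. linear (br x)"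
  shows "esym (-1) (bsum br F)"
  unfolding esym_def
proof (intro conjI allI)
  have l: "linear (\<lambda>x. br x y)" for y
    unfolding assms(3)[of _ y] by (intro linear_compose_neg assms(4))
  fix xs
  show "linear (\<lambda>x. bsum br F (x # xs))"
    unfolding bsum.simps
    by (intro linear_compose_sub linear_bsum linear_dsum esym_linear[OF assms(1)]
      linear_compose[OF l assms(2), unfolded o_def])
next
  fix xs y z ys
  show "bsum br F (xs @ y # z # ys) = (-1) *\<^sub>R bsum br F (xs @ z # y # ys)"
    using assms(1,2)
  proof (induction xs arbitrary: F)
    case Nil
    have "bsum br (\<lambda>x xs. F x (y # z # xs)) ys = - bsum br (\<lambda>x xs. F x (z # y # xs)) ys"
      unfolding bsum_minus[symmetric] by (simp add: esym_swap[OF Nil(1), of _ y z])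
    moreover have "F (br y z) ys = - F (br z y) ys"
      by (subst assms(3)) (rule linear_neg[OF Nil(2)])
    ultimately show ?case by (simp add: algebra_simps)
  next
    case (Cons x xs)
    have "esym (-1) (dsum (-1) (\<lambda>y. F (br x y)))"
      using linear_compose[OF assms(4) Cons.prems(2)] by (intro esym_dsum Cons.prems) (auto simp: o_def)
    moreover have "bsum br (\<lambda>y ys. F y (x # ys)) (xs @ y # z # ys) =
        (-1) *\<^sub>R bsum br (\<lambda>y ys. F y (x # ys)) (xs @ z # y # ys)"
      by (rule Cons.IH) (rule esym_Cons[OF Cons.prems(1)], rule Cons.prems(2))
    ultimately show ?case using esymD[of "-1" "dsum (-1) (\<lambda>y. F (br x y))" xs y z ys] by simp
  qed
qed

lemma esym_altD:
  assumes "esym (-1) F" shows "F (x # y # xs) = - F (y # x # xs)"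
  using esym_swap[OF assms, of x y xs] by simp

lemma esym_symD:
  assumes "esym 1 F" shows "F (x # y # xs) = F (y # x # xs)"
  using esym_swap[OF assms, of x y xs] by simp

section \<open>The algebra of cochains\<close>

lemma dsum_cong:
  assumes "\<And>x ys. x \<in> set xs \<Longrightarrow> set ys \<subseteq> set xs \<Longrightarrow> length xs = Suc (length ys) \<Longrightarrow> F x ys = G x ys"
  shows "dsum e F xs = dsum e G xs"
  using assms
proof (induction xs arbitrary: F G)
  case (Cons x xs)
  have "dsum e (\<lambda>y ys. F y (x # ys)) xs = dsum e (\<lambda>y ys. G y (x # ys)) xs"
    by (rule Cons.IH, rule Cons.prems) auto
  moreover have "F x xs = G x xs" by (rule Cons.prems) auto
  ultimately show ?case by simp
qed simp

lemma bsum_cong: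
  assumes "\<And>x y ys. x \<in> set xs \<Longrightarrow> y \<in> set xs \<Longrightarrow> set ys \<subseteq> set xs \<Longrightarrow>
    length xs = Suc (Suc (length ys)) \<Longrightarrow> F (br x y) ys = G (br x y) ys"
  shows "bsum br F xs = bsum br G xs"
  using assms
proof (induction xs arbitrary: F G)
  case (Cons x xs)
  have "bsum br (\<lambda>y ys. F y (x # ys)) xs = bsum br (\<lambda>y ys. G y (x # ys)) xs"
    by (rule Cons.IH, rule Cons.prems) auto
  moreover have "dsum (-1) (\<lambda>y. F (br x y)) xs = dsum (-1) (\<lambda>y. G (br x y)) xs"
    by (rule dsum_cong, rule Cons.prems) auto
  ultimately show ?case by simp
qed simp

lemma esym_sign_length:
  assumes "esym e F"
  shows "esym e (\<lambda>xs. (-1) ^ length xs *\<^sub>R F xs)"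
proof (rule esymI)
  fix xs
  show "linear (\<lambda>x. (-1) ^ length (x # xs) *\<^sub>R F (x # xs))"
    unfolding list.size(4) by (rule linear_scaleR_fun) (rule esym_linear[OF assms])
next
  fix xs y z ys
  show "(-1) ^ length (xs @ y # z # ys) *\<^sub>R F (xs @ y # z # ys) =
      e *\<^sub>R (-1) ^ length (xs @ z # y # ys) *\<^sub>R F (xs @ z # y # ys)"
    by (subst esymD[OF assms]) simp
qed

lemma dsum_in_subspace:
  assumes K: "subspace K" and "\<And>x ys. F x ys \<in> K"
  shows "dsum e F xs \<in> K"
  using assms(2)
proof (induction xs arbitrary: F)
  case Nil
  then show ?case by (simp add: subspace_0[OF K])
next
  case (Cons x xs)
  have "dsum e (\<lambda>y ys. F y (x # ys)) xs \<in> K"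
    by (rule Cons.IH) (rule Cons.prems)
  then show ?case
    unfolding dsum.simps by (intro subspace_add[OF K] subspace_scale[OF K] Cons.prems)
qed

lemma bsum_in_subspace:
  assumes K: "subspace K" and "\<And>x ys. F x ys \<in> K"
  shows "bsum br F xs \<in> K"
  using assms(2)
proof (induction xs arbitrary: F)
  case Nil
  then show ?case by (simp add: subspace_0[OF K])
next
  case (Cons x xs)
  have "bsum br (\<lambda>y ys. F y (x # ys)) xs \<in> K"
    by (rule Cons.IH) (rule Cons.prems)
  then show ?case
    unfolding bsum.simps by (intro subspace_diff[OF K] dsum_in_subspace[OF K] Cons.prems)
qed

text \<open>Cochains of all bidegrees at once: the bidegree is read off the lengths of the three lists.\<close>

type_synonym ('g, 'x) tcochain = "'g list \<Rightarrow> 'g list \<Rightarrow> 'x list \<Rightarrow> 'g"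

text \<open>The factor (-1)^k of both differentials is kept apart: the sign-free parts are handled
  first, and \<open>sg\<close> then turns anticommutation with an operator that changes k by one
  into commutation.\<close>

definition sg :: "('g::real_vector, 'x) tcochain \<Rightarrow> ('g, 'x) tcochain" where
  "sg c = (\<lambda>as bs Xs. (-1) ^ length bs *\<^sub>R c as bs Xs)"

text \<open>\<open>br\<close>, \<open>vbr\<close>, \<open>rh\<close> stand for the brackets of sections and of vector fields and the anchor, extended
  from sections and vector fields to ambient real vector spaces by means of linear projections, so
  that no membership conditions on arguments are needed.\<close>

locale im_algebra =
  fixes br :: "'g::real_vector \<Rightarrow> 'g \<Rightarrow> 'g"
    and vbr :: "'x::real_vector \<Rightarrow> 'x \<Rightarrow> 'x"
    and rh :: "'g \<Rightarrow> 'x"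
    and K :: "'g set"
    and C :: "'g \<Rightarrow> 'x \<Rightarrow> 'g"
    and v :: "'g \<Rightarrow> 'g"
  assumes linear_br: "linear (br a)"
    and br_anti: "br a b = - br b a"
    and linear_vbr: "linear (vbr X)"
    and vbr_anti: "vbr X Y = - vbr Y X"
    and vbr_jacobi: "vbr X (vbr Y Z) + vbr Y (vbr Z X) + vbr Z (vbr X Y) = 0"
    and linear_rh: "linear rh"
    and subspace_K: "subspace K"
    and br_K: "k \<in> K \<Longrightarrow> br a k \<in> K"
    and rh_K: "k \<in> K \<Longrightarrow> rh k = 0"
    and C_K: "C a X \<in> K"
    and v_K: "v a \<in> K"
    and v_on_K: "k \<in> K \<Longrightarrow> v k = k"
    and linear_v: "linear v"
    and linear_C1: "linear (\<lambda>a. C a X)"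
    and linear_C2: "linear (C a)"
    and im0: "br a (C b X) - C b (vbr (rh a) X) - (br b (C a X) - C a (vbr (rh b) X)) = C (br a b) X"
    and im1: "br a (v b) - v (br a b) = C a (rh b)"
begin

lemma linear_br': "linear (\<lambda>a. br a b)"
  unfolding br_anti[of _ b] by (intro linear_compose_neg linear_br)

lemma linear_vbr': "linear (\<lambda>a. vbr a b)"
  unfolding vbr_anti[of _ b] by (intro linear_compose_neg linear_vbr)

lemmas lin_simps =
  linear_add[OF linear_br] linear_diff[OF linear_br] linear_neg[OF linear_br] linear_0[OF linear_br]
  linear_scale[OF linear_br] dsum_linear[OF linear_br] bsum_linear[OF linear_br]
  linear_add[OF linear_C1] linear_diff[OF linear_C1] linear_neg[OF linear_C1] linear_0[OF linear_C1]
  linear_scale[OF linear_C1] dsum_linear[OF linear_C1] bsum_linear[OF linear_C1]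

definition lied where
  "lied a c as bs Xs = br a (c as bs Xs) - dsum 1 (\<lambda>b bs. c as (br a b # bs) Xs) bs
     - dsum (-1) (\<lambda>X Ys. c as bs (vbr (rh a) X # Ys)) Xs"

definition del1 :: "('g, 'x) tcochain \<Rightarrow> ('g, 'x) tcochain" where
  "del1 c = (\<lambda>as bs Xs. dsum (-1) (\<lambda>a as. lied a c as bs Xs) as + bsum br (\<lambda>g as. c (g # as) bs Xs) as)"

definition del2 :: "('g, 'x) tcochain \<Rightarrow> ('g, 'x) tcochain" where
  "del2 c = (\<lambda>as bs Xs. dsum 1 (\<lambda>b bs. c as bs (rh b # Xs)) bs)"

definition del :: "('g, 'x) tcochain \<Rightarrow> ('g, 'x) tcochain" where
  "del c = sg (del1 c - del2 c)"

definition d1 :: "('g, 'x) tcochain \<Rightarrow> ('g, 'x) tcochain" where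
  "d1 c = (\<lambda>as bs Xs. dsum (-1) (\<lambda>X Ys. C (c as bs Ys) X) Xs + bsum vbr (\<lambda>X Ys. c as bs (X # Ys)) Xs)"

definition d2 :: "('g, 'x) tcochain \<Rightarrow> ('g, 'x) tcochain" where
  "d2 c = (\<lambda>as bs Xs. dsum 1 (\<lambda>b bs. c (b # as) bs Xs) bs)"

definition dn :: "('g, 'x) tcochain \<Rightarrow> ('g, 'x) tcochain" where
  "dn c = sg (d1 c - d2 c)"

text \<open>The derivation \<open>N\<close> acts on core sections by \<open>N1\<close> and on complete lifts by \<open>N2\<close>.\<close>

definition N1 :: "('g, 'x) tcochain \<Rightarrow> ('g, 'x) tcochain" where
  "N1 c = (\<lambda>as bs Xs. dsum 1 (\<lambda>b bs. c as (v b # bs) Xs) bs)"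

definition N2 :: "('g, 'x) tcochain \<Rightarrow> ('g, 'x) tcochain" where
  "N2 c = (\<lambda>as bs Xs. dsum (-1) (\<lambda>a as. dsum (-1) (\<lambda>X Ys. c as (C a X # bs) Ys) Xs) as)"

definition N :: "('g, 'x) tcochain \<Rightarrow> ('g, 'x) tcochain" where
  "N c = N1 c + N2 c"

definition M1 :: "('g, 'x) tcochain \<Rightarrow> ('g, 'x) tcochain" where
  "M1 c = (\<lambda>as bs Xs. dsum (-1) (\<lambda>a as. dsum (-1) (\<lambda>X Ys. br (C a X) (c as bs Ys)) Xs) as)"

definition M2 :: "('g, 'x) tcochain \<Rightarrow> ('g, 'x) tcochain" where
  "M2 c = (\<lambda>as bs Xs. dsum 1 (\<lambda>b bs. br (v b) (c as bs Xs)) bs)"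

definition M :: "('g, 'x) tcochain \<Rightarrow> ('g, 'x) tcochain" where
  "M c = M1 c + M2 c"

text \<open>No bidegree is imposed, so that every operator acts on one space. Linearity is over the
  reals here; the behaviour under multiplication by functions is the separate predicate
  \<open>flin\<close>.\<close>

definition coch :: "('g, 'x) tcochain \<Rightarrow> bool" where
  "coch c \<longleftrightarrow> (\<forall>bs Xs. esym (-1) (\<lambda>as. c as bs Xs)) \<and> (\<forall>as Xs. esym 1 (\<lambda>bs. c as bs Xs)) \<and>
     (\<forall>as bs. esym (-1) (c as bs)) \<and> (\<forall>as bs Xs. c as bs Xs \<in> K)"

lemma cochI:
  assumes "\<And>bs Xs. esym (-1) (\<lambda>as. c as bs Xs)" "\<And>as Xs. esym 1 (\<lambda>bs. c as bs Xs)"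
    "\<And>as bs. esym (-1) (c as bs)" "\<And>as bs Xs. c as bs Xs \<in> K"
  shows "coch c"
  using assms by (simp add: coch_def)

lemma cochD:
  assumes "coch c"
  shows coch_alpha: "esym (-1) (\<lambda>as. c as bs Xs)" and coch_beta: "esym 1 (\<lambda>bs. c as bs Xs)"
    and coch_X: "esym (-1) (c as bs)" and coch_K: "c as bs Xs \<in> K"
  using assms by (simp_all add: coch_def)

lemma coch_add: "coch c \<Longrightarrow> coch c' \<Longrightarrow> coch (c + c')"
  by (rule cochI) (auto intro: esym_add cochD subspace_add[OF subspace_K] simp: plus_fun_def)

lemma coch_diff: "coch c \<Longrightarrow> coch c' \<Longrightarrow> coch (c - c')"
  by (rule cochI) (auto intro: esym_diff cochD subspace_diff[OF subspace_K] simp: fun_diff_def)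

lemma coch_scaleR: "coch c \<Longrightarrow> coch (r *\<^sub>R c)"
  by (rule cochI) (auto intro: esym_scaleR cochD subspace_scale[OF subspace_K] simp: scaleR_fun_def)

lemma coch_sg: "coch c \<Longrightarrow> coch (sg c)"
  unfolding sg_def by (rule cochI) (auto intro: esym_sign_length esym_scaleR cochD subspace_scale[OF subspace_K])

context
  fixes c :: "('g, 'x) tcochain"
  assumes c: "coch c"
begin

lemma lin_alpha: "linear (\<lambda>a. c (a # as) bs Xs)" by (rule esym_linear[OF coch_alpha[OF c]])
lemma lin_beta: "linear (\<lambda>b. c as (b # bs) Xs)" by (rule esym_linear[OF coch_beta[OF c]])
lemma lin_X: "linear (\<lambda>X. c as bs (X # Xs))" by (rule esym_linear[OF coch_X[OF c]])

lemma esym_beta_head: "linear f \<Longrightarrow> esym 1 (dsum 1 (\<lambda>b bs. c as (f b # bs) Xs))"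
  by (rule esym_dsum) (simp, rule esym_Cons[OF coch_beta[OF c]], rule linear_compose[OF _ lin_beta, unfolded o_def])

lemma esym_X_head: "linear f \<Longrightarrow> esym (-1) (dsum (-1) (\<lambda>X Ys. c as bs (f X # Ys)))"
  by (rule esym_dsum) (simp, rule esym_Cons[OF coch_X[OF c]], rule linear_compose[OF _ lin_X, unfolded o_def])

lemma coch_lied: "coch (lied a c)"
proof (rule cochI, goal_cases)
  case (1 bs Xs)
  show ?case unfolding lied_def
    by (intro esym_diff esym_compose[OF linear_br] coch_alpha[OF c] esym_dsum_other)
next
  case (2 as Xs)
  show ?case unfolding lied_def
    by (intro esym_diff esym_compose[OF linear_br] coch_beta[OF c] esym_dsum_other
      esym_beta_head linear_br)
next
  case (3 as bs)
  show ?case unfolding lied_def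
    by (intro esym_diff esym_compose[OF linear_br] coch_X[OF c] esym_dsum_other
      esym_X_head linear_vbr)
next
  case (4 as bs Xs)
  show ?case unfolding lied_def
    by (intro subspace_diff[OF subspace_K] br_K coch_K[OF c] dsum_in_subspace[OF subspace_K])
qed

lemma linear_lied: "linear (\<lambda>a. lied a c as bs Xs)"
  unfolding lied_def
  by (intro linear_compose_sub linear_br' linear_dsum linear_compose[OF linear_br' lin_beta, unfolded o_def]
    linear_compose[OF linear_compose[OF linear_rh linear_vbr'] lin_X, unfolded o_def])

lemma coch_del1: "coch (del1 c)"
proof (rule cochI, goal_cases)
  case (1 bs Xs)
  show ?case unfolding del1_def
    by (intro esym_add esym_dsum esym_bsum coch_alpha[OF coch_lied] linear_lied esym_Cons[OF coch_alpha[OF c]]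
      lin_alpha linear_br br_anti) simp
next
  case (2 as Xs)
  show ?case unfolding del1_def
    by (intro esym_add esym_dsum_other esym_bsum_other coch_beta[OF coch_lied] coch_beta[OF c])
next
  case (3 as bs)
  show ?case unfolding del1_def
    by (intro esym_add esym_dsum_other esym_bsum_other coch_X[OF coch_lied] coch_X[OF c])
next
  case (4 as bs Xs)
  show ?case unfolding del1_def
    by (intro subspace_add[OF subspace_K] dsum_in_subspace[OF subspace_K] bsum_in_subspace[OF subspace_K]
      coch_K[OF coch_lied] coch_K[OF c])
qed

lemma coch_del2: "coch (del2 c)"
proof (rule cochI, goal_cases)
  case (1 bs Xs)
  show ?case unfolding del2_def by (intro esym_dsum_other coch_alpha[OF c])
next
  case (2 as Xs)
  show ?case unfolding del2_def
    by (intro esym_dsum coch_beta[OF c] linear_compose[OF linear_rh lin_X, unfolded o_def]) simp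
next
  case (3 as bs)
  show ?case unfolding del2_def by (intro esym_dsum_other esym_Cons[OF coch_X[OF c]])
next
  case (4 as bs Xs)
  show ?case unfolding del2_def by (intro dsum_in_subspace[OF subspace_K] coch_K[OF c])
qed

lemma coch_d1: "coch (d1 c)"
proof (rule cochI, goal_cases)
  case (1 bs Xs)
  show ?case unfolding d1_def
    by (intro esym_add esym_dsum_other esym_bsum_other esym_compose[OF linear_C1] coch_alpha[OF c])
next
  case (2 as Xs)
  show ?case unfolding d1_def
    by (intro esym_add esym_dsum_other esym_bsum_other esym_compose[OF linear_C1] coch_beta[OF c])
next
  case (3 as bs)
  show ?case unfolding d1_def
    by (intro esym_add esym_dsum esym_bsum esym_compose[OF linear_C1] coch_X[OF c] linear_C2
      esym_Cons[OF coch_X[OF c]] lin_X linear_vbr vbr_anti) simp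
next
  case (4 as bs Xs)
  show ?case unfolding d1_def
    by (intro subspace_add[OF subspace_K] dsum_in_subspace[OF subspace_K] bsum_in_subspace[OF subspace_K]
      C_K coch_K[OF c])
qed

lemma coch_d2: "coch (d2 c)"
proof (rule cochI, goal_cases)
  case (1 bs Xs)
  show ?case unfolding d2_def by (intro esym_dsum_other esym_Cons[OF coch_alpha[OF c]])
next
  case (2 as Xs)
  show ?case unfolding d2_def by (intro esym_dsum coch_beta[OF c] lin_alpha) simp
next
  case (3 as bs)
  show ?case unfolding d2_def by (intro esym_dsum_other coch_X[OF c])
next
  case (4 as bs Xs)
  show ?case unfolding d2_def by (intro dsum_in_subspace[OF subspace_K] coch_K[OF c])
qed

lemma coch_N1: "coch (N1 c)"
proof (rule cochI, goal_cases)
  case (1 bs Xs)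
  show ?case unfolding N1_def by (intro esym_dsum_other coch_alpha[OF c])
next
  case (2 as Xs)
  show ?case unfolding N1_def by (intro esym_beta_head linear_v)
next
  case (3 as bs)
  show ?case unfolding N1_def by (intro esym_dsum_other coch_X[OF c])
next
  case (4 as bs Xs)
  show ?case unfolding N1_def by (intro dsum_in_subspace[OF subspace_K] coch_K[OF c])
qed

lemma coch_N2: "coch (N2 c)"
proof (rule cochI, goal_cases)
  case (1 bs Xs)
  show ?case unfolding N2_def
    by (intro esym_dsum esym_dsum_other coch_alpha[OF c] linear_dsum
      linear_compose[OF linear_C1 lin_beta, unfolded o_def]) simp
next
  case (2 as Xs)
  show ?case unfolding N2_def by (intro esym_dsum_other esym_Cons[OF coch_beta[OF c]])
next
  case (3 as bs)
  show ?case unfolding N2_def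
    by (intro esym_dsum_other esym_dsum coch_X[OF c] linear_compose[OF linear_C2 lin_beta, unfolded o_def]) simp
next
  case (4 as bs Xs)
  show ?case unfolding N2_def by (intro dsum_in_subspace[OF subspace_K] coch_K[OF c])
qed

end

lemma coch_del: "coch c \<Longrightarrow> coch (del c)"
  unfolding del_def by (intro coch_sg coch_diff coch_del1 coch_del2)

lemma coch_dn: "coch c \<Longrightarrow> coch (dn c)"
  unfolding dn_def by (intro coch_sg coch_diff coch_d1 coch_d2)

lemma coch_N: "coch c \<Longrightarrow> coch (N c)"
  unfolding N_def by (intro coch_add coch_N1 coch_N2)

end

section \<open>Signs and additivity of the operators\<close>

lemma dsum_sign_Suc:
  "dsum e (\<lambda>x ys. (-1) ^ Suc (length ys) *\<^sub>R F x ys) xs = (-1) ^ length xs *\<^sub>R dsum e F xs"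
  unfolding dsum_scaleR[symmetric] by (rule dsum_cong) simp

lemma dsum_sign:
  "dsum e (\<lambda>x ys. (-1) ^ length ys *\<^sub>R F x ys) xs = - ((-1) ^ length xs *\<^sub>R dsum e F xs)"
  unfolding dsum_scaleR[symmetric] dsum_minus[symmetric] by (rule dsum_cong) simp

lemma dsum_comm3:
  "dsum e (\<lambda>x xs. dsum e' (\<lambda>y ys. dsum e'' (\<lambda>z zs. G x xs y ys z zs) (Z y ys)) ys0) xs0 =
   dsum e' (\<lambda>y ys. dsum e'' (\<lambda>z zs. dsum e (\<lambda>x xs. G x xs y ys z zs) xs0) (Z y ys)) ys0"
  by (rule trans[OF dsum_dsum_comm dsum_cong]) (rule dsum_dsum_comm)

lemma sg_sg: "sg (sg c) = c"
  by (simp add: sg_def fun_eq_iff flip: power_add)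

lemma sg_add: "sg (c + c') = sg c + sg c'"
  by (simp add: sg_def fun_eq_iff scaleR_add_right)

lemma sg_diff: "sg (c - c') = sg c - sg c'"
  by (simp add: sg_def fun_eq_iff scaleR_diff_right)

lemma sg_minus: "sg (- c) = - sg c"
  by (simp add: sg_def fun_eq_iff)

context im_algebra
begin

lemma lied_sg: "lied a (sg c) as bs Xs = (-1) ^ length bs *\<^sub>R lied a c as bs Xs"
  by (simp add: lied_def sg_def lin_simps dsum_scaleR dsum_sign_Suc scaleR_diff_right del: power_Suc)

lemma del1_sg: "del1 (sg c) = sg (del1 c)"
  by (simp add: del1_def fun_eq_iff lied_sg dsum_scaleR scaleR_add_right)
     (simp add: sg_def bsum_scaleR dsum_scaleR scaleR_add_right)

lemma d1_sg: "d1 (sg c) = sg (d1 c)"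
  by (simp add: d1_def fun_eq_iff sg_def lin_simps bsum_scaleR dsum_scaleR scaleR_add_right)

lemma del2_sg: "del2 (sg c) = - sg (del2 c)"
  by (simp add: del2_def fun_eq_iff sg_def dsum_sign)

lemma d2_sg: "d2 (sg c) = - sg (d2 c)"
  by (simp add: d2_def fun_eq_iff sg_def dsum_sign)

lemma N1_sg: "N1 (sg c) = sg (N1 c)"
  by (simp add: N1_def fun_eq_iff sg_def dsum_sign_Suc del: power_Suc)

lemma N2_sg: "N2 (sg c) = - sg (N2 c)"
  by (simp add: N2_def fun_eq_iff sg_def dsum_scaleR dsum_minus)

lemma del1_diff: "del1 (c - c') = del1 c - del1 c'"
  by (simp add: del1_def lied_def fun_eq_iff dsum_simps bsum_simps lin_simps)

lemma d1_diff: "d1 (c - c') = d1 c - d1 c'"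
  by (simp add: d1_def fun_eq_iff dsum_simps bsum_simps lin_simps)

lemma del2_diff: "del2 (c - c') = del2 c - del2 c'"
  by (simp add: del2_def fun_eq_iff dsum_simps)

lemma d2_diff: "d2 (c - c') = d2 c - d2 c'"
  by (simp add: d2_def fun_eq_iff dsum_simps)

lemma N1_diff: "N1 (c - c') = N1 c - N1 c'"
  by (simp add: N1_def fun_eq_iff dsum_simps)

lemma N2_diff: "N2 (c - c') = N2 c - N2 c'"
  by (simp add: N2_def fun_eq_iff dsum_simps)

lemma del1_add: "del1 (c + c') = del1 c + del1 c'"
  by (simp add: del1_def lied_def fun_eq_iff dsum_simps bsum_simps lin_simps)

lemma del2_add: "del2 (c + c') = del2 c + del2 c'"
  by (simp add: del2_def fun_eq_iff dsum_simps)

section \<open>The derivation \<open>N\<close> and the simplicial differential\<close>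

context
  fixes c :: "('g, 'x) tcochain"
  assumes c: "coch c"
begin

lemma c_beta_swap: "c as (b # b' # bs) Xs = c as (b' # b # bs) Xs"
  by (rule esym_symD[OF coch_beta[OF c]])

lemma c_X_swap: "c as bs (X # Y # Xs) = - c as bs (Y # X # Xs)"
  by (rule esym_altD[OF coch_X[OF c]])

lemma c_alpha_swap: "c (a # a' # as) bs Xs = - c (a' # a # as) bs Xs"
  by (rule esym_altD[OF coch_alpha[OF c]])

text \<open>By \<open>im1\<close>, \<open>v\<close> fails to commute with \<open>br a\<close> by
  \<open>C a (rh b)\<close>. Applied in each core slot this is the whole defect, since the terms in
  which two different core slots are hit agree in both orders.\<close>

lemma lied_N1:
  "lied a (N1 c) as bs Xs - N1 (lied a c) as bs Xs = dsum 1 (\<lambda>b bs. c as (C a (rh b) # bs) Xs) bs"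
proof -
  have sw: "dsum 1 (\<lambda>b. dsum 1 (\<lambda>b' bs. c as (v b' # br a b # bs) Xs)) bs
      = dsum 1 (\<lambda>b. dsum 1 (\<lambda>b' bs. c as (br a b' # v b # bs) Xs)) bs"
    by (subst dsum_swap) (simp_all add: c_beta_swap[of _ "v _" "br _ _"])
  have X: "dsum (-1) (\<lambda>X Ys. dsum 1 (\<lambda>b bs. c as (v b # bs) (vbr (rh a) X # Ys)) bs) Xs =
      dsum 1 (\<lambda>b bs. dsum (-1) (\<lambda>X Ys. c as (v b # bs) (vbr (rh a) X # Ys)) Xs) bs"
    by (rule dsum_dsum_comm)
  have im: "c as (C a (rh b) # bs) Xs = c as (br a (v b) # bs) Xs - c as (v (br a b) # bs) Xs" for b bs
    unfolding im1[symmetric] by (rule linear_diff[OF lin_beta[OF c]])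
  show ?thesis
    unfolding lied_def N1_def im
    by (simp add: dsum_simps lin_simps sw X)
qed

text \<open>The extra sum is the failure of \<open>C\<close> to be equivariant under
  \<open>a\<close>. Only its part antisymmetric in \<open>a\<close> and \<open>a'\<close> is
  controlled, by \<open>im0\<close>, so it can be simplified only after summation over
  \<open>a\<close> in \<open>del1_N\<close>.\<close>

lemma lied_N2:
  "lied a (N2 c) as bs Xs = N2 (lied a c) as bs Xs +
    dsum (-1) (\<lambda>a' as. dsum (-1) (\<lambda>X Ys.
      c as (br a (C a' X) # bs) Ys - c as (C a' (vbr (rh a) X) # bs) Ys) Xs) as"
proof -
  have B: "dsum 1 (\<lambda>b bs. dsum (-1) (\<lambda>a' as. dsum (-1) (\<lambda>X Ys. c as (C a' X # br a b # bs) Ys) Xs) as) bs =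
     dsum (-1) (\<lambda>a' as. dsum (-1) (\<lambda>X Ys. dsum 1 (\<lambda>b bs. c as (br a b # C a' X # bs) Ys) bs) Xs) as"
    by (subst dsum_comm3) (simp add: c_beta_swap[of _ "C _ _" "br _ _"])
  have X: "dsum (-1) (\<lambda>Y Ys. dsum (-1) (\<lambda>a' as. dsum (-1) (\<lambda>X Ys. c as (C a' X # bs) (vbr (rh a) Y # Ys)) Ys) as) Xs =
     - dsum (-1) (\<lambda>a' as. dsum (-1) (\<lambda>X. dsum (-1) (\<lambda>Y Ys. c as (C a' X # bs) (vbr (rh a) Y # Ys))) Xs) as"
    unfolding dsum_minus[symmetric]
    by (rule trans[OF dsum_dsum_comm dsum_cong], rule trans[OF dsum_swap])
      (simp_all add: dsum_minus)
  show ?thesis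
    unfolding lied_def N2_def
    by (simp add: dsum_simps lin_simps B X) (rule dsum_dsum_comm)
qed

text \<open>\<open>N2\<close> and \<open>del1\<close> both delete complete lifts with alternating
  signs, hence the minus sign, which \<open>sg\<close> removes in \<open>del_N\<close>. The leftover
  sum from \<open>im1\<close> cancels there against the one in \<open>del2_N2\<close>.\<close>

lemma del1_N:
  "del1 (N1 c) + del1 (N2 c) = N1 (del1 c) - N2 (del1 c) +
     (\<lambda>as bs Xs. dsum 1 (\<lambda>b bs. dsum (-1) (\<lambda>a as. c as (C a (rh b) # bs) Xs) as) bs)"
proof (intro ext)
  fix as bs :: "'g list" and Xs :: "'x list"
  have 1: "dsum (-1) (\<lambda>a as. lied a (N1 c) as bs Xs) as =
     dsum 1 (\<lambda>b bs. dsum (-1) (\<lambda>a as. lied a c as (v b # bs) Xs) as) bs +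
     dsum 1 (\<lambda>b bs. dsum (-1) (\<lambda>a as. c as (C a (rh b) # bs) Xs) as) bs"
    using lied_N1[unfolded diff_eq_eq]
    by (simp add: dsum_add N1_def dsum_dsum_comm[of "-1" 1])
  have 2: "dsum (-1) (\<lambda>a as. lied a (N2 c) as bs Xs) as =
     - dsum (-1) (\<lambda>a' as. dsum (-1) (\<lambda>X Ys. dsum (-1) (\<lambda>a as. lied a c as (C a' X # bs) Ys) as) Xs) as
     - bsum br (\<lambda>g as. dsum (-1) (\<lambda>X Ys. c as (C g X # bs) Ys) Xs) as"
  proof -
    \<comment> \<open>Antisymmetrised in \<open>a\<close> and \<open>a'\<close>, the extra sum of
      \<open>lied_N2\<close> is the left side of \<open>im0\<close>, so it turns into
      \<open>C\<close> of brackets. This cancels the summands of fact 4 in which \<open>N2\<close>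
      hits the bracket itself.\<close>
    have "dsum (-1) (\<lambda>a. dsum (-1) (\<lambda>a' as. dsum (-1) (\<lambda>X Ys.
        c as (br a (C a' X) # bs) Ys - c as (C a' (vbr (rh a) X) # bs) Ys) Xs)) as =
      - bsum br (\<lambda>g as. dsum (-1) (\<lambda>X Ys. c as (C g X # bs) Ys) Xs) as"
      unfolding linear_diff[OF lin_beta[OF c], symmetric]
      by (rule dsum_dsum_bsum)
        (simp only: dsum_diff[symmetric] linear_diff[OF lin_beta[OF c], symmetric] im0)
    moreover have "dsum (-1) (\<lambda>a as. N2 (lied a c) as bs Xs) as =
      - dsum (-1) (\<lambda>a' as. dsum (-1) (\<lambda>X Ys. dsum (-1) (\<lambda>a as. lied a c as (C a' X # bs) Ys) as) Xs) as"
    proof -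
      have "dsum (-1) (\<lambda>a as. N2 (lied a c) as bs Xs) as =
        (-1) *\<^sub>R dsum (-1) (\<lambda>a'. dsum (-1) (\<lambda>a as. dsum (-1) (\<lambda>X Ys. lied a c as (C a' X # bs) Ys) Xs)) as"
        unfolding N2_def by (rule dsum_swap) simp
      also have "\<dots> = (-1) *\<^sub>R dsum (-1) (\<lambda>a' as. dsum (-1) (\<lambda>X Ys. dsum (-1) (\<lambda>a as. lied a c as (C a' X # bs) Ys) as) Xs) as"
        by (intro arg_cong[where f = "(*\<^sub>R) (-1)"] dsum_cong dsum_dsum_comm)
      finally show ?thesis by simp
    qed
    ultimately show ?thesis
      unfolding lied_N2 by (simp add: dsum_add)
  qed
  have 3: "bsum br (\<lambda>g as. N1 c (g # as) bs Xs) as = dsum 1 (\<lambda>b bs. bsum br (\<lambda>g as. c (g # as) (v b # bs) Xs) as) bs"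
    unfolding N1_def by (rule dsum_bsum_comm[symmetric])
  have 4: "bsum br (\<lambda>g as. N2 c (g # as) bs Xs) as =
     bsum br (\<lambda>g as. dsum (-1) (\<lambda>X Ys. c as (C g X # bs) Ys) Xs) as
     - dsum (-1) (\<lambda>a as. dsum (-1) (\<lambda>X Ys. bsum br (\<lambda>g as. c (g # as) (C a X # bs) Ys) as) Xs) as"
    unfolding N2_def by (simp add: bsum_simps bsum_dsum dsum_bsum_comm)
  show "(del1 (N1 c) + del1 (N2 c)) as bs Xs = (N1 (del1 c) - N2 (del1 c) +
     (\<lambda>as bs Xs. dsum 1 (\<lambda>b bs. dsum (-1) (\<lambda>a as. c as (C a (rh b) # bs) Xs) as) bs)) as bs Xs"
    unfolding del1_def plus_fun_apply minus_apply 1 2 3 4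
    by (simp add: N1_def N2_def dsum_add)
qed

text \<open>The only summand in which both operators hit the same slot contains
  \<open>rh (v b)\<close>, and the anchor kills K.\<close>

lemma del2_N1: "del2 (N1 c) = N1 (del2 c)"
proof (intro ext)
  fix as bs :: "'g list" and Xs :: "'x list"
  have "c as bs (rh (v b) # Xs) = 0" for b bs
    by (simp add: rh_K v_K linear_0[OF lin_X[OF c]])
  then show "del2 (N1 c) as bs Xs = N1 (del2 c) as bs Xs"
    unfolding del2_def N1_def by (simp add: dsum_add) (subst dsum_swap, simp_all)
qed

text \<open>The leftover sum arises when \<open>N2\<close> uses up the vector field
  \<open>rh b\<close> supplied by \<open>del2\<close>. In the other order the anchor meets
  \<open>C a X\<close>, which it kills.\<close>

lemma del2_N2: "del2 (N2 c) = - N2 (del2 c) +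
     (\<lambda>as bs Xs. dsum 1 (\<lambda>b bs. dsum (-1) (\<lambda>a as. c as (C a (rh b) # bs) Xs) as) bs)"
proof (intro ext)
  fix as bs :: "'g list" and Xs :: "'x list"
  have z: "c as bs (rh (C a X) # Xs) = 0" for as a X bs Xs
    by (simp add: rh_K C_K linear_0[OF lin_X[OF c]])
  have "N2 (del2 c) as bs Xs = dsum (-1) (\<lambda>a as. dsum (-1) (\<lambda>X Ys. dsum 1 (\<lambda>b bs. c as (C a X # bs) (rh b # Ys)) bs) Xs) as"
    unfolding del2_def N2_def by (simp add: dsum_add z)
  also have "\<dots> = dsum 1 (\<lambda>b bs. dsum (-1) (\<lambda>a as. dsum (-1) (\<lambda>X Ys. c as (C a X # bs) (rh b # Ys)) Xs) as) bs"
    by (rule dsum_comm3[symmetric])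
  finally show "del2 (N2 c) as bs Xs = (- N2 (del2 c) +
     (\<lambda>as bs Xs. dsum 1 (\<lambda>b bs. dsum (-1) (\<lambda>a as. c as (C a (rh b) # bs) Xs) as) bs)) as bs Xs"
    unfolding del2_def N2_def by (simp add: dsum_simps)
qed

lemma del_N: "del (N c) = N (del c)"
proof -
  have "del1 (N1 c) + del1 (N2 c) - (del2 (N1 c) + del2 (N2 c)) = N1 (del1 c - del2 c) - N2 (del1 c - del2 c)"
    unfolding del1_N del2_N1 del2_N2 N1_diff N2_diff by (simp add: algebra_simps)
  then show ?thesis
    unfolding del_def N_def del1_add del2_add N1_sg N2_sg by (simp add: sg_diff)
qed

end

end

section \<open>The commutator of the differentials and the horizontal projection\<close>

context im_algebra
begin

text \<open>With \<open>rh k = 0\<close>, \<open>im0\<close> says that the connection on K is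
  invariant under \<open>a\<close> up to the inner term \<open>br (C a X) k\<close>. This is where
  \<open>M1\<close> comes from.\<close>

lemma im0_K:
  assumes "k \<in> K"
  shows "C (br a k) X = br a (C k X) - C k (vbr (rh a) X) + br (C a X) k"
proof -
  have "vbr 0 X = 0" by (rule linear_0[OF linear_vbr'])
  then have "br a (C k X) - C k (vbr (rh a) X) - br k (C a X) = C (br a k) X"
    using im0[of a k X] assms by (simp add: rh_K linear_0[OF linear_C2])
  then show ?thesis by (simp add: br_anti[of k])
qed

text \<open>\<open>im1\<close> with \<open>k\<close> in the first place: then \<open>br k b\<close>
  lies in K and is fixed by \<open>v\<close>. The two actions of \<open>b\<close> on K, by bracket
  and by the connection along its anchor, differ by an inner one; this is where \<open>M2\<close>
  comes from.\<close>

lemma im1_K: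
  assumes "k \<in> K"
  shows "br b k - C k (rh b) = br (v b) k"
proof -
  have "br k b \<in> K" unfolding br_anti[of k] by (intro subspace_neg[OF subspace_K] br_K assms)
  then show ?thesis
    using im1[of k b] by (simp add: v_on_K br_anti[of k] algebra_simps)
qed

lemma vbr_deriv: "vbr Z (vbr X Y) = vbr (vbr Z X) Y - vbr (vbr Z Y) X"
proof -
  have 1: "vbr X (vbr Y Z) = vbr (vbr Z Y) X"
    by (subst vbr_anti[of Y Z]) (simp add: linear_neg[OF linear_vbr] vbr_anti[of X "vbr Z Y"])
  have 2: "vbr Y (vbr Z X) = - vbr (vbr Z X) Y" by (rule vbr_anti)
  show ?thesis using vbr_jacobi[of X Y Z] unfolding 1 2 by (simp add: add_eq_0_iff)
qed

section \<open>Cartan formulas and the commutator of \<open>dn\<close> with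
  \<open>del\<close>\<close>

context
  fixes c :: "('g, 'x) tcochain"
  assumes c: "coch c"
begin

lemma d1_Cons: "d1 c as bs (Z # Xs) = C (c as bs Xs) Z - dsum (-1) (\<lambda>X Ys. C (c as bs (Z # Ys)) X) Xs
   - bsum vbr (\<lambda>X Ys. c as bs (Z # X # Ys)) Xs - dsum (-1) (\<lambda>X Ys. c as bs (vbr Z X # Ys)) Xs"
  unfolding d1_def dsum.simps bsum.simps c_X_swap[OF c, of _ _ _ Z] by (simp add: bsum_minus)

text \<open>\<open>d1\<close> is built from \<open>C\<close> on K and the bracket of vector fields.
  The action of \<open>a\<close> respects the bracket by the Jacobi identity and \<open>C\<close> up
  to the inner term of \<open>im0_K\<close>, which is the only defect.\<close>

lemma d1_lied: "d1 (lied a c) as bs Xs = lied a (d1 c) as bs Xs + dsum (-1) (\<lambda>X Ys. br (C a X) (c as bs Ys)) Xs"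
proof -
  let ?D = "vbr (rh a)"
  have K: "dsum (-1) (\<lambda>X Ys. C (br a (c as bs Ys)) X) Xs =
      dsum (-1) (\<lambda>X Ys. br a (C (c as bs Ys) X)) Xs - dsum (-1) (\<lambda>X Ys. C (c as bs Ys) (?D X)) Xs
      + dsum (-1) (\<lambda>X Ys. br (C a X) (c as bs Ys)) Xs"
    by (simp add: im0_K coch_K[OF c] dsum_simps)
  have b: "dsum 1 (\<lambda>b bs. d1 c as (br a b # bs) Xs) bs =
      dsum (-1) (\<lambda>X Ys. dsum 1 (\<lambda>b bs. C (c as (br a b # bs) Ys) X) bs) Xs
      + bsum vbr (\<lambda>X Ys. dsum 1 (\<lambda>b bs. c as (br a b # bs) (X # Ys)) bs) Xs"
    by (simp add: d1_def dsum_add dsum_dsum_comm[of "-1" 1] dsum_bsum_comm)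
  have p: "dsum (-1) (\<lambda>X. dsum (-1) (\<lambda>Y Ys. C (c as bs (?D Y # Ys)) X)) Xs =
      - dsum (-1) (\<lambda>X. dsum (-1) (\<lambda>Y Ys. C (c as bs (?D X # Ys)) Y)) Xs"
    by (subst dsum_swap) simp_all
  have q: "dsum (-1) (\<lambda>X. dsum (-1) (\<lambda>Y Ys. c as bs (vbr (?D X) Y # Ys))) Xs
      = - bsum vbr (\<lambda>X Ys. c as bs (?D X # Ys)) Xs"
    by (rule dsum_dsum_bsum) (simp only: vbr_deriv linear_diff[OF lin_X[OF c]])
  have r: "bsum vbr (\<lambda>X Ys. dsum (-1) (\<lambda>Y Ys. c as bs (?D Y # Ys)) (X # Ys)) Xs
      = bsum vbr (\<lambda>X Ys. c as bs (?D X # Ys)) Xs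
      - dsum (-1) (\<lambda>Y. bsum vbr (\<lambda>X Ys. c as bs (?D Y # X # Ys))) Xs"
    by (simp add: bsum_simps bsum_dsum)
  show ?thesis
    unfolding lied_def[of a "d1 c"] b d1_Cons
    unfolding d1_def lied_def
    by (simp only: lin_simps dsum_diff bsum_diff K p q r)
       (simp add: dsum_simps bsum_simps lin_simps)
qed

lemma d1_del1: "d1 (del1 c) = del1 (d1 c) + M1 c"
proof (intro ext)
  fix as bs :: "'g list" and Xs :: "'x list"
  have "dsum (-1) (\<lambda>a as. lied a (d1 c) as bs Xs) as + M1 c as bs Xs = dsum (-1) (\<lambda>a as. d1 (lied a c) as bs Xs) as"
    unfolding d1_lied M1_def dsum_add ..
  also have "\<dots> = dsum (-1) (\<lambda>X Ys. C (dsum (-1) (\<lambda>a as. lied a c as bs Ys) as) X) Xs +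
      bsum vbr (\<lambda>X Ys. dsum (-1) (\<lambda>a as. lied a c as bs (X # Ys)) as) Xs"
    unfolding d1_def by (simp add: dsum_add lin_simps dsum_bsum_comm) (rule dsum_dsum_comm)
  finally have 1: "dsum (-1) (\<lambda>X Ys. C (dsum (-1) (\<lambda>a as. lied a c as bs Ys) as) X) Xs +
      bsum vbr (\<lambda>X Ys. dsum (-1) (\<lambda>a as. lied a c as bs (X # Ys)) as) Xs =
      dsum (-1) (\<lambda>a as. lied a (d1 c) as bs Xs) as + M1 c as bs Xs" ..
  have 2: "bsum br (\<lambda>g as. d1 c (g # as) bs Xs) as =
      dsum (-1) (\<lambda>X Ys. C (bsum br (\<lambda>g as. c (g # as) bs Ys) as) X) Xs +
      bsum vbr (\<lambda>X Ys. bsum br (\<lambda>g as. c (g # as) bs (X # Ys)) as) Xs"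
    unfolding d1_def by (simp add: bsum_add lin_simps dsum_bsum_comm bsum_bsum_comm[of br vbr])
  have "d1 (del1 c) as bs Xs = (dsum (-1) (\<lambda>X Ys. C (dsum (-1) (\<lambda>a as. lied a c as bs Ys) as) X) Xs +
      bsum vbr (\<lambda>X Ys. dsum (-1) (\<lambda>a as. lied a c as bs (X # Ys)) as) Xs) +
      bsum br (\<lambda>g as. d1 c (g # as) bs Xs) as"
    unfolding 2 unfolding d1_def del1_def by (simp add: dsum_simps bsum_simps lin_simps)
  also have "\<dots> = (del1 (d1 c) + M1 c) as bs Xs"
    unfolding 1 by (simp add: del1_def)
  finally show "d1 (del1 c) as bs Xs = (del1 (d1 c) + M1 c) as bs Xs" .
qed

text \<open>Cartan's formula: each summand is the Lie derivative along \<open>rh b\<close>, taken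
  with the connection \<open>C\<close> on values.\<close>

lemma d1_del2: "d1 (del2 c) + del2 (d1 c) = (\<lambda>as bs Xs. dsum 1 (\<lambda>b bs. C (c as bs Xs) (rh b)
    - dsum (-1) (\<lambda>X Ys. c as bs (vbr (rh b) X # Ys)) Xs) bs)"
proof (intro ext)
  fix as bs :: "'g list" and Xs :: "'x list"
  show "(d1 (del2 c) + del2 (d1 c)) as bs Xs = dsum 1 (\<lambda>b bs. C (c as bs Xs) (rh b)
    - dsum (-1) (\<lambda>X Ys. c as bs (vbr (rh b) X # Ys)) Xs) bs"
    unfolding plus_fun_apply del2_def d1_Cons
    unfolding d1_def
    by (simp add: dsum_simps lin_simps dsum_bsum_comm dsum_dsum_comm[of "-1" 1])
qed

lemma lied_d2: "lied a (d2 c) as bs Xs = dsum 1 (\<lambda>b bs. lied a c (b # as) bs Xs) bs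
   - dsum 1 (\<lambda>b bs. c (br a b # as) bs Xs) bs"
proof -
  have sw: "dsum 1 (\<lambda>b. dsum 1 (\<lambda>b' bs. c (b' # as) (br a b # bs) Xs)) bs =
     dsum 1 (\<lambda>b. dsum 1 (\<lambda>b' bs. c (b # as) (br a b' # bs) Xs)) bs"
    by (subst dsum_swap) simp_all
  show ?thesis
    unfolding lied_def d2_def
    by (simp add: dsum_simps lin_simps sw dsum_dsum_comm[of "-1" 1])
qed

text \<open>Cartan's formula in the direction of the algebroid: \<open>d2\<close> inserts
  \<open>b\<close> as the first complete lift, and all terms of \<open>del1\<close> cancel except
  the one that differentiates along \<open>b\<close>.\<close>

lemma d2_del1: "d2 (del1 c) + del1 (d2 c) = (\<lambda>as bs Xs. dsum 1 (\<lambda>b bs. lied b c as bs Xs) bs)"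
proof (intro ext)
  fix as bs :: "'g list" and Xs :: "'x list"
  have 1: "del1 c (b # as) bs Xs = lied b c as bs Xs - dsum (-1) (\<lambda>a as. lied a c (b # as) bs Xs) as
     - bsum br (\<lambda>g as. c (b # g # as) bs Xs) as + dsum (-1) (\<lambda>a as. c (br a b # as) bs Xs) as" for b bs
    unfolding del1_def dsum.simps bsum.simps c_alpha_swap[OF c, of _ b] br_anti[of b]
    by (simp add: dsum_simps bsum_simps linear_neg[OF lin_alpha[OF c]])
  show "(d2 (del1 c) + del1 (d2 c)) as bs Xs = dsum 1 (\<lambda>b bs. lied b c as bs Xs) bs"
    unfolding plus_fun_apply d2_def[of "del1 c"] 1 unfolding del1_def lied_d2
    unfolding d2_def
    by (simp add: dsum_simps dsum_bsum_comm dsum_dsum_comm[of "-1" 1])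
qed

lemma d2_del2: "d2 (del2 c) = del2 (d2 c)"
  unfolding d2_def del2_def fun_eq_iff by (intro allI, subst dsum_swap) simp_all

text \<open>The Cartan formulas contribute the Lie derivative along \<open>b\<close> and the one
  along its anchor. By \<open>im1_K\<close> they differ by the action of \<open>v b\<close>, up to a
  sum over \<open>br b b'\<close> that is antisymmetric in two symmetric slots and therefore
  0.\<close>

lemma dn_del_commutator: "dn (del c) - del (dn c) = M c"
proof -
  have "dsum 1 (\<lambda>b. dsum 1 (\<lambda>b' bs. c as (br b b' # bs) Xs)) bs = 0" for as bs Xs
  proof (rule dsum_dsum_sym_zero)
    show "c as (br z y # zs) Xs = - 1 *\<^sub>R c as (br y z # zs) Xs" for y z zs
      by (subst br_anti) (simp add: linear_neg[OF lin_beta[OF c]])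
  qed simp
  then have M2: "M2 c as bs Xs = dsum 1 (\<lambda>b bs. lied b c as bs Xs) bs - dsum 1 (\<lambda>b bs. C (c as bs Xs) (rh b)
    - dsum (-1) (\<lambda>X Ys. c as bs (vbr (rh b) X # Ys)) Xs) bs" for as bs Xs
    unfolding M2_def im1_K[OF coch_K[OF c], symmetric] lied_def
    by (simp add: dsum_simps)
  have "M2 c = (d2 (del1 c) + del1 (d2 c)) - (d1 (del2 c) + del2 (d1 c))"
    unfolding d1_del2 d2_del1 by (simp add: M2 fun_eq_iff)
  \<comment> \<open>\<open>d2\<close> and \<open>del2\<close> anticommute with \<open>sg\<close>, so
    the outer differences in \<open>dn (del c)\<close> and \<open>del (dn c)\<close> become sums.
    This is why the mixed pairs \<open>d1\<close>, \<open>del2\<close> and \<open>d2\<close>,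
    \<open>del1\<close> entered as anticommutators.\<close>
  then have "M c = d1 (del1 c - del2 c) + d2 (del1 c - del2 c) - (del1 (d1 c - d2 c) + del2 (d1 c - d2 c))"
    unfolding d1_diff d2_diff del1_diff del2_diff d1_del1 d2_del2 M_def by (simp add: algebra_simps)
  then show ?thesis
    unfolding dn_def del_def del1_sg del2_sg d1_sg d2_sg by (simp add: sg_diff sg_minus sg_sg sg_add)
qed

end

section \<open>The bracket product under \<open>N\<close>\<close>

lemma N1_M1: "N1 (M1 c) = M1 (N1 c)"
  unfolding N1_def M1_def fun_eq_iff by (auto simp: lin_simps intro: dsum_comm3)

text \<open>The extra \<open>M2 c\<close> is the summand in which \<open>N1\<close> hits the slot
  read by \<open>v\<close>, where \<open>v (v b) = v b\<close>.\<close>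

lemma N1_M2: "N1 (M2 c) = M2 c + M2 (N1 c)"
proof (intro ext)
  fix as bs :: "'g list" and Xs :: "'x list"
  have "dsum 1 (\<lambda>b. dsum 1 (\<lambda>b' bs. br (v b') (c as (v b # bs) Xs))) bs =
    dsum 1 (\<lambda>b. dsum 1 (\<lambda>b' bs. br (v b) (c as (v b' # bs) Xs))) bs"
    by (subst dsum_swap) simp_all
  then show "N1 (M2 c) as bs Xs = (M2 c + M2 (N1 c)) as bs Xs"
    unfolding N1_def M2_def by (simp add: dsum_simps lin_simps v_on_K v_K)
qed

text \<open>The extra \<open>M1 c\<close> arises when \<open>N2\<close> puts \<open>C a X\<close>
  into the slot read by \<open>v\<close>, which fixes it.\<close>

lemma N2_M2: "N2 (M2 c) = M1 c + M2 (N2 c)"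
proof (intro ext)
  fix as bs :: "'g list" and Xs :: "'x list"
  have "dsum 1 (\<lambda>b bs. dsum (-1) (\<lambda>a as. dsum (-1) (\<lambda>X Ys. br (v b) (c as (C a X # bs) Ys)) Xs) as) bs =
    dsum (-1) (\<lambda>a as. dsum (-1) (\<lambda>X Ys. dsum 1 (\<lambda>b bs. br (v b) (c as (C a X # bs) Ys)) bs) Xs) as"
    by (rule dsum_comm3)
  then show "N2 (M2 c) as bs Xs = (M1 c + M2 (N2 c)) as bs Xs"
    unfolding N2_def M2_def M1_def by (simp add: dsum_simps lin_simps v_on_K C_K)
qed

text \<open>Exchanging the two insertions swaps two complete lifts and two vector fields, and the
  two signs cancel.\<close>

lemma N2_M1: "N2 (M1 c) = M1 (N2 c)"
proof (intro ext)
  fix as bs :: "'g list" and Xs :: "'x list"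
  let ?F = "\<lambda>a X a' Y as Ys. br (C a' Y) (c as (C a X # bs) Ys)"
  have "N2 (M1 c) as bs Xs = dsum (-1) (\<lambda>a. dsum (-1) (\<lambda>a' as. dsum (-1) (\<lambda>X. dsum (-1) (\<lambda>Y Ys. ?F a X a' Y as Ys)) Xs)) as"
    unfolding N2_def M1_def by (intro dsum_cong dsum_dsum_comm)
  also have "\<dots> = - dsum (-1) (\<lambda>a. dsum (-1) (\<lambda>a' as. dsum (-1) (\<lambda>X. dsum (-1) (\<lambda>Y Ys. ?F a' X a Y as Ys)) Xs)) as"
    by (rule trans[OF dsum_swap]) simp_all
  also have "\<dots> = dsum (-1) (\<lambda>a. dsum (-1) (\<lambda>a' as. dsum (-1) (\<lambda>X. dsum (-1) (\<lambda>Y Ys. ?F a' Y a X as Ys)) Xs)) as"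
  proof -
    have sw: "dsum (-1) (\<lambda>X. dsum (-1) (\<lambda>Y Ys. ?F a' X a Y as Ys)) Xs =
      - dsum (-1) (\<lambda>X. dsum (-1) (\<lambda>Y Ys. ?F a' Y a X as Ys)) Xs" for a a' as
      by (subst dsum_swap) simp_all
    have sw': "dsum (-1) (\<lambda>a' as. dsum (-1) (\<lambda>X. dsum (-1) (\<lambda>Y Ys. ?F a' X a Y as Ys)) Xs) as =
      - dsum (-1) (\<lambda>a' as. dsum (-1) (\<lambda>X. dsum (-1) (\<lambda>Y Ys. ?F a' Y a X as Ys)) Xs) as" for a as
      by (rule trans[OF dsum_cong dsum_minus]) (rule sw)
    have "dsum (-1) (\<lambda>a as. dsum (-1) (\<lambda>a' as. dsum (-1) (\<lambda>X. dsum (-1) (\<lambda>Y Ys. ?F a' X a Y as Ys)) Xs) as) as =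
      dsum (-1) (\<lambda>a as. - dsum (-1) (\<lambda>a' as. dsum (-1) (\<lambda>X. dsum (-1) (\<lambda>Y Ys. ?F a' Y a X as Ys)) Xs) as) as"
      by (rule dsum_cong) (rule sw')
    then show ?thesis unfolding dsum_minus by simp
  qed
  also have "\<dots> = M1 (N2 c) as bs Xs"
    unfolding N2_def M1_def lin_simps
    by (rule dsum_cong) (rule dsum_dsum_comm)
  finally show "N2 (M1 c) as bs Xs = M1 (N2 c) as bs Xs" .
qed

lemma M1_add: "M1 (c + c') = M1 c + M1 c'"
  by (simp add: M1_def fun_eq_iff dsum_simps lin_simps)

lemma M2_add: "M2 (c + c') = M2 c + M2 c'"
  by (simp add: M2_def fun_eq_iff dsum_simps lin_simps)

lemma N1_add: "N1 (c + c') = N1 c + N1 c'"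
  by (simp add: N1_def fun_eq_iff dsum_simps)

lemma N2_add: "N2 (c + c') = N2 c + N2 c'"
  by (simp add: N2_def fun_eq_iff dsum_simps)

text \<open>\<open>N\<close> is a derivation of the bracket product, and (C, v) itself is an
  eigenvector of \<open>N\<close> with eigenvalue 1.\<close>

lemma N_M: "N (M c) = M (N c) + M c"
  unfolding N_def M_def N1_add N2_add M1_add M2_add N1_M1 N1_M2 N2_M2 N2_M1 by (simp add: algebra_simps)

lemma N_scaleR: "N (r *\<^sub>R c) = r *\<^sub>R N c"
  by (simp add: N_def N1_def N2_def fun_eq_iff dsum_simps scaleR_add_right)

lemma N_minus: "N (- c) = - N c"
  using N_scaleR[of "-1" c] by simp

lemma N_add: "N (c + c') = N c + N c'"
  by (simp add: N_def N1_add N2_add)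

lemma N_diff: "N (c - c') = N c - N c'"
  by (simp add: N_def N1_diff N2_diff)

lemma M_diff: "M (c - c') = M c - M c'"
  by (simp add: M_def M1_def M2_def fun_eq_iff dsum_simps lin_simps)

lemma M_scaleR: "M (r *\<^sub>R c) = r *\<^sub>R M c"
  by (simp add: M_def M1_def M2_def fun_eq_iff dsum_simps lin_simps scaleR_add_right)

lemma del_diff: "del (c - c') = del c - del c'"
  by (simp add: del_def del1_diff del2_diff sg_diff)

lemma del_scaleR: "del (r *\<^sub>R c) = r *\<^sub>R del c"
  by (simp add: del_def sg_def del1_def del2_def lied_def fun_eq_iff dsum_simps bsum_simps lin_simps
    scaleR_add_right scaleR_diff_right) (simp add: algebra_simps)

text \<open>The bound concerns p, the number of sections of both kinds. Since \<open>N\<close> keeps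
  p, while \<open>del\<close> and \<open>M\<close> read cochains only at smaller p, identities valid
  up to some p can be propagated without splitting cochains into bidegrees.\<close>

definition vanishes :: "nat \<Rightarrow> ('g, 'x) tcochain \<Rightarrow> bool" where
  "vanishes n c \<longleftrightarrow> (\<forall>as bs Xs. length as + length bs \<le> n \<longrightarrow> c as bs Xs = 0)"

lemma vanishesD: "vanishes n c \<Longrightarrow> length as + length bs \<le> n \<Longrightarrow> c as bs Xs = 0"
  by (simp add: vanishes_def)

lemma vanishes_N:
  assumes "vanishes n c" shows "vanishes n (N c)"
  unfolding vanishes_def
proof (intro allI impI)
  fix as bs :: "'g list" and Xs :: "'x list"
  assume l: "length as + length bs \<le> n"
  have "N1 c as bs Xs = dsum 1 (\<lambda>_ _. 0) bs"
    unfolding N1_def using l by (intro dsum_cong vanishesD[OF assms]) auto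
  moreover have "N2 c as bs Xs = dsum (-1) (\<lambda>_ _. dsum (-1) (\<lambda>_ _. 0) Xs) as"
    unfolding N2_def using l by (intro dsum_cong vanishesD[OF assms]) auto
  ultimately show "N c as bs Xs = 0" by (simp add: N_def)
qed

lemma M_vanishes:
  assumes "\<And>as' bs' Xs. length as' + length bs' < length as + length bs \<Longrightarrow> c as' bs' Xs = 0"
  shows "M c as bs Xs = 0"
proof -
  have "M1 c as bs Xs = dsum (-1) (\<lambda>a _. dsum (-1) (\<lambda>X _. br (C a X) 0) Xs) as"
    unfolding M1_def by (intro dsum_cong arg_cong[where f = "br _"] assms) auto
  moreover have "M2 c as bs Xs = dsum 1 (\<lambda>b _. br (v b) 0) bs"
    unfolding M2_def by (intro dsum_cong arg_cong[where f = "br _"] assms) auto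
  ultimately show ?thesis by (simp add: M_def lin_simps)
qed

lemma del_vanishes:
  assumes "vanishes n c" shows "vanishes n (del c)"
  unfolding vanishes_def
proof (intro allI impI)
  fix as bs :: "'g list" and Xs :: "'x list"
  assume l: "length as + length bs \<le> n"
  have z: "lied a c as bs Xs = 0" if "length as + length bs \<le> n" for a as bs Xs
  proof -
    have "lied a c as bs Xs = br a 0 - dsum 1 (\<lambda>_ _. 0) bs - dsum (-1) (\<lambda>_ _. 0) Xs"
      unfolding lied_def using that
      by (intro dsum_cong vanishesD[OF assms] arg_cong2[where f = "(-)"] arg_cong[where f = "br _"]) auto
    then show ?thesis by (simp add: lin_simps)
  qed
  have "del1 c as bs Xs = dsum (-1) (\<lambda>_ _. 0) as + bsum br (\<lambda>_ _. 0) as"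
    unfolding del1_def using l
    by (intro dsum_cong bsum_cong vanishesD[OF assms] z arg_cong2[where f = "(+)"]) auto
  moreover have "del2 c as bs Xs = dsum 1 (\<lambda>_ _. 0) bs"
    unfolding del2_def using l by (intro dsum_cong vanishesD[OF assms]) auto
  ultimately show "del c as bs Xs = 0" by (simp add: del_def sg_def)
qed

text \<open>\<open>hpoly n = (1 - N) (2 - N) \<cdots> (n - N)\<close>, and \<open>vpoly n = (0 - N) (1 - N) \<cdots> (n - 1 - N)\<close> is its value at
  \<open>N + 1\<close>.\<close>

fun hpoly :: "nat \<Rightarrow> ('g, 'x) tcochain \<Rightarrow> ('g, 'x) tcochain" where
  "hpoly 0 c = c"
| "hpoly (Suc n) c = real (Suc n) *\<^sub>R hpoly n c - N (hpoly n c)"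

fun vpoly :: "nat \<Rightarrow> ('g, 'x) tcochain \<Rightarrow> ('g, 'x) tcochain" where
  "vpoly 0 c = c"
| "vpoly (Suc n) c = real n *\<^sub>R vpoly n c - N (vpoly n c)"

text \<open>The first factor \<open>0 - N\<close> split off from the product. Hence the vanishing of
  \<open>N (hpoly n c)\<close> and that of \<open>vpoly (Suc n) c\<close> are the same fact.\<close>

lemma vpoly_Suc: "vpoly (Suc n) c = - N (hpoly n c)"
proof (induction n)
  case (Suc n)
  show ?case
    by (subst vpoly.simps, subst (1 2) Suc) (simp only: hpoly.simps N_diff N_scaleR N_minus
      scaleR_minus_right minus_diff_eq diff_minus_eq_add uminus_add_conv_diff)
qed (simp add: fun_eq_iff)

text \<open>Contraction with a complete lift (the sign makes it commute with \<open>N\<close> up to \<open>iform\<close>), with a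
  core section, and with a one-form with values in core sections.\<close>

definition ialpha :: "'g \<Rightarrow> ('g, 'x) tcochain \<Rightarrow> ('g, 'x) tcochain" where "ialpha a c = (\<lambda>as bs Xs. (-1) ^ length bs *\<^sub>R c (a # as) bs Xs)"
definition ibeta :: "'g \<Rightarrow> ('g, 'x) tcochain \<Rightarrow> ('g, 'x) tcochain" where "ibeta b c = (\<lambda>as bs Xs. c as (b # bs) Xs)"
definition iform :: "('x \<Rightarrow> ('g, 'x) tcochain) \<Rightarrow> ('g, 'x) tcochain" where "iform cf = (\<lambda>as bs Xs. (-1) ^ length bs *\<^sub>R dsum (-1) (\<lambda>X Ys. cf X as bs Ys) Xs)"

lemma coch_ibeta:
  assumes "coch c" shows "coch (ibeta b c)"
  unfolding ibeta_def
  by (rule cochI) (intro cochD[OF assms] esym_Cons[OF coch_beta[OF assms]])+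

lemma coch_ialpha:
  assumes "coch c" shows "coch (ialpha a c)"
proof -
  have "coch (\<lambda>as bs Xs. c (a # as) bs Xs)"
    by (rule cochI) (intro cochD[OF assms] esym_Cons[OF coch_alpha[OF assms]])+
  from coch_sg[OF this] show ?thesis unfolding ialpha_def sg_def .
qed

lemma iform_diff: "iform (\<lambda>X. cf X - cf' X) = iform cf - iform cf'"
  by (simp add: iform_def fun_eq_iff dsum_simps scaleR_diff_right)

lemma iform_scaleR: "iform (\<lambda>X. r *\<^sub>R cf X) = r *\<^sub>R iform cf"
  by (simp add: iform_def fun_eq_iff dsum_simps)

text \<open>\<open>N2\<close> passes one vector field, which costs a sign, and adds a core section;
  the factor (-1)^length bs in \<open>iform\<close> undoes that sign.\<close>

lemma N_iform: "N (iform cf) = iform (\<lambda>X. N (cf X))"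
proof (intro ext)
  fix as bs :: "'g list" and Xs :: "'x list"
  have 1: "N1 (iform cf) as bs Xs = iform (\<lambda>X. N1 (cf X)) as bs Xs"
    unfolding iform_def N1_def by (simp add: dsum_sign_Suc dsum_dsum_comm[of "-1" 1] del: power_Suc)
  have "dsum (-1) (\<lambda>X. dsum (-1) (\<lambda>Y Ys. cf Y as (C a X # bs) Ys)) Xs =
      - dsum (-1) (\<lambda>Y. dsum (-1) (\<lambda>X Ys. cf Y as (C a X # bs) Ys)) Xs" for a as
    by (subst dsum_swap) simp_all
  then have "N2 (iform cf) as bs Xs = (-1) ^ length bs *\<^sub>R
      dsum (-1) (\<lambda>a as. dsum (-1) (\<lambda>Y. dsum (-1) (\<lambda>X Ys. cf Y as (C a X # bs) Ys)) Xs) as"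
    unfolding iform_def N2_def by (simp add: dsum_simps)
  also have "\<dots> = iform (\<lambda>X. N2 (cf X)) as bs Xs"
    unfolding iform_def N2_def by (simp add: dsum_dsum_comm[of "-1" "-1" _ Xs as])
  finally show "N (iform cf) as bs Xs = iform (\<lambda>X. N (cf X)) as bs Xs"
    using 1 by (simp add: N_def) (simp add: iform_def dsum_add scaleR_add_right)
qed

lemma ialpha_N: "ialpha a (N c) = N (ialpha a c) + iform (\<lambda>X. ibeta (C a X) c)"
proof (intro ext)
  fix as bs :: "'g list" and Xs :: "'x list"
  show "ialpha a (N c) as bs Xs = (N (ialpha a c) + iform (\<lambda>X. ibeta (C a X) c)) as bs Xs"
    unfolding N_def plus_fun_apply ialpha_def N1_def N2_def iform_def ibeta_def
    by (simp add: dsum_simps dsum_sign scaleR_add_right)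
       (simp add: dsum_sign_Suc dsum_simps scaleR_diff_right flip: power_Suc scaleR_minus_left)
qed

lemma ibeta_N:
  assumes "coch c" shows "ibeta b (N c) = N (ibeta b c) + ibeta (v b) c"
proof -
  have sw: "c as (b' # b # bs) = c as (b # b' # bs)" for as b' bs
    by (rule ext) (rule c_beta_swap[OF assms])
  show ?thesis
    by (intro ext) (simp add: ibeta_def N_def N1_def N2_def sw[of _ "v _"] sw[of _ "C _ _"])
qed

lemma ibeta_add: "coch c \<Longrightarrow> ibeta (b + b') c = ibeta b c + ibeta b' c"
  by (simp add: ibeta_def fun_eq_iff linear_add[OF lin_beta])

lemma coch_hpoly: "coch c \<Longrightarrow> coch (hpoly n c)"
  by (induction n) (simp_all add: coch_diff coch_scaleR coch_N del: of_nat_Suc)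

lemma hpoly_add: "hpoly n (c + c') = hpoly n c + hpoly n c'"
proof (induction n)
  case (Suc n)
  show ?case by (simp only: hpoly.simps Suc N_add scaleR_add_right add_diff_add)
qed simp

lemma ibeta_diff: "ibeta b (c - c') = ibeta b c - ibeta b c'"
  by (simp add: ibeta_def fun_eq_iff)

lemma ibeta_scaleR: "ibeta b (r *\<^sub>R c) = r *\<^sub>R ibeta b c"
  by (simp add: ibeta_def fun_eq_iff)

lemma ialpha_diff: "ialpha b (c - c') = ialpha b c - ialpha b c'"
  by (simp add: ialpha_def fun_eq_iff scaleR_diff_right)

lemma ialpha_scaleR: "ialpha b (r *\<^sub>R c) = r *\<^sub>R ialpha b c"
  by (simp add: ialpha_def fun_eq_iff)

lemma Suc_scaleR_diff1:
  fixes x :: "'v::real_vector"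
  shows "real (Suc n) *\<^sub>R x - (y + x) = real n *\<^sub>R x - y"
  by (simp add: algebra_simps)

lemma Suc_scaleR_diff2:
  fixes x :: "'v::real_vector"
  shows "real (Suc n) *\<^sub>R (x - y + z) - (x' - y' + z' + z) =
    (real (Suc n) *\<^sub>R x - x') - (real (Suc n) *\<^sub>R y - y') + (real n *\<^sub>R z - z')"
  by (simp add: algebra_simps)

text \<open>By \<open>ibeta_N\<close>, contraction with a core section fixed by \<open>v\<close>
  turns \<open>N\<close> into \<open>N + 1\<close>, hence \<open>hpoly\<close> into
  \<open>vpoly\<close>.\<close>

lemma ibeta_hpoly_K:
  assumes "coch c" "v b = b" shows "ibeta b (hpoly n c) = vpoly n (ibeta b c)"
proof (induction n)
  case (Suc n)
  have "ibeta b (hpoly (Suc n) c) = real (Suc n) *\<^sub>R ibeta b (hpoly n c) - (N (ibeta b (hpoly n c)) + ibeta (v b) (hpoly n c))"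
    by (simp only: hpoly.simps ibeta_diff ibeta_scaleR ibeta_N[OF coch_hpoly[OF assms(1)]])
  then show ?case
    unfolding Suc assms(2) vpoly.simps Suc_scaleR_diff1 .
qed simp

lemma ibeta_hpoly_ker:
  assumes "coch c" "v b = 0" shows "ibeta b (hpoly n c) = hpoly n (ibeta b c)"
proof (induction n)
  case (Suc n)
  have "ibeta 0 (hpoly n c) = 0"
    by (simp add: ibeta_def fun_eq_iff linear_0[OF lin_beta[OF coch_hpoly[OF assms(1)]]])
  then have "ibeta b (hpoly (Suc n) c) = real (Suc n) *\<^sub>R ibeta b (hpoly n c) - N (ibeta b (hpoly n c))"
    by (simp only: hpoly.simps ibeta_diff ibeta_scaleR ibeta_N[OF coch_hpoly[OF assms(1)]] assms(2) add_0_right)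
  then show ?case by (simp only: Suc hpoly.simps)
qed simp

definition hor where "hor b = b - v b"

lemma ibeta_hpoly:
  assumes "coch c" shows "ibeta b (hpoly n c) = hpoly n (ibeta (hor b) c) + vpoly n (ibeta (v b) c)"
proof -
  have "v (v b) = v b" by (simp add: v_on_K v_K)
  moreover from this have "v (hor b) = 0" by (simp add: hor_def linear_diff[OF linear_v])
  moreover have "ibeta b (hpoly n c) = ibeta (hor b) (hpoly n c) + ibeta (v b) (hpoly n c)"
    using ibeta_add[OF coch_hpoly[OF assms], of "hor b" "v b" n] by (simp add: hor_def)
  ultimately show ?thesis by (simp add: ibeta_hpoly_ker ibeta_hpoly_K assms)
qed

text \<open>A complete lift splits into \<open>a - C a\<close>, killed by \<nu>, and
  \<open>C a\<close>, fixed by \<nu>. On the first part \<open>hpoly\<close> survives, on the second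
  it shifts to \<open>vpoly\<close>.\<close>

lemma ialpha_hpoly:
  assumes "coch c"
  shows "ialpha a (hpoly n c) = hpoly n (ialpha a c) - iform (\<lambda>X. hpoly n (ibeta (C a X) c)) + iform (\<lambda>X. vpoly n (ibeta (C a X) c))"
proof (induction n)
  case (Suc n)
  have ibeta: "ibeta (C a X) (hpoly n c) = vpoly n (ibeta (C a X) c)" for X
    by (rule ibeta_hpoly_K[OF assms]) (rule v_on_K[OF C_K])
  have "ialpha a (hpoly (Suc n) c) = real (Suc n) *\<^sub>R ialpha a (hpoly n c) - (N (ialpha a (hpoly n c)) + iform (\<lambda>X. vpoly n (ibeta (C a X) c)))"
    by (simp only: hpoly.simps ialpha_diff ialpha_scaleR ialpha_N ibeta)
  then show ?case
    unfolding Suc N_add N_diff N_iform hpoly.simps vpoly.simps iform_diff iform_scaleR Suc_scaleR_diff2 .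
qed (simp add: fun_eq_iff)

lemma hpoly_Nil: "hpoly n c [] [] Xs = fact n *\<^sub>R c [] [] Xs"
proof (induction n)
  case (Suc n)
  have "N (hpoly n c) [] [] Xs = 0" by (simp add: N_def N1_def N2_def)
  then show ?case by (simp add: Suc)
qed simp

text \<open>The projection \<open>h^*\<close>, by recursion on the complete lifts: the first one is either kept or replaced
  by \<open>- \<C> a\<close>.\<close>

primrec hpull :: "'g list \<Rightarrow> ('g, 'x) tcochain \<Rightarrow> 'g list \<Rightarrow> 'x list \<Rightarrow> 'g" where
  "hpull [] = (\<lambda>c bs Xs. c [] (map hor bs) Xs)"
| "hpull (a # as) = (\<lambda>c bs Xs. (-1) ^ length bs *\<^sub>R hpull as (ialpha a c) bs Xs
     - dsum (-1) (\<lambda>X Ys. hpull as (ibeta (C a X) c) bs Ys) Xs)"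

lemma iform_vanishes:
  assumes "\<And>X. vanishes n (cf X)" shows "vanishes n (iform cf)"
  unfolding vanishes_def
proof (intro allI impI)
  fix as bs :: "'g list" and Xs :: "'x list"
  assume "length as + length bs \<le> n"
  then have "dsum (-1) (\<lambda>X Ys. cf X as bs Ys) Xs = dsum (-1) (\<lambda>_ _. 0) Xs"
    by (intro dsum_cong vanishesD[OF assms])
  then show "iform cf as bs Xs = 0" by (simp add: iform_def)
qed

lemma vanishes_add: "vanishes n c \<Longrightarrow> vanishes n c' \<Longrightarrow> vanishes n (c + c')"
  by (simp add: vanishes_def)

lemma vanishes_diff: "vanishes n c \<Longrightarrow> vanishes n c' \<Longrightarrow> vanishes n (c - c')"
  by (simp add: vanishes_def)

lemma vanishes_scaleR: "vanishes n c \<Longrightarrow> vanishes n (r *\<^sub>R c)"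
  by (simp add: vanishes_def)

lemma vanishes_minus: "vanishes n c \<Longrightarrow> vanishes n (- c)"
  by (simp add: vanishes_def)

text \<open>This replaces the decomposition into eigenspaces. Contracting with one argument leaves
  cochains of the form \<open>N (hpoly (Suc n) _)\<close> or \<open>vpoly (Suc n) _\<close>,
  possibly under further applications of \<open>N\<close>, to be evaluated on at most
  \<open>n\<close> arguments, where the induction hypothesis applies. With no arguments
  \<open>N\<close> is 0.\<close>

lemma N_hpoly_vanishes: "coch c \<Longrightarrow> vanishes n (N (hpoly n c))"
proof (induction n arbitrary: c)
  case 0
  show ?case by (simp add: vanishes_def N_def N1_def N2_def)
next
  case (Suc n)
  \<comment> \<open>The additional factor \<open>Suc n - N\<close> commutes with \<open>N\<close>,
    so the induction hypothesis survives it.\<close>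
  have NG: "vanishes n (N (hpoly (Suc n) c))" if "coch c" for c
    unfolding hpoly.simps N_diff N_scaleR
    by (intro vanishes_diff vanishes_scaleR vanishes_N Suc.IH that)
  have vpoly: "vanishes n (vpoly (Suc n) c)" if "coch c" for c
    unfolding vpoly_Suc by (intro vanishes_minus Suc.IH that)
  have "N (hpoly (Suc n) c) as bs Xs = 0" if l: "length as + length bs \<le> Suc n" for as bs Xs
  proof (cases as)
    case (Cons a as')
    have "vanishes n (ialpha a (N (hpoly (Suc n) c)))"
      unfolding ialpha_N ialpha_hpoly[OF Suc.prems] N_add N_diff N_iform ibeta_hpoly_K[OF Suc.prems v_on_K[OF C_K]]
      by (intro vanishes_add vanishes_diff iform_vanishes vanishes_N NG vpoly coch_ialpha coch_ibeta Suc.prems)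
    then have "ialpha a (N (hpoly (Suc n) c)) as' bs Xs = 0"
      by (rule vanishesD) (use l Cons in simp)
    then show ?thesis by (simp add: ialpha_def Cons del: hpoly.simps)
  next
    case Nil
    show ?thesis
    proof (cases bs)
      case (Cons b bs')
      have "v (v b) = v b" by (simp add: v_on_K v_K)
      have "vanishes n (ibeta b (N (hpoly (Suc n) c)))"
        unfolding ibeta_N[OF coch_hpoly[OF Suc.prems]] ibeta_hpoly_K[OF Suc.prems \<open>v (v b) = v b\<close>]
          ibeta_hpoly[OF Suc.prems, of b] N_add
        by (intro vanishes_add vanishes_N NG vpoly coch_ibeta Suc.prems)
      then have "ibeta b (N (hpoly (Suc n) c)) [] bs' Xs = 0"
        by (rule vanishesD) (use l Cons Nil in simp)
      then show ?thesis by (simp add: ibeta_def Cons Nil del: hpoly.simps)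
    next
      case Nil
      with \<open>as = []\<close> show ?thesis by (simp add: N_def N1_def N2_def del: hpoly.simps)
    qed
  qed
  then show ?case unfolding vanishes_def by blast
qed

lemma vpoly_vanishes: "coch c \<Longrightarrow> vanishes n (vpoly (Suc n) c)"
  unfolding vpoly_Suc by (intro vanishes_minus N_hpoly_vanishes)

text \<open>On the image of \<open>hpoly n\<close> the next factor is multiplication by n + 1. Hence
  \<open>hpoly n\<close> divided by n! no longer depends on n once n is at least p.\<close>

lemma hpoly_Suc_eq:
  "coch c \<Longrightarrow> length as + length bs \<le> n \<Longrightarrow> hpoly (Suc n) c as bs Xs = real (Suc n) *\<^sub>R hpoly n c as bs Xs"
  using vanishesD[OF N_hpoly_vanishes] by simp

lemma sign_scaleR:
  fixes x :: "'v::real_vector"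
  shows "(-1) ^ k *\<^sub>R (f *\<^sub>R x - f *\<^sub>R (-1) ^ k *\<^sub>R y) = f *\<^sub>R ((-1) ^ k *\<^sub>R x - y)"
proof -
  have "(-1) ^ k * (f * (-1) ^ k) = f" by (simp add: mult.left_commute flip: power_add)
  then show ?thesis by (simp add: scaleR_diff_right mult.commute)
qed

text \<open>After contraction with one argument the \<open>vpoly\<close> terms vanish, because fewer
  arguments are left than they have factors; what remains is the recursion that defines
  \<open>hpull\<close>.\<close>

lemma hpoly_eq_hpull: "coch c \<Longrightarrow> length as + length bs \<le> n \<Longrightarrow> hpoly n c as bs Xs = fact n *\<^sub>R hpull as c bs Xs"
proof (induction n arbitrary: c as bs Xs)
  case (Suc n)
  note w = coch_ialpha[OF Suc.prems(1)] coch_ibeta[OF Suc.prems(1)]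
  have eq: "hpoly (Suc n) c as bs Xs = fact (Suc n) *\<^sub>R hpull as c bs Xs"
    if "coch c" "length as + length bs \<le> n" for c as bs Xs
    using that by (simp add: hpoly_Suc_eq Suc.IH del: hpoly.simps)
  show ?case
  proof (cases as)
    case (Cons a as')
    with Suc.prems have l: "length as' + length bs \<le> n" by simp
    have z: "iform (\<lambda>X. vpoly (Suc n) (ibeta (C a X) c)) as' bs Xs = 0"
      by (intro vanishesD[OF iform_vanishes l] vpoly_vanishes w)
    have j: "iform (\<lambda>X. hpoly (Suc n) (ibeta (C a X) c)) as' bs Xs =
        fact (Suc n) *\<^sub>R (-1) ^ length bs *\<^sub>R dsum (-1) (\<lambda>X Ys. hpull as' (ibeta (C a X) c) bs Ys) Xs"
      unfolding iform_def eq[OF w(2) l] by (simp add: dsum_simps)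
    have "hpoly (Suc n) c as bs Xs = (-1) ^ length bs *\<^sub>R ialpha a (hpoly (Suc n) c) as' bs Xs"
      by (simp add: ialpha_def Cons flip: power_add del: hpoly.simps)
    also have "\<dots> = fact (Suc n) *\<^sub>R hpull as c bs Xs"
      unfolding ialpha_hpoly[OF Suc.prems(1)] plus_fun_apply minus_apply z j eq[OF w(1) l]
      by (simp only: Cons add_0_right sign_scaleR hpull.simps)
    finally show ?thesis .
  next
    case as0: Nil
    show ?thesis
    proof (cases bs)
      case (Cons b bs')
      with Suc.prems as0 have l: "length [] + length bs' \<le> n" by simp
      have "hpoly (Suc n) c as bs Xs = ibeta b (hpoly (Suc n) c) [] bs' Xs"
        by (simp add: ibeta_def Cons as0 del: hpoly.simps)
      also have "\<dots> = fact (Suc n) *\<^sub>R hpull as c bs Xs"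
        unfolding ibeta_hpoly[OF Suc.prems(1)] plus_fun_apply vanishesD[OF vpoly_vanishes[OF w(2)] l] eq[OF w(2) l]
        by (simp add: Cons as0 ibeta_def)
      finally show ?thesis .
    next
      case Nil
      with as0 show ?thesis using hpoly_Nil[of "Suc n" c Xs] by simp
    qed
  qed
qed (simp)

text \<open>By \<open>N_M\<close>, each factor \<open>j - N\<close> becomes \<open>j - 1 - N\<close>
  when moved past \<open>M\<close>.\<close>

lemma hpoly_M: "hpoly n (M c) = M (vpoly n c)"
proof (induction n)
  case (Suc n)
  show ?case unfolding hpoly.simps vpoly.simps Suc N_M M_diff M_scaleR Suc_scaleR_diff1 ..
qed simp

lemma hpull_M:
  assumes "coch c" shows "hpull as (M c) bs Xs = 0"
proof -
  let ?n = "length as + length bs"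
  have "coch (M c)"
    unfolding dn_del_commutator[OF assms, symmetric] by (intro coch_diff coch_dn coch_del assms)
  then have "fact ?n *\<^sub>R hpull as (M c) bs Xs = M (vpoly ?n c) as bs Xs"
    using hpoly_eq_hpull[of "M c" as bs ?n Xs] by (simp add: hpoly_M)
  also have "\<dots> = 0"
  proof (rule M_vanishes)
    fix as' bs' :: "'g list" and Ys :: "'x list"
    assume l: "length as' + length bs' < ?n"
    \<comment> \<open>\<open>M\<close> reads \<open>vpoly ?n c\<close> on fewer than
      \<open>?n\<close> arguments, hence on at most \<open>m\<close>, where its factors
      \<open>0 - N\<close> up to \<open>m - N\<close> annihilate everything.\<close>
    then obtain m where m: "?n = Suc m" by (cases ?n) auto
    show "vpoly ?n c as' bs' Ys = 0"
      using l unfolding m by (intro vanishesD[OF vpoly_vanishes[OF assms]]) simp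
  qed
  finally show ?thesis by simp
qed

lemma del_hpoly: "coch c \<Longrightarrow> del (hpoly n c) = hpoly n (del c)"
  by (induction n) (simp_all add: del_diff del_scaleR del_N coch_hpoly del: of_nat_Suc)

text \<open>\<open>hpull\<close> is not itself a polynomial in \<open>N\<close>, but it agrees with
  one, up to a factorial, on at most \<open>?n\<close> arguments, and \<open>del\<close> reads
  nothing beyond that. The same degree and factorial serve on both sides although \<open>del\<close>
  changes p.\<close>

lemma hpull_del:
  assumes "coch c" shows "del (\<lambda>as. hpull as c) as bs Xs = hpull as (del c) bs Xs"
proof -
  let ?n = "length as + length bs"
  have "vanishes ?n (fact ?n *\<^sub>R (\<lambda>as. hpull as c) - hpoly ?n c)"
    by (simp add: vanishes_def hpoly_eq_hpull[OF assms])
  then have "del (fact ?n *\<^sub>R (\<lambda>as. hpull as c) - hpoly ?n c) as bs Xs = 0"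
    using vanishesD[OF del_vanishes] by blast
  then have "fact ?n *\<^sub>R del (\<lambda>as. hpull as c) as bs Xs = hpoly ?n (del c) as bs Xs"
    by (simp add: del_diff del_scaleR del_hpoly[OF assms])
  also have "\<dots> = fact ?n *\<^sub>R hpull as (del c) bs Xs"
    by (simp add: hpoly_eq_hpull[OF coch_del[OF assms]])
  finally show ?thesis by simp
qed

lemma hpull_add: "coch c \<Longrightarrow> coch c' \<Longrightarrow> hpull as (c + c') bs Xs = hpull as c bs Xs + hpull as c' bs Xs"
  using hpoly_eq_hpull[of "c + c'" as bs "length as + length bs"] hpoly_eq_hpull[of c as bs "length as + length bs"]
    hpoly_eq_hpull[of c' as bs "length as + length bs"]
  by (simp add: coch_add hpoly_add flip: scaleR_add_right)

theorem hpull_dn_del: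
  assumes "coch c" shows "del (\<lambda>as. hpull as (dn c)) as bs Xs = hpull as (dn (del c)) bs Xs"
proof -
  have "dn (del c) = del (dn c) + M c"
    using dn_del_commutator[OF assms] by (simp add: algebra_simps)
  moreover have "coch (M c)"
    unfolding dn_del_commutator[OF assms, symmetric] by (intro coch_diff coch_dn coch_del assms)
  ultimately show ?thesis
    by (simp add: hpull_del coch_dn hpull_add coch_del assms hpull_M)
qed

end

section \<open>Linearity over functions\<close>

text \<open>The data behind membership of the horizontal derivative in the space of Weil cochains.
  As \<open>'f\<close> carries no algebraic structure, the action of a bracket on functions is
  stated in \<open>sA_vbr\<close> after multiplying a section.\<close>

locale im_module = im_algebra br vbr rh K C v
  for br :: "'g::real_vector \<Rightarrow> 'g \<Rightarrow> 'g"
    and vbr :: "'x::real_vector \<Rightarrow> 'x \<Rightarrow> 'x"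
    and rh :: "'g \<Rightarrow> 'x"
    and K :: "'g set"
    and C :: "'g \<Rightarrow> 'x \<Rightarrow> 'g"
    and v :: "'g \<Rightarrow> 'g" +
  fixes Fn :: "'f set"
    and sA :: "'f \<Rightarrow> 'g \<Rightarrow> 'g"
    and sX :: "'f \<Rightarrow> 'x \<Rightarrow> 'x"
    and ap :: "'x \<Rightarrow> 'f \<Rightarrow> 'f"
  assumes linear_sA: "linear (sA f)"
    and sA_vbr: "f \<in> Fn \<Longrightarrow> sA (ap (vbr X Y) f) a = sA (ap X (ap Y f)) a - sA (ap Y (ap X f)) a"
    and ap_Fn: "f \<in> Fn \<Longrightarrow> ap X f \<in> Fn"
    and C_sA: "f \<in> Fn \<Longrightarrow> C (sA f a) X = sA f (C a X) + sA (ap X f) (v a)"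
    and C_sX: "f \<in> Fn \<Longrightarrow> C a (sX f X) = sA f (C a X)"
    and v_sA: "f \<in> Fn \<Longrightarrow> v (sA f a) = sA f (v a)"
    and vbr_sX: "f \<in> Fn \<Longrightarrow> vbr (sX f X) Y = sX f (vbr X Y) - sX (ap Y f) X"
begin

lemmas sA_simps = linear_add[OF linear_sA] linear_diff[OF linear_sA] linear_neg[OF linear_sA]
  linear_0[OF linear_sA] linear_scale[OF linear_sA] dsum_linear[OF linear_sA] bsum_linear[OF linear_sA]

definition dw :: "'f \<Rightarrow> ('x list \<Rightarrow> 'g) \<Rightarrow> 'x list \<Rightarrow> 'g" where
  "dw f eta Xs = dsum (-1) (\<lambda>X Ys. sA (ap X f) (eta Ys)) Xs"

definition flin :: "('g, 'x) tcochain \<Rightarrow> bool" where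
  "flin c \<longleftrightarrow> (\<forall>f\<in>Fn. \<forall>a as bs X Xs.
     c (sA f a # as) bs Xs = sA f (c (a # as) bs Xs) + dw f (c as (a # bs)) Xs \<and>
     c as (sA f a # bs) Xs = sA f (c as (a # bs) Xs) \<and>
     c as bs (sX f X # Xs) = sA f (c as bs (X # Xs)))"

lemma flinI:
  assumes "\<And>f a as bs Xs. f \<in> Fn \<Longrightarrow> c (sA f a # as) bs Xs = sA f (c (a # as) bs Xs) + dw f (c as (a # bs)) Xs"
    and "\<And>f b as bs Xs. f \<in> Fn \<Longrightarrow> c as (sA f b # bs) Xs = sA f (c as (b # bs) Xs)"
    and "\<And>f X as bs Xs. f \<in> Fn \<Longrightarrow> c as bs (sX f X # Xs) = sA f (c as bs (X # Xs))"
  shows "flin c"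
  using assms unfolding flin_def by blast

lemma flinD:
  assumes "flin c" "f \<in> Fn"
  shows flin_alpha: "c (sA f a # as) bs Xs = sA f (c (a # as) bs Xs) + dw f (c as (a # bs)) Xs"
    and flin_beta: "c as (sA f b # bs) Xs = sA f (c as (b # bs) Xs)"
    and flin_X: "c as bs (sX f X # Xs) = sA f (c as bs (X # Xs))"
  using assms by (simp_all add: flin_def)

lemma dw_diff: "dw f (\<lambda>Ys. eta Ys - eta' Ys) Xs = dw f eta Xs - dw f eta' Xs"
  by (simp add: dw_def sA_simps dsum_simps)

lemma dw_add: "dw f (\<lambda>Ys. eta Ys + eta' Ys) Xs = dw f eta Xs + dw f eta' Xs"
  by (simp add: dw_def sA_simps dsum_simps)

lemma dw_scaleR: "dw f (\<lambda>Ys. r *\<^sub>R eta Ys) Xs = r *\<^sub>R dw f eta Xs"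
  by (simp add: dw_def sA_simps dsum_simps)

lemma dw_dsum: "dw f (\<lambda>Ys. dsum e (\<lambda>a as. eta a as Ys) as) Xs = dsum e (\<lambda>a as. dw f (eta a as) Xs) as"
  unfolding dw_def sA_simps by (rule dsum_dsum_comm)

lemma flin_diff: "flin c \<Longrightarrow> flin c' \<Longrightarrow> flin (c - c')"
  by (rule flinI) (simp_all add: fun_diff_def flinD dw_diff sA_simps)

lemma flin_scaleR: "flin c \<Longrightarrow> flin (r *\<^sub>R c)"
  by (rule flinI) (simp_all add: scaleR_fun_def flinD dw_scaleR sA_simps scaleR_add_right)

context
  fixes c :: "('g, 'x) tcochain"
  assumes c: "coch c" and s: "flin c"
begin

text \<open>\<open>N1\<close> and \<open>N2\<close> preserve the Leibniz rule only together: by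
  \<open>C_sA\<close>, \<open>N2\<close> at \<open>sA f a\<close> produces the df-term of
  \<open>c as (v a # bs)\<close>, which is the summand of \<open>N1\<close> on the new core slot
  \<open>a\<close>.\<close>

lemma flin_N: "flin (N c)"
proof (rule flinI)
  fix f a as bs Xs assume f: "f \<in> Fn"
  have N1: "N1 c (sA f a # as) bs Xs = sA f (N1 c (a # as) bs Xs) + dw f (\<lambda>Ys. dsum 1 (\<lambda>b bs. c as (a # v b # bs) Ys) bs) Xs"
    unfolding N1_def flin_alpha[OF s f] dsum_add sA_simps dw_dsum ..
  have sw: "dsum (-1) (\<lambda>X. dsum (-1) (\<lambda>Y Ys. sA (ap Y f) (c as (C a' X # a # bs) Ys))) Xs =
    - dw f (\<lambda>Ys. dsum (-1) (\<lambda>Y Ys. c as (C a' Y # a # bs) Ys) Ys) Xs" for a' as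
    unfolding dw_def sA_simps by (subst dsum_swap) simp_all
  have "N2 c (sA f a # as) bs Xs = dsum (-1) (\<lambda>X Ys. sA f (c as (C a X # bs) Ys) + sA (ap X f) (c as (v a # bs) Ys)) Xs
     - dsum (-1) (\<lambda>a' as. dsum (-1) (\<lambda>X Ys. sA f (c (a # as) (C a' X # bs) Ys) +
         dsum (-1) (\<lambda>Y Ys. sA (ap Y f) (c as (C a' X # a # bs) Ys)) Ys) Xs) as"
    unfolding N2_def dsum.simps C_sA[OF f] flin_alpha[OF s f] linear_add[OF lin_beta[OF c]]
      flin_beta[OF s f] flin_beta[OF s ap_Fn[OF f]] dw_def c_beta_swap[OF c, of _ "C _ _" a] by simp
  also have "\<dots> = sA f (N2 c (a # as) bs Xs) + dw f (c as (v a # bs)) Xs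
     - dsum (-1) (\<lambda>a' as. dsum (-1) (\<lambda>X. dsum (-1) (\<lambda>Y Ys. sA (ap Y f) (c as (C a' X # a # bs) Ys))) Xs) as"
    unfolding N2_def dw_def by (simp add: dsum_simps sA_simps)
  also have "\<dots> = sA f (N2 c (a # as) bs Xs) + dw f (c as (v a # bs)) Xs + dw f (N2 c as (a # bs)) Xs"
    unfolding sw unfolding N2_def dw_dsum by (simp add: dsum_simps)
  finally show "N c (sA f a # as) bs Xs = sA f (N c (a # as) bs Xs) + dw f (N c as (a # bs)) Xs"
    using N1 unfolding N_def plus_fun_apply
    by (simp add: sA_simps dw_add) (simp add: N1_def dw_add c_beta_swap[OF c, of _ "v _" a])
next
  fix f b as bs Xs assume f: "f \<in> Fn"
  show "N c as (sA f b # bs) Xs = sA f (N c as (b # bs) Xs)"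
    unfolding N_def plus_fun_apply N1_def N2_def dsum.simps v_sA[OF f] c_beta_swap[OF c, of _ "v _"]
      c_beta_swap[OF c, of _ "C _ _"] flin_beta[OF s f] by (simp add: sA_simps)
next
  fix f X as bs Xs assume f: "f \<in> Fn"
  show "N c as bs (sX f X # Xs) = sA f (N c as bs (X # Xs))"
    unfolding N_def plus_fun_apply N1_def N2_def dsum.simps C_sX[OF f] flin_beta[OF s f] flin_X[OF s f]
    by (simp add: sA_simps)
qed

lemma C_sA_c: "f \<in> Fn \<Longrightarrow> C (sA f (c as bs Xs)) X = sA f (C (c as bs Xs) X) + sA (ap X f) (c as bs Xs)"
  by (simp add: C_sA v_on_K coch_K[OF c])

definition ce :: "('x list \<Rightarrow> 'g) \<Rightarrow> 'x list \<Rightarrow> 'g" where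
  "ce eta Xs = dsum (-1) (\<lambda>X Ys. C (eta Ys) X) Xs + bsum vbr (\<lambda>X Ys. eta (X # Ys)) Xs"

lemma d1_ce: "d1 c as bs Xs = ce (c as bs) Xs"
  by (simp add: d1_def ce_def)

lemma ce_add: "ce (\<lambda>Ys. eta Ys + eta' Ys) Xs = ce eta Xs + ce eta' Xs"
  by (simp add: ce_def dsum_simps bsum_simps lin_simps)

lemma ce_sA: "f \<in> Fn \<Longrightarrow> ce (\<lambda>Ys. sA f (c as bs Ys)) Xs = sA f (ce (c as bs) Xs) + dw f (c as bs) Xs"
  by (simp add: ce_def C_sA_c dsum_simps sA_simps dw_def)

text \<open>The second derivatives of \<open>f\<close> cancel against the bracket term by
  \<open>sA_vbr\<close>; this is ddf = 0.\<close>

lemma ce_dw: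
  assumes f: "f \<in> Fn"
  shows "ce (dw f (c as bs)) Xs = - dw f (ce (c as bs)) Xs"
proof -
  have 1: "dsum (-1) (\<lambda>X. dsum (-1) (\<lambda>Y Ys. sA (ap Y f) (C (c as bs Ys) X))) Xs =
     - dsum (-1) (\<lambda>X. dsum (-1) (\<lambda>Y Ys. sA (ap X f) (C (c as bs Ys) Y))) Xs"
    by (subst dsum_swap) simp_all
  have 2: "dsum (-1) (\<lambda>X. dsum (-1) (\<lambda>Y Ys. sA (ap X (ap Y f)) (c as bs Ys))) Xs =
     - bsum vbr (\<lambda>X Ys. sA (ap X f) (c as bs Ys)) Xs"
    by (rule dsum_dsum_bsum) (simp add: sA_vbr f)
  have 3: "bsum vbr (\<lambda>X. dsum (-1) (\<lambda>Y Ys. sA (ap Y f) (c as bs (X # Ys)))) Xs =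
     dsum (-1) (\<lambda>Y. bsum vbr (\<lambda>X Ys. sA (ap Y f) (c as bs (X # Ys)))) Xs"
    by (rule bsum_dsum)
  show ?thesis
    unfolding ce_def dw_def dsum.simps
    by (simp add: lin_simps C_sA_c[OF ap_Fn[OF f]] dsum_simps bsum_simps sA_simps 1 2 3)
qed

text \<open>The df-term of \<open>c (a # as) bs\<close> produced by \<open>d1\<close> is the summand
  of \<open>d2\<close> in which the new core slot \<open>a\<close> moves back among the complete
  lifts. All df-terms come out with the opposite sign, which \<open>sg\<close> corrects because
  \<open>a # bs\<close> is longer by one. In a core slot the df-terms of \<open>d1\<close> and
  \<open>d2\<close> cancel.\<close>

lemma flin_dn: "flin (dn c)"
proof (rule flinI)
  fix f a as bs Xs assume f: "f \<in> Fn"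
  have 1: "c (b # sA f a # as) bs Xs = sA f (c (b # a # as) bs Xs) - dw f (c (b # as) (a # bs)) Xs" for b bs
    unfolding c_alpha_swap[OF c, of b] flin_alpha[OF s f] by (simp add: sA_simps)
  have "d1 c (sA f a # as) bs Xs - d2 c (sA f a # as) bs Xs =
      sA f (ce (c (a # as) bs) Xs) + dw f (c (a # as) bs) Xs - dw f (ce (c as (a # bs))) Xs
       - (sA f (d2 c (a # as) bs Xs) - dw f (\<lambda>Ys. dsum 1 (\<lambda>b bs. c (b # as) (a # bs) Ys) bs) Xs)"
    unfolding d1_ce flin_alpha[OF s f] ce_add ce_sA[OF f] ce_dw[OF f] d2_def 1 dsum_diff sA_simps dw_dsum by simp
  also have "\<dots> = sA f (d1 c (a # as) bs Xs - d2 c (a # as) bs Xs) - dw f (\<lambda>Ys. d1 c as (a # bs) Ys - d2 c as (a # bs) Ys) Xs"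
    unfolding dw_diff d1_ce[symmetric] d2_def dsum.simps by (simp add: sA_simps dw_add)
  finally show "dn c (sA f a # as) bs Xs = sA f (dn c (a # as) bs Xs) + dw f (dn c as (a # bs)) Xs"
    unfolding dn_def sg_def by (simp add: sA_simps dw_scaleR scaleR_diff_right dw_diff)
next
  fix f b as bs Xs assume f: "f \<in> Fn"
  have "d1 c as (sA f b # bs) Xs - d2 c as (sA f b # bs) Xs = sA f (d1 c as (b # bs) Xs - d2 c as (b # bs) Xs)"
    unfolding d1_ce flin_beta[OF s f] ce_sA[OF f] d2_def dsum.simps flin_alpha[OF s f]
    by (simp add: sA_simps)
  then show "dn c as (sA f b # bs) Xs = sA f (dn c as (b # bs) Xs)"
    unfolding dn_def sg_def by (simp add: sA_simps)
next
  fix f X as bs Xs assume f: "f \<in> Fn"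
  have "d1 c as bs (sX f X # Xs) = sA f (d1 c as bs (X # Xs))"
    unfolding d1_Cons[OF c] C_sX[OF f] flin_X[OF s f] C_sA_c[OF f] vbr_sX[OF f]
      linear_diff[OF lin_X[OF c]] flin_X[OF s ap_Fn[OF f]]
    by (simp add: dsum_simps sA_simps)
  then show "dn c as bs (sX f X # Xs) = sA f (dn c as bs (X # Xs))"
    unfolding dn_def sg_def d2_def by (simp add: sA_simps flin_X[OF s f])
qed

end

lemma flin_hpoly: "coch c \<Longrightarrow> flin c \<Longrightarrow> flin (hpoly n c)"
  by (induction n) (simp_all add: flin_diff flin_scaleR flin_N coch_hpoly del: of_nat_Suc)

end

section \<open>Permutations and shuffles\<close>

lemma sum_nths_dsum: "(\<Sum>i<length xs. e ^ i *\<^sub>R F (xs ! i) (nths xs (- {i}))) = dsum e F xs"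
proof (induction xs arbitrary: F)
  case (Cons x xs)
  have "nths xs {j. Suc j \<noteq> Suc i} = nths xs (- {i})" for i
    by (rule arg_cong[where f = "nths xs"]) auto
  moreover have "nths xs {j. Suc j \<noteq> 0} = xs" by (simp add: nths_all)
  ultimately show ?case
    using Cons[of "\<lambda>y ys. F y (x # ys)"]
    by (simp add: sum.lessThan_Suc_shift nths_Cons scaleR_right.sum[symmetric]
        del: sum.lessThan_Suc flip: scaleR_scaleR)
qed simp

lemma sum_nths_bsum:
  "(\<Sum>j<length xs. \<Sum>i<j. (-1) ^ (i + j) *\<^sub>R F (br (xs ! i) (xs ! j)) (nths xs (- {i, j}))) = bsum br F xs"
proof (induction xs arbitrary: F)
  case (Cons x xs)
  have "nths (x # xs) (- {0, Suc j}) = nths xs (- {j})" for j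
    by (simp add: nths_Cons) (rule arg_cong[where f = "nths xs"], auto)
  moreover have "nths (x # xs) (- {Suc i, Suc j}) = x # nths xs (- {i, j})" for i j
    by (simp add: nths_Cons) (rule arg_cong[where f = "nths xs"], auto)
  ultimately show ?case
    using Cons[of "\<lambda>y ys. F y (x # ys)"] sum_nths_dsum[of "-1" "\<lambda>y. F (br x y)" xs]
    by (simp add: sum.lessThan_Suc_shift sum_subtractf sum.distrib sum_negf del: sum.lessThan_Suc)
qed simp

lemma dsum_self:
  assumes "e * e = 1" "esym e F"
  shows "dsum e (\<lambda>x ys. F (x # ys)) xs = real (length xs) *\<^sub>R F xs"
  using assms(2)
proof (induction xs arbitrary: F)
  case (Cons x xs)
  have "dsum e (\<lambda>y ys. F (y # x # ys)) xs = dsum e (\<lambda>y ys. e *\<^sub>R F (x # y # ys)) xs"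
    by (rule dsum_cong) (rule esym_swap[OF Cons.prems])
  also have "\<dots> = e *\<^sub>R real (length xs) *\<^sub>R F (x # xs)"
    unfolding dsum_scaleR Cons.IH[OF esym_Cons[OF Cons.prems]] ..
  finally show ?case using assms(1) by (simp add: algebra_simps)
qed simp

text \<open>Moving the i-th entry to the front costs \<open>e ^ i\<close>, which is its weight in
  \<open>dsum\<close>. So replacement in place, as in the Lie derivative, carries no sign.\<close>

lemma sum_list_update_dsum:
  assumes "e * e = 1" "esym e F"
  shows "(\<Sum>i<length xs. F (xs[i := g (xs ! i)])) = dsum e (\<lambda>x ys. F (g x # ys)) xs"
  using assms(2)
proof (induction xs arbitrary: F)
  case (Cons x xs)
  have "dsum e (\<lambda>y ys. F (g y # x # ys)) xs = dsum e (\<lambda>y ys. e *\<^sub>R F (x # g y # ys)) xs"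
    by (rule dsum_cong) (rule esym_swap[OF Cons.prems])
  then show ?case
    using assms(1) Cons.IH[OF esym_Cons[OF Cons.prems]]
    by (simp add: sum.lessThan_Suc_shift dsum_scaleR del: sum.lessThan_Suc)
qed simp

text \<open>A permutation of \<open>{..<Suc n}\<close> is \<open>rcyc b \<circ> lift p\<close>, where \<open>b\<close> is its value at 0; a shuffle is \<open>lift p\<close> or
  \<open>lift p \<circ> cyc t\<close>, depending on the block that contains the preimage \<open>t\<close> of 0.\<close>

definition lift :: "(nat \<Rightarrow> nat) \<Rightarrow> nat \<Rightarrow> nat" where
  "lift p i = (case i of 0 \<Rightarrow> 0 | Suc i \<Rightarrow> Suc (p i))"

definition cyc :: "nat \<Rightarrow> nat \<Rightarrow> nat" where
  "cyc t i = (if i < t then Suc i else if i = t then 0 else i)"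

definition rcyc :: "nat \<Rightarrow> nat \<Rightarrow> nat" where
  "rcyc t i = (case i of 0 \<Rightarrow> t | Suc j \<Rightarrow> if j < t then j else Suc j)"

lemma lift_simps [simp]: "lift p 0 = 0" "lift p (Suc i) = Suc (p i)"
  by (simp_all add: lift_def)

lemma rcyc_simps [simp]: "rcyc t 0 = t" "rcyc t (Suc j) = (if j < t then j else Suc j)"
  by (simp_all add: rcyc_def)

lemma rcyc_cyc: "rcyc t (cyc t i) = i"
  by (cases i) (auto simp: cyc_def)

lemma cyc_rcyc: "cyc t (rcyc t i) = i"
  by (cases i) (auto simp: cyc_def)

lemma lift_permutes_iff: "lift p permutes {..<Suc n} \<longleftrightarrow> p permutes {..<n}"
proof
  assume L: "lift p permutes {..<Suc n}"
  show "p permutes {..<n}"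
    unfolding permutes_def
  proof (intro conjI allI impI)
    fix x assume "x \<notin> {..<n}"
    then show "p x = x" using permutes_not_in[OF L, of "Suc x"] by simp
  next
    fix y
    obtain x where x: "lift p x = Suc y" using permutes_inverses(1)[OF L] by blast
    then obtain x' where x': "x = Suc x'" by (cases x) auto
    show "\<exists>!x. p x = y"
    proof (rule ex1I[of _ x'])
      show "p x' = y" using x x' by simp
      fix z assume "p z = y"
      then have "lift p (Suc z) = lift p x" using x by simp
      then show "z = x'" using injD[OF permutes_inj[OF L]] x' by blast
    qed
  qed
next
  assume p: "p permutes {..<n}"
  show "lift p permutes {..<Suc n}"
    unfolding permutes_def
  proof (intro conjI allI impI)
    fix x assume "x \<notin> {..<Suc n}"
    then show "lift p x = x" using permutes_not_in[OF p, of "x - 1"] by (cases x) auto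
  next
    fix y
    show "\<exists>!x. lift p x = y"
    proof (cases y)
      case 0
      then show ?thesis by (intro ex1I[of _ 0]) (auto simp: lift_def split: nat.splits)
    next
      case (Suc y')
      obtain x where x: "p x = y'" using permutes_inverses(1)[OF p] by blast
      show ?thesis
      proof (rule ex1I[of _ "Suc x"])
        show "lift p (Suc x) = y" using x Suc by simp
        fix z assume z: "lift p z = y"
        then obtain z' where z': "z = Suc z'" using Suc by (cases z) auto
        then have "p z' = p x" using z x Suc by simp
        then show "z = Suc x" using injD[OF permutes_inj[OF p]] z' by blast
      qed
    qed
  qed
qed

lemma rcyc_permutes: "t < n \<Longrightarrow> rcyc t permutes {..<n}"
  unfolding permutes_def
proof (intro conjI allI impI)
  fix y
  show "\<exists>!x. rcyc t x = y"
    by (rule ex1I[of _ "cyc t y"]) (auto simp: rcyc_cyc cyc_rcyc)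
qed (auto simp: rcyc_def split: nat.splits)

lemma cyc_permutes: "t < n \<Longrightarrow> cyc t permutes {..<n}"
  unfolding permutes_def
proof (intro conjI allI impI)
  fix y
  show "\<exists>!x. cyc t x = y"
    by (rule ex1I[of _ "rcyc t y"]) (auto simp: rcyc_cyc cyc_rcyc)
qed (auto simp: cyc_def)

lemma permutation_of_permutes: "p permutes {..<n::nat} \<Longrightarrow> permutation p"
  by (rule permutes_imp_permutation) simp_all

lemma sign_rcyc: "sign (rcyc t) = (-1) ^ t"
proof (induction t)
  case 0
  have "rcyc 0 = id" by (auto simp: fun_eq_iff rcyc_def split: nat.splits)
  then show ?case by simp
next
  case (Suc t)
  have "rcyc (Suc t) = Transposition.transpose t (Suc t) \<circ> rcyc t"
    by (auto simp: fun_eq_iff rcyc_def Transposition.transpose_def split: nat.splits)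
  moreover have "permutation (rcyc t)" by (rule permutation_of_permutes[OF rcyc_permutes[OF lessI]])
  ultimately show ?case
    using Suc sign_compose[OF permutation_swap_id[of t "Suc t"], of "rcyc t"] by (simp only: sign_swap_id) simp
qed

lemma sign_cyc: "sign (cyc t) = (-1) ^ t"
proof -
  have "cyc t \<circ> rcyc t = id" by (simp add: fun_eq_iff cyc_rcyc)
  moreover have "sign (cyc t \<circ> rcyc t) = sign (cyc t) * sign (rcyc t)"
    by (intro sign_compose permutation_of_permutes[OF rcyc_permutes[OF lessI]]
      permutation_of_permutes[OF cyc_permutes[OF lessI]])
  ultimately have "sign (cyc t) * (-1) ^ t = 1" by (simp add: sign_rcyc)
  then show ?thesis by (cases "even t") auto
qed

lemma sign_lift:
  assumes "p permutes {..<n}" shows "sign (lift p) = sign p"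
  using assms finite_lessThan[of n]
proof (induction p rule: permutes_induct)
  case id
  have "lift id = id" by (auto simp: fun_eq_iff lift_def split: nat.splits)
  then show ?case by (simp only:)
next
  case (swap a b p)
  have "lift (Transposition.transpose a b \<circ> p) = Transposition.transpose (Suc a) (Suc b) \<circ> lift p"
  proof
    show "lift (Transposition.transpose a b \<circ> p) i = (Transposition.transpose (Suc a) (Suc b) \<circ> lift p) i" for i
      by (cases i) (simp_all add: Transposition.transpose_def)
  qed
  moreover have "permutation (lift p)"
    using swap(4) lift_permutes_iff permutation_of_permutes by blast
  moreover have "permutation p" using swap(4) by (rule permutation_of_permutes)
  ultimately show ?case
    using swap(5) sign_compose[OF permutation_swap_id[of a b], of p]
      sign_compose[OF permutation_swap_id[of "Suc a" "Suc b"], of "lift p"]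
    by (simp only: sign_swap_id nat.inject)
qed

lemma permutes_fix_0:
  assumes "s permutes {..<Suc n}" "s 0 = 0"
  obtains p where "p permutes {..<n}" "s = lift p"
proof -
  have "s (Suc i) \<noteq> 0" for i
    using permutes_inj[OF assms(1)] assms(2) by (metis inj_eq nat.distinct(1))
  then have "s i = lift (\<lambda>i. s (Suc i) - 1) i" for i
    using assms(2) by (cases i) simp_all
  then have s: "s = lift (\<lambda>i. s (Suc i) - 1)" by (rule ext)
  have "lift (\<lambda>i. s (Suc i) - 1) permutes {..<Suc n}"
    unfolding s[symmetric] by (rule assms(1))
  then show ?thesis using that[OF _ s] unfolding lift_permutes_iff by blast
qed

lemma inj_lift: "lift p = lift q \<Longrightarrow> p = q"
  by (metis ext lift_simps(2) nat.inject)

lemma sum_permutations_Suc: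
  fixes F :: "(nat \<Rightarrow> nat) \<Rightarrow> 'v::comm_monoid_add"
  shows "(\<Sum>s | s permutes {..<Suc n}. F s) = (\<Sum>b<Suc n. \<Sum>p | p permutes {..<n}. F (rcyc b \<circ> lift p))"
proof -
  let ?P = "\<lambda>n. {p. p permutes {..<n::nat}}"
  have inj: "inj_on (\<lambda>(b, p). rcyc b \<circ> lift p) ({..<Suc n} \<times> ?P n)"
  proof (rule inj_onI, clarify)
    fix b p b' p'
    assume eq: "rcyc b \<circ> lift p = rcyc b' \<circ> lift p'"
    then have "b = b'" by (metis comp_apply lift_simps(1) rcyc_simps(1))
    with eq have "lift p = lift p'" by (metis comp_apply cyc_rcyc ext)
    with \<open>b = b'\<close> show "b = b' \<and> p = p'" by (simp add: inj_lift)
  qed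
  have "(\<lambda>(b, p). rcyc b \<circ> lift p) ` ({..<Suc n} \<times> ?P n) = ?P (Suc n)"
  proof (rule set_eqI, rule iffI)
    fix s assume "s \<in> (\<lambda>(b, p). rcyc b \<circ> lift p) ` ({..<Suc n} \<times> ?P n)"
    then show "s \<in> ?P (Suc n)"
      by (auto intro: permutes_compose rcyc_permutes simp: lift_permutes_iff)
  next
    fix s assume "s \<in> ?P (Suc n)"
    then have s: "s permutes {..<Suc n}" by simp
    then have b: "s 0 < Suc n" using permutes_in_image[OF s, of 0] by simp
    have "cyc (s 0) \<circ> s permutes {..<Suc n}" by (rule permutes_compose[OF s cyc_permutes[OF b]])
    moreover have "(cyc (s 0) \<circ> s) 0 = 0" by (simp add: cyc_def)
    ultimately obtain p where "p permutes {..<n}" and p: "cyc (s 0) \<circ> s = lift p"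
      by (rule permutes_fix_0)
    moreover have "s = rcyc (s 0) \<circ> lift p" unfolding p[symmetric] by (simp add: fun_eq_iff rcyc_cyc)
    ultimately show "s \<in> (\<lambda>(b, p). rcyc b \<circ> lift p) ` ({..<Suc n} \<times> ?P n)"
      using b by (intro image_eqI[of _ _ "(s 0, p)"]) simp_all
  qed
  then have "sum F (?P (Suc n)) = sum F ((\<lambda>(b, p). rcyc b \<circ> lift p) ` ({..<Suc n} \<times> ?P n))" by simp
  also have "\<dots> = (\<Sum>(b, p)\<in>{..<Suc n} \<times> ?P n. F (rcyc b \<circ> lift p))"
    by (subst sum.reindex[OF inj]) (simp add: case_prod_beta o_def)
  finally show ?thesis by (simp add: sum.cartesian_product)
qed

section \<open>Laplace expansion of sums over permutations\<close>

definition asum :: "('b list \<Rightarrow> 'v::real_vector) \<Rightarrow> 'b list \<Rightarrow> 'v" where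
  "asum F xs = (\<Sum>s | s permutes {..<length xs}. of_int (sign s) *\<^sub>R F (permute_list s xs))"

lemma nths_minus_single: "nths xs (- {i}) = take i xs @ drop (Suc i) xs"
proof (induction xs arbitrary: i)
  case (Cons x xs)
  have "nths xs {j. Suc j \<noteq> Suc k} = nths xs (- {k})" for k
    by (rule arg_cong[where f = "nths xs"]) auto
  with Cons show ?case by (cases i) (simp_all add: nths_Cons nths_all)
qed simp

text \<open>Expansion along the first place, with the sign (-1)^b of \<open>rcyc b\<close>. The
  empty list is excluded because \<open>dsum\<close> is 0 there, while \<open>asum F []\<close> is
  \<open>F []\<close>.\<close>

lemma asum_rec:
  assumes "xs \<noteq> []"
  shows "asum F xs = dsum (-1) (\<lambda>x ys. asum (\<lambda>zs. F (x # zs)) ys) xs"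
proof -
  obtain n where n: "length xs = Suc n" using assms by (cases xs) auto
  have pl: "permute_list (rcyc b \<circ> lift p) xs = xs ! b # permute_list p (nths xs (- {b}))"
    if b: "b < Suc n" and p: "p permutes {..<n}" for b p
  proof (rule nth_equalityI)
    have l: "length (nths xs (- {b})) = n" using b n by (simp add: nths_minus_single)
    then show "length (permute_list (rcyc b \<circ> lift p) xs) = length (xs ! b # permute_list p (nths xs (- {b})))"
      by (simp add: n)
    fix i assume "i < length (permute_list (rcyc b \<circ> lift p) xs)"
    then have i: "i < Suc n" by (simp add: n)
    show "permute_list (rcyc b \<circ> lift p) xs ! i = (xs ! b # permute_list p (nths xs (- {b}))) ! i"
    proof (cases i)
      case 0
      then show ?thesis using n by (simp add: permute_list_def del: upt_Suc)
    next
      case (Suc j)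
      then have "p j < n" using permutes_in_image[OF p, of j] i by simp
      with Suc i show ?thesis
        using n l b by (simp add: permute_list_def del: upt_Suc)
          (auto simp: nths_minus_single nth_append min_def)
    qed
  qed
  have sg: "sign (rcyc b \<circ> lift p) = (-1) ^ b * sign p" if b: "b < Suc n" and p: "p permutes {..<n}" for b p
  proof -
    have "permutation (lift p)" using p lift_permutes_iff permutation_of_permutes by blast
    then show ?thesis
      using permutation_of_permutes[OF rcyc_permutes[OF b]] by (simp add: sign_compose sign_rcyc sign_lift[OF p])
  qed
  have "asum F xs = (\<Sum>b<Suc n. \<Sum>p | p permutes {..<n}.
      of_int (sign (rcyc b \<circ> lift p)) *\<^sub>R F (permute_list (rcyc b \<circ> lift p) xs))"
    unfolding asum_def n sum_permutations_Suc ..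
  also have "\<dots> = (\<Sum>b<Suc n. \<Sum>p | p permutes {..<n}.
      (-1) ^ b *\<^sub>R of_int (sign p) *\<^sub>R F (xs ! b # permute_list p (nths xs (- {b}))))"
    by (intro sum.cong refl) (simp add: pl sg)
  also have "\<dots> = (\<Sum>b<length xs. (-1) ^ b *\<^sub>R asum (\<lambda>zs. F (xs ! b # zs)) (nths xs (- {b})))"
    unfolding n by (intro sum.cong refl)
      (simp add: asum_def nths_minus_single n min_def scaleR_right.sum less_Suc_eq_le)
  finally show ?thesis
    unfolding sum_nths_dsum[of "-1" "\<lambda>x. asum (\<lambda>zs. F (x # zs))"] .
qed

lemma asum_alternating:
  assumes "esym (-1) F" shows "asum F xs = fact (length xs) *\<^sub>R F xs"
  using assms
proof (induction "length xs" arbitrary: xs F)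
  case 0
  then show ?case by (simp add: asum_def)
next
  case (Suc n)
  then have "asum F xs = dsum (-1) (\<lambda>x ys. asum (\<lambda>zs. F (x # zs)) ys) xs"
    by (intro asum_rec) auto
  also have "\<dots> = dsum (-1) (\<lambda>x ys. fact n *\<^sub>R F (x # ys)) xs"
  proof (rule dsum_cong)
    fix x ys assume "set ys \<subseteq> set xs" "length xs = Suc (length ys)"
    with Suc.hyps have "n = length ys" by simp
    then show "asum (\<lambda>zs. F (x # zs)) ys = fact n *\<^sub>R F (x # ys)"
      using Suc.hyps(1)[OF _ esym_Cons[OF Suc.prems]] by simp
  qed
  also have "\<dots> = fact (length xs) *\<^sub>R F xs"
    unfolding dsum_scaleR using dsum_self[OF _ Suc.prems, of xs] by (simp add: Suc.hyps(2)[symmetric] mult.commute)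
  finally show ?case .
qed

text \<open>\<open>pairing\<close> without the sum over permutations.\<close>

primrec pr :: "('g list \<Rightarrow> 'x list \<Rightarrow> 'v::real_vector) \<Rightarrow> ('x \<Rightarrow> 'g) list \<Rightarrow> 'x list \<Rightarrow> 'v" where
  "pr c [] = (\<lambda>Xs. c [] Xs)"
| "pr c (t # ts) = (\<lambda>Xs. dsum (-1) (\<lambda>X Ys. pr (\<lambda>bs. c (t X # bs)) ts Ys) Xs)"

lemma pr_too_long: "length Xs < length ts \<Longrightarrow> pr c ts Xs = 0"
proof (induction ts arbitrary: c Xs)
  case (Cons t ts)
  have "pr c (t # ts) Xs = dsum (-1) (\<lambda>_ _. 0) Xs"
    unfolding pr.simps by (rule dsum_cong) (use Cons in auto)
  then show ?case by simp
qed simp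

lemma pr_sign: "pr (\<lambda>bs. (-1) ^ length bs *\<^sub>R c bs) ts Xs = (-1) ^ length ts *\<^sub>R pr c ts Xs"
proof -
  \<comment> \<open>\<open>k\<close> counts the core sections already inserted, so that the
    induction can pass through \<open>t X # bs\<close>.\<close>
  have "pr (\<lambda>bs Xs. (-1) ^ (length bs + k) *\<^sub>R c bs Xs) ts Xs = (-1) ^ (length ts + k) *\<^sub>R pr c ts Xs" for k
  proof (induction ts arbitrary: c Xs k)
    case (Cons t ts)
    then show ?case using Cons[of "Suc k" "\<lambda>bs. c (t _ # bs)"] by (simp add: dsum_scaleR dsum_minus)
  qed simp
  from this[of 0] show ?thesis by (simp add: scaleR_fun_def)
qed

text \<open>One expansion for each one-form strips the list \<open>ts\<close>. The permutations of
  the remaining vector fields contribute equally, by alternation, which gives the factorial that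
  \<open>pairing\<close> divides by.\<close>

lemma asum_pr:
  assumes "\<And>bs. esym (-1) (c bs)" "length ts \<le> length Xs"
  shows "asum (\<lambda>Ys. c (map2 (\<lambda>t X. t X) ts (take (length ts) Ys)) (drop (length ts) Ys)) Xs =
     fact (length Xs - length ts) *\<^sub>R pr c ts Xs"
  using assms
proof (induction ts arbitrary: c Xs)
  case Nil
  then show ?case by (simp add: asum_alternating)
next
  case (Cons t ts)
  have "asum (\<lambda>Ys. c (map2 (\<lambda>t X. t X) (t # ts) (take (length (t # ts)) Ys)) (drop (length (t # ts)) Ys)) Xs =
    dsum (-1) (\<lambda>X. asum (\<lambda>Ys. c (t X # map2 (\<lambda>t X. t X) ts (take (length ts) Ys)) (drop (length ts) Ys))) Xs"
    using Cons.prems(2) by (subst asum_rec) auto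
  also have "\<dots> = dsum (-1) (\<lambda>X Ys. fact (length Xs - length (t # ts)) *\<^sub>R pr (\<lambda>bs. c (t X # bs)) ts Ys) Xs"
  proof (rule dsum_cong)
    fix X Ys assume "set Ys \<subseteq> set Xs" "length Xs = Suc (length Ys)"
    then show "asum (\<lambda>Ys. c (t X # map2 (\<lambda>t X. t X) ts (take (length ts) Ys)) (drop (length ts) Ys)) Ys =
        fact (length Xs - length (t # ts)) *\<^sub>R pr (\<lambda>bs. c (t X # bs)) ts Ys"
      using Cons.IH[of "\<lambda>bs. c (t X # bs)" Ys] Cons.prems by simp
  qed
  finally show ?case by (simp add: dsum_scaleR)
qed

section \<open>Recursion for shuffles\<close>

lemma strict_mono_on_lift:
  "strict_mono_on {..<Suc t} (lift p) \<longleftrightarrow> strict_mono_on {..<t} p"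
  "strict_mono_on {Suc t..<Suc u} (lift p) \<longleftrightarrow> strict_mono_on {t..<u} p"
proof -
  have 1: "strict_mono_on {..<Suc t} (lift p)" if "strict_mono_on {..<t} p"
  proof (rule strict_mono_onI)
    fix i j assume "i \<in> {..<Suc t}" "j \<in> {..<Suc t}" "i < j"
    then show "lift p i < lift p j"
      using strict_mono_onD[OF that, of "i - 1" "j - 1"] by (cases i; cases j) auto
  qed
  have 2: "strict_mono_on {..<t} p" if "strict_mono_on {..<Suc t} (lift p)"
    using strict_mono_onD[OF that, of "Suc _" "Suc _"] by (intro strict_mono_onI) simp
  have 3: "strict_mono_on {Suc t..<Suc u} (lift p)" if "strict_mono_on {t..<u} p"
  proof (rule strict_mono_onI)
    fix i j assume "i \<in> {Suc t..<Suc u}" "j \<in> {Suc t..<Suc u}" "i < j"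
    then show "lift p i < lift p j"
      using strict_mono_onD[OF that, of "i - 1" "j - 1"] by (cases i; cases j) auto
  qed
  have 4: "strict_mono_on {t..<u} p" if "strict_mono_on {Suc t..<Suc u} (lift p)"
    using strict_mono_onD[OF that, of "Suc _" "Suc _"] by (intro strict_mono_onI) simp
  show "strict_mono_on {..<Suc t} (lift p) \<longleftrightarrow> strict_mono_on {..<t} p"
    using 1 2 by blast
  show "strict_mono_on {Suc t..<Suc u} (lift p) \<longleftrightarrow> strict_mono_on {t..<u} p"
    using 3 4 by blast
qed

lemma lift_shuffle_iff: "lift p \<in> shuffle_perms (Suc t) b \<longleftrightarrow> p \<in> shuffle_perms t b"
  unfolding shuffle_perms_def by (simp add: lift_permutes_iff strict_mono_on_lift)

lemma lift_cyc_shuffle_iff: "lift p \<circ> cyc t \<in> shuffle_perms t (Suc b) \<longleftrightarrow> p \<in> shuffle_perms t b"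
proof -
  have perm: "lift p \<circ> cyc t permutes {..<Suc (t + b)} \<longleftrightarrow> p permutes {..<t + b}"
  proof
    assume "lift p \<circ> cyc t permutes {..<Suc (t + b)}"
    from permutes_compose[OF rcyc_permutes this, of t] have "(lift p \<circ> cyc t) \<circ> rcyc t permutes {..<Suc (t + b)}" by simp
    moreover have "(lift p \<circ> cyc t) \<circ> rcyc t = lift p" by (simp add: fun_eq_iff cyc_rcyc)
    ultimately show "p permutes {..<t + b}" by (simp add: lift_permutes_iff)
  qed (simp add: permutes_compose cyc_permutes lift_permutes_iff)
  have 1: "strict_mono_on {..<t} (lift p \<circ> cyc t) \<longleftrightarrow> strict_mono_on {..<t} p"
    by (auto simp: strict_mono_on_def cyc_def)
  have 2: "strict_mono_on {t..<t + Suc b} (lift p \<circ> cyc t)" if m: "strict_mono_on {t..<t + b} p"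
  proof (rule strict_mono_onI)
    fix i j assume "i \<in> {t..<t + Suc b}" "j \<in> {t..<t + Suc b}" "i < j"
    then show "(lift p \<circ> cyc t) i < (lift p \<circ> cyc t) j"
      using strict_mono_onD[OF m, of "i - 1" "j - 1"] by (cases i; cases j) (auto simp: cyc_def)
  qed
  have 3: "strict_mono_on {t..<t + b} p" if m: "strict_mono_on {t..<t + Suc b} (lift p \<circ> cyc t)"
  proof (rule strict_mono_onI)
    fix i j assume "i \<in> {t..<t + b}" "j \<in> {t..<t + b}" "i < j"
    then show "p i < p j"
      using strict_mono_onD[OF m, of "Suc i" "Suc j"] by (simp add: cyc_def)
  qed
  show ?thesis
    unfolding shuffle_perms_def using perm 1 2 3 by auto
qed

lemma shuffle_perms_finite: "finite (shuffle_perms t b)"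
  unfolding shuffle_perms_def by (rule finite_subset[OF _ finite_permutations[of "{..<t + b}"]]) auto

text \<open>A shuffle is increasing on each block, so the preimage of 0 is the first place of its
  block.\<close>

lemma shuffle_perms_0: "s \<in> shuffle_perms t b \<Longrightarrow> 0 < t + b \<Longrightarrow> (0 < t \<and> s 0 = 0) \<or> (0 < b \<and> s t = 0)"
proof -
  assume s: "s \<in> shuffle_perms t b" and pos: "0 < t + b"
  then have p: "s permutes {..<t + b}" and m: "strict_mono_on {..<t} s" "strict_mono_on {t..<t + b} s"
    by (auto simp: shuffle_perms_def)
  obtain i where i: "s i = 0" using permutes_inverses(1)[OF p] by blast
  then have il: "i < t + b" using permutes_in_image[OF p, of i] pos by simp
  show ?thesis
  proof (cases "i < t")
    case True
    have "i = 0" using strict_mono_onD[OF m(1), of 0 i] i True by (cases i) auto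
    then show ?thesis using i True by simp
  next
    case False
    have "i = t" using strict_mono_onD[OF m(2), of t i] i il False by (cases "i = t") auto
    then show ?thesis using i il by simp
  qed
qed

text \<open>The value 0 for \<open>t\<close> beyond the length makes \<open>shsum_Cons\<close> hold
  without a side condition.\<close>

definition shsum :: "('b list \<Rightarrow> 'b list \<Rightarrow> 'v::real_vector) \<Rightarrow> nat \<Rightarrow> 'b list \<Rightarrow> 'v" where
  "shsum F t xs = (if t \<le> length xs then \<Sum>s\<in>shuffle_perms t (length xs - t). of_int (sign s) *\<^sub>R
     F (map (\<lambda>i. xs ! s i) [0..<t]) (map (\<lambda>i. xs ! s i) [t..<length xs]) else 0)"

lemma shuffle_perms_Suc:
  assumes "0 < t + b"
  shows "shuffle_perms t b = (if 0 < t then lift ` shuffle_perms (t - 1) b else {}) \<union>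
    (if 0 < b then (\<lambda>p. lift p \<circ> cyc t) ` shuffle_perms t (b - 1) else {})" (is "_ = ?A \<union> ?B")
proof (intro set_eqI iffI)
  fix s assume s: "s \<in> shuffle_perms t b"
  then have p: "s permutes {..<Suc (t + b - 1)}" using assms by (simp add: shuffle_perms_def)
  from shuffle_perms_0[OF s assms] show "s \<in> ?A \<union> ?B"
  proof
    assume "0 < t \<and> s 0 = 0"
    with p obtain q where "s = lift q" by (metis permutes_fix_0)
    with s \<open>0 < t \<and> s 0 = 0\<close> show ?thesis using lift_shuffle_iff[of q "t - 1" b] by simp
  next
    assume b: "0 < b \<and> s t = 0"
    then have "s \<circ> rcyc t permutes {..<Suc (t + b - 1)}" by (intro permutes_compose[OF rcyc_permutes p]) simp
    then obtain q where q: "s \<circ> rcyc t = lift q" by (rule permutes_fix_0) (use b in auto)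
    have "s = lift q \<circ> cyc t" unfolding q[symmetric] by (simp add: fun_eq_iff rcyc_cyc)
    with s b show ?thesis using lift_cyc_shuffle_iff[of q t "b - 1"] by simp
  qed
next
  fix s assume "s \<in> ?A \<union> ?B"
  then show "s \<in> shuffle_perms t b"
    using lift_shuffle_iff[of _ "t - 1" b] lift_cyc_shuffle_iff[of _ t "b - 1"] by (auto split: if_splits)
qed

lemma shsum_0_Nil: "shsum F 0 [] = F [] []"
proof -
  have "shuffle_perms 0 0 = {id}" by (auto simp: shuffle_perms_def strict_mono_on_def)
  then show ?thesis by (simp add: shsum_def)
qed

text \<open>Pascal's rule: \<open>x\<close> opens the first block, or it opens the second and has to
  pass the \<open>t\<close> entries of the first.\<close>

lemma shsum_Cons: "shsum F t (x # xs) = (if 0 < t then shsum (\<lambda>us. F (x # us)) (t - 1) xs else 0) +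
    (-1) ^ t *\<^sub>R shsum (\<lambda>us ws. F us (x # ws)) t xs"
proof (cases "t \<le> Suc (length xs)")
  case True
  let ?n = "length xs"
  let ?f = "\<lambda>s. of_int (sign s) *\<^sub>R F (map (\<lambda>i. (x # xs) ! s i) [0..<t]) (map (\<lambda>i. (x # xs) ! s i) [t..<Suc ?n])"
  let ?A = "if 0 < t then lift ` shuffle_perms (t - 1) (Suc ?n - t) else {}"
  let ?B = "if 0 < Suc ?n - t then (\<lambda>p. lift p \<circ> cyc t) ` shuffle_perms t (Suc ?n - t - 1) else {}"
  have "?A \<inter> ?B = {}"
  proof -
    have "lift p \<noteq> lift q \<circ> cyc t" if "0 < t" for p q
    proof
      assume "lift p = lift q \<circ> cyc t"
      then have "lift p 0 = (lift q \<circ> cyc t) 0" by simp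
      with that show False by (simp add: cyc_def)
    qed
    then show ?thesis by auto
  qed
  then have "shsum F t (x # xs) = sum ?f ?A + sum ?f ?B"
    using True shuffle_perms_Suc[of t "Suc ?n - t"]
    by (simp add: shsum_def sum.union_disjoint shuffle_perms_finite)
  moreover have "sum ?f ?A = (if 0 < t then shsum (\<lambda>us. F (x # us)) (t - 1) xs else 0)"
  proof (cases t)
    case (Suc u)
    have m1: "map (\<lambda>i. (x # xs) ! lift p i) [0..<t] = x # map (\<lambda>i. xs ! p i) [0..<u]" for p
      unfolding Suc by (simp add: upt_conv_Cons map_Suc_upt[symmetric] del: upt_Suc)
    have m2: "map (\<lambda>i. (x # xs) ! lift p i) [t..<Suc ?n] = map (\<lambda>i. xs ! p i) [u..<?n]" for p
      unfolding Suc by (simp add: map_Suc_upt[symmetric] del: upt_Suc)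
    have "sum ?f ?A = (\<Sum>p\<in>shuffle_perms u (?n - u). ?f (lift p))"
      using Suc by (simp add: sum.reindex inj_on_def inj_lift)
    also have "\<dots> = shsum (\<lambda>us. F (x # us)) u xs"
      unfolding shsum_def m1 m2 using True Suc
      by (simp, intro sum.cong refl) (auto simp: sign_lift shuffle_perms_def)
    finally show ?thesis using Suc by simp
  qed simp
  moreover have "sum ?f ?B = (-1) ^ t *\<^sub>R shsum (\<lambda>us ws. F us (x # ws)) t xs"
  proof (cases "t \<le> ?n")
    case t: True
    have m1: "map (\<lambda>i. (x # xs) ! (lift p \<circ> cyc t) i) [0..<t] = map (\<lambda>i. xs ! p i) [0..<t]" for p
      by (simp add: cyc_def)
    have m2: "map (\<lambda>i. (x # xs) ! (lift p \<circ> cyc t) i) [t..<Suc ?n] = x # map (\<lambda>i. xs ! p i) [t..<?n]" for p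
      using t by (simp add: upt_conv_Cons map_Suc_upt[symmetric] cyc_def del: upt_Suc)
    have inj: "inj_on (\<lambda>p. lift p \<circ> cyc t) S" for S
    proof (rule inj_onI)
      fix p q assume "lift p \<circ> cyc t = lift q \<circ> cyc t"
      then have "lift p = lift q" by (metis comp_apply cyc_rcyc ext)
      then show "p = q" by (rule inj_lift)
    qed
    have "sum ?f ?B = (\<Sum>p\<in>shuffle_perms t (?n - t). ?f (lift p \<circ> cyc t))"
      using t by (simp add: sum.reindex[OF inj] Suc_diff_le)
    also have "\<dots> = (\<Sum>p\<in>shuffle_perms t (?n - t). (-1) ^ t *\<^sub>R of_int (sign p) *\<^sub>R
         F (map (\<lambda>i. xs ! p i) [0..<t]) (x # map (\<lambda>i. xs ! p i) [t..<?n]))"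
    proof (rule sum.cong[OF refl])
      fix p assume "p \<in> shuffle_perms t (?n - t)"
      then have p: "p permutes {..<?n}" using t by (simp add: shuffle_perms_def)
      then have "permutation (lift p)" using lift_permutes_iff permutation_of_permutes by blast
      then have "sign (lift p \<circ> cyc t) = (-1) ^ t * sign p"
        using permutation_of_permutes[OF cyc_permutes[OF lessI]] by (simp add: sign_compose sign_cyc sign_lift[OF p])
      then show "?f (lift p \<circ> cyc t) = (-1) ^ t *\<^sub>R of_int (sign p) *\<^sub>R
         F (map (\<lambda>i. xs ! p i) [0..<t]) (x # map (\<lambda>i. xs ! p i) [t..<?n])"
        unfolding m1 m2 by simp
    qed
    also have "\<dots> = (-1) ^ t *\<^sub>R shsum (\<lambda>us ws. F us (x # ws)) t xs"
      unfolding shsum_def using t by (simp add: scaleR_right.sum)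
    finally show ?thesis .
  qed (simp add: shsum_def)
  ultimately show ?thesis by simp
qed (auto simp: shsum_def)

lemma esym_front_sign:
  assumes "esym e F" shows "F (xs @ y # ys) = e ^ length xs *\<^sub>R F (y # xs @ ys)"
  using assms
proof (induction xs arbitrary: F)
  case (Cons x xs)
  have "F (x # xs @ y # ys) = e ^ length xs *\<^sub>R F (x # y # xs @ ys)"
    by (rule Cons.IH[OF esym_Cons[OF Cons.prems]])
  also have "\<dots> = e ^ length xs *\<^sub>R e *\<^sub>R F (y # x # xs @ ys)"
    by (subst esym_swap[OF Cons.prems]) (rule refl)
  finally show ?case by (simp add: mult.commute)
qed simp

lemma esym_front: "esym 1 F \<Longrightarrow> F (xs @ y # ys) = F (y # xs @ ys)"
  using esym_front_sign[of 1 F xs y ys] by simp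

lemma pr_scaleR: "pr (\<lambda>bs. r *\<^sub>R c bs) ts Xs = r *\<^sub>R pr c ts Xs"
  by (induction ts arbitrary: c Xs) (simp_all add: dsum_scaleR)

lemma shsum_cong:
  "(\<And>us ws. length us = t \<Longrightarrow> F us ws = F' us ws) \<Longrightarrow> shsum F t xs = shsum F' t xs"
  by (simp add: shsum_def)

lemma sum_dsum: "(\<Sum>t\<in>S. dsum e (F t) xs) = dsum e (\<lambda>x ys. \<Sum>t\<in>S. F t x ys) xs"
  by (induction xs arbitrary: F) (simp_all add: sum.distrib scaleR_right.sum[symmetric])

lemma shsum_dsum:
  "shsum (\<lambda>us ws. dsum e (\<lambda>X Ys. F X Ys us ws) Xs) t xs = dsum e (\<lambda>X Ys. shsum (F X Ys) t xs) Xs"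
  by (cases "t \<le> length xs") (simp_all add: shsum_def dsum_scaleR sum_dsum[symmetric])

lemma shsum_scaleR: "shsum (\<lambda>us ws. r *\<^sub>R F us ws) t xs = r *\<^sub>R shsum F t xs"
  by (cases "t \<le> length xs") (simp_all add: shsum_def scaleR_right.sum mult.commute)

lemma shsum_too_long: "length xs < t \<Longrightarrow> shsum F t xs = 0"
  by (simp add: shsum_def)

context im_algebra
begin

text \<open>Each complete lift is kept or replaced by minus its core part. Sorting these choices by
  the number \<open>t\<close> of replaced lifts turns the recursion into a sum over
  shuffles.\<close>

lemma hpull_shuffle:
  "coch c \<Longrightarrow> hpull as c bs Xs = (\<Sum>t\<le>length as. (-1) ^ t *\<^sub>R
     shsum (\<lambda>us ws. pr (\<lambda>bs'. c ws (map hor bs @ bs')) (map C us) Xs) t as)"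
proof (induction as arbitrary: c Xs)
  case Nil
  show ?case by (simp add: shsum_0_Nil)
next
  case (Cons a as)
  let ?n = "length as"
  let ?F = "\<lambda>us ws. pr (\<lambda>bs'. c ws (map hor bs @ bs')) (map C us) Xs"
  have "(\<Sum>t\<le>Suc ?n. (-1) ^ t *\<^sub>R shsum ?F t (a # as)) =
     (\<Sum>t\<le>Suc ?n. (-1) ^ t *\<^sub>R (if 0 < t then shsum (\<lambda>us. ?F (a # us)) (t - 1) as else 0)) +
     (\<Sum>t\<le>Suc ?n. (-1) ^ t *\<^sub>R (-1) ^ t *\<^sub>R shsum (\<lambda>us ws. ?F us (a # ws)) t as)"
    unfolding shsum_Cons scaleR_add_right sum.distrib ..
  also have "(\<Sum>t\<le>Suc ?n. (-1) ^ t *\<^sub>R (if 0 < t then shsum (\<lambda>us. ?F (a # us)) (t - 1) as else 0)) =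
     - (\<Sum>t\<le>?n. (-1) ^ t *\<^sub>R shsum (\<lambda>us. ?F (a # us)) t as)"
    by (subst sum.atMost_Suc_shift) (simp add: sum_negf)
  also have "(\<Sum>t\<le>?n. (-1) ^ t *\<^sub>R shsum (\<lambda>us. ?F (a # us)) t as) = dsum (-1) (\<lambda>X Ys. hpull as (ibeta (C a X) c) bs Ys) Xs"
  proof -
    have "shsum (\<lambda>us. ?F (a # us)) t as = dsum (-1) (\<lambda>X Ys.
       shsum (\<lambda>us ws. pr (\<lambda>bs'. ibeta (C a X) c ws (map hor bs @ bs')) (map C us) Ys) t as) Xs" for t
    proof -
      have "c ws (map hor bs @ C a X # bs') = ibeta (C a X) c ws (map hor bs @ bs')" for X ws bs'
        unfolding ibeta_def by (rule ext, rule esym_front[OF coch_beta[OF Cons.prems]])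
      then show ?thesis unfolding shsum_dsum[symmetric] by simp
    qed
    then show ?thesis
      by (simp add: Cons.IH[OF coch_ibeta[OF Cons.prems]] flip: dsum_scaleR sum_dsum)
  qed
  also have "(\<Sum>t\<le>Suc ?n. (-1) ^ t *\<^sub>R (-1) ^ t *\<^sub>R shsum (\<lambda>us ws. ?F us (a # ws)) t as) =
     (-1) ^ length bs *\<^sub>R hpull as (ialpha a c) bs Xs"
  proof -
    \<comment> \<open>The sign in \<open>ialpha\<close> counts the \<open>t\<close> core sections
      inserted by \<open>pr\<close> as well as \<open>bs\<close>. Its part (-1)^t compensates the
      sign of \<open>shsum_Cons\<close>, so that one factor (-1)^t remains in the sum.\<close>
    have eq: "shsum (\<lambda>us ws. ?F us (a # ws)) t as = (-1) ^ t *\<^sub>R (-1) ^ length bs *\<^sub>R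
      shsum (\<lambda>us ws. pr (\<lambda>bs'. ialpha a c ws (map hor bs @ bs')) (map C us) Xs) t as" for t
    proof -
      have "(\<lambda>bs'. c (a # ws) (map hor bs @ bs')) =
        (\<lambda>bs'. (-1) ^ length bs' *\<^sub>R (-1) ^ length bs *\<^sub>R ialpha a c ws (map hor bs @ bs'))" for ws
      proof (intro ext)
        fix bs' :: "'g list" and Ys
        have "(-1) ^ length bs' * ((-1) ^ length bs * (-1) ^ (length bs + length bs')) = (1::real)"
          by (simp add: power_add algebra_simps flip: power_mult_distrib)
        then show "c (a # ws) (map hor bs @ bs') Ys =
            ((-1) ^ length bs' *\<^sub>R (-1) ^ length bs *\<^sub>R ialpha a c ws (map hor bs @ bs')) Ys"
          by (simp add: ialpha_def mult.assoc)
      qed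
      then have "?F us (a # ws) = (-1) ^ length us *\<^sub>R (-1) ^ length bs *\<^sub>R
          pr (\<lambda>bs'. ialpha a c ws (map hor bs @ bs')) (map C us) Xs" for us ws
        by (simp only: pr_sign pr_scaleR length_map)
      then show ?thesis unfolding shsum_scaleR[symmetric] by (intro shsum_cong) simp
    qed
    have "(\<Sum>t\<le>Suc ?n. (-1) ^ t *\<^sub>R (-1) ^ t *\<^sub>R shsum (\<lambda>us ws. ?F us (a # ws)) t as) =
      (\<Sum>t\<le>?n. (-1) ^ t *\<^sub>R (-1) ^ t *\<^sub>R shsum (\<lambda>us ws. ?F us (a # ws)) t as)"
      by (simp add: shsum_too_long)
    also have "\<dots> = (-1) ^ length bs *\<^sub>R hpull as (ialpha a c) bs Xs"
      unfolding Cons.IH[OF coch_ialpha[OF Cons.prems]] eq scaleR_right.sum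
      by (rule sum.cong) (simp_all add: mult.commute)
    finally show ?thesis .
  qed
  finally show ?case by simp
qed

end

section \<open>Smooth functions in charts, and linear projections\<close>

lemma Ck_on_subset: "Ck_on k S f \<Longrightarrow> T \<subseteq> S \<Longrightarrow> Ck_on k T f"
  by (induction k arbitrary: f) (auto intro: continuous_on_subset)

lemma Ck_on_cong:
  assumes "open S" "\<And>x. x \<in> S \<Longrightarrow> f x = g x"
  shows "Ck_on k S f \<Longrightarrow> Ck_on k S g"
  using assms(2)
proof (induction k arbitrary: f g)
  case 0
  then show ?case using continuous_on_cong[of S S f g] by simp
next
  case (Suc k)
  have d: "(g has_derivative frechet_derivative f (at x)) (at x)" if "x \<in> S" for x
  proof -
    have "(f has_derivative frechet_derivative f (at x)) (at x)"
      using Suc.prems(1) that by (simp add: frechet_derivative_works)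
    then show ?thesis
      by (rule has_derivative_transform_within_open[OF _ assms(1) that]) (rule Suc.prems(2))
  qed
  have eq: "frechet_derivative f (at x) v = frechet_derivative g (at x) v" if "x \<in> S" for x v
    by (rule fun_cong[OF frechet_derivative_at[OF d[OF that]]])
  have "Ck_on k S (\<lambda>x. frechet_derivative g (at x) v)" for v
  proof (rule Suc.IH)
    show "Ck_on k S (\<lambda>x. frechet_derivative f (at x) v)" using Suc.prems(1) by simp
  qed (rule eq)
  moreover have "g differentiable (at x)" if "x \<in> S" for x
    using d[OF that] unfolding differentiable_def by blast
  ultimately show ?case by simp
qed

lemma Ck_on_Suc_D: "Ck_on (Suc k) S f \<Longrightarrow> Ck_on k S f"
proof (induction k arbitrary: f)
  case 0
  then show ?case
    by (auto intro!: continuous_at_imp_continuous_on differentiable_imp_continuous_within)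
qed (auto simp del: Ck_on.simps(1))

lemma Ck_on_const: "Ck_on k S (\<lambda>x. c)"
  by (induction k arbitrary: c) (simp_all add: frechet_derivative_const)

lemma Ck_on_add:
  assumes "open S"
  shows "Ck_on k S f \<Longrightarrow> Ck_on k S g \<Longrightarrow> Ck_on k S (\<lambda>x. f x + g x)"
proof (induction k arbitrary: f g)
  case 0
  then show ?case by (simp add: continuous_on_add)
next
  case (Suc k)
  have "Ck_on k S (\<lambda>x. frechet_derivative (\<lambda>x. f x + g x) (at x) v)" for v
  proof (rule Ck_on_cong[OF assms])
    show "Ck_on k S (\<lambda>x. frechet_derivative f (at x) v + frechet_derivative g (at x) v)"
      using Suc by simp
    show "frechet_derivative f (at x) v + frechet_derivative g (at x) v =
        frechet_derivative (\<lambda>x. f x + g x) (at x) v" if "x \<in> S" for x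
    proof -
      have "((\<lambda>x. f x + g x) has_derivative
          (\<lambda>v. frechet_derivative f (at x) v + frechet_derivative g (at x) v)) (at x)"
        using Suc.prems that by (intro has_derivative_add) (simp_all add: frechet_derivative_works)
      from fun_cong[OF frechet_derivative_at[OF this]] show ?thesis .
    qed
  qed
  then show ?case using Suc.prems by simp
qed

lemma Ck_on_mult:
  fixes f g :: "'e::real_normed_vector \<Rightarrow> real"
  assumes "open S"
  shows "Ck_on k S f \<Longrightarrow> Ck_on k S g \<Longrightarrow> Ck_on k S (\<lambda>x. f x * g x)"
proof (induction k arbitrary: f g)
  case 0
  then show ?case by (simp add: continuous_on_mult)
next
  case (Suc k)
  have "Ck_on k S (\<lambda>x. frechet_derivative (\<lambda>x. f x * g x) (at x) v)" for v
  proof (rule Ck_on_cong[OF assms])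
    show "Ck_on k S (\<lambda>x. f x * frechet_derivative g (at x) v + frechet_derivative f (at x) v * g x)"
      using Suc.prems(1)[THEN Ck_on_Suc_D] Suc.prems(2)[THEN Ck_on_Suc_D] Suc.prems
      by (intro Ck_on_add[OF assms] Suc.IH) simp_all
    show "f x * frechet_derivative g (at x) v + frechet_derivative f (at x) v * g x =
        frechet_derivative (\<lambda>x. f x * g x) (at x) v" if "x \<in> S" for x
    proof -
      have "((\<lambda>x. f x * g x) has_derivative
          (\<lambda>v. f x * frechet_derivative g (at x) v + frechet_derivative f (at x) v * g x)) (at x)"
        using Suc.prems that by (intro has_derivative_mult) (simp_all add: frechet_derivative_works)
      from fun_cong[OF frechet_derivative_at[OF this]] show ?thesis .
    qed
  qed
  then show ?case using Suc.prems by simp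
qed

lemma chart_image_open:
  assumes "smooth_atlas \<A>" "(U, \<phi>) \<in> \<A>" "open W"
  shows "open (\<phi> ` (U \<inter> W))"
proof -
  from assms(1,2) have "open U" "open (\<phi> ` U)" and h: "homeomorphism U (\<phi> ` U) \<phi> (inv_into U \<phi>)"
    unfolding smooth_atlas_def by fast+
  have "openin (top_of_set (\<phi> ` U)) (\<phi> ` (U \<inter> W))"
    using homeomorphism_imp_open_map[OF h] assms(3) by (simp add: openin_open_Int)
  then show ?thesis using \<open>open (\<phi> ` U)\<close> openin_open_trans by blast
qed

lemma smooth_fun_on_subset: "smooth_fun_on \<A> W f \<Longrightarrow> V \<subseteq> W \<Longrightarrow> smooth_fun_on \<A> V f"
  unfolding smooth_fun_on_def smooth_on_def by (fastforce intro: Ck_on_subset)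

lemma smooth_fun_on_const: "smooth_fun_on \<A> W (\<lambda>x. c)"
  by (simp add: smooth_fun_on_def smooth_on_def o_def Ck_on_const)

lemma smooth_fun_on_add:
  assumes "smooth_atlas \<A>" "open W" "smooth_fun_on \<A> W f" "smooth_fun_on \<A> W g"
  shows "smooth_fun_on \<A> W (\<lambda>x. f x + g x)"
  using assms(3,4) unfolding smooth_fun_on_def smooth_on_def o_def
  by (auto intro!: Ck_on_add chart_image_open[OF assms(1) _ assms(2)])

lemma smooth_fun_on_mult:
  assumes "smooth_atlas \<A>" "open W" "smooth_fun_on \<A> W f" "smooth_fun_on \<A> W g"
  shows "smooth_fun_on \<A> W (\<lambda>x. f x * g x)"
  using assms(3,4) unfolding smooth_fun_on_def smooth_on_def o_def
  by (auto intro!: Ck_on_mult chart_image_open[OF assms(1) _ assms(2)])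

text \<open>Purely algebraic: the projection is a left inverse of the inclusion of \<open>V\<close>.
  It serves to extend operations on sections and vector fields to all functions of the ambient
  type.\<close>

lemma linear_projection_onto:
  fixes V :: "'v::real_vector set"
  assumes "subspace V"
  obtains P where "linear P" "\<And>x. P x \<in> V" "\<And>x. x \<in> V \<Longrightarrow> P x = x"
proof -
  have "linear (id :: 'v \<Rightarrow> 'v)" by (simp add: linear_iff)
  from linear_exists_left_inverse_on[OF this assms] show ?thesis
    using that by (auto simp: image_subset_iff)
qed

section \<open>Sections, vector fields and Weil cochains\<close>

text \<open>Translates between two conventions: linearity in each slot on \<open>S\<close> and
  vanishing on repeated entries, against linearity of the head on the whole space and adjacent
  swaps. Antisymmetry is polarisation, with \<open>y + z\<close> in both slots. The value 0 at wrong
  lengths lets one function serve all lengths.\<close>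

lemma esym_alternating_proj:
  assumes P: "linear P" "\<And>x. P x \<in> S" and S: "subspace S"
    and lin: "\<And>xs i r y z. xs \<in> tuples n S \<Longrightarrow> i < n \<Longrightarrow> y \<in> S \<Longrightarrow> z \<in> S \<Longrightarrow>
      F (xs[i := r *\<^sub>R y + z]) = r *\<^sub>R F (xs[i := y]) + F (xs[i := z])"
    and out: "\<And>xs. length xs \<noteq> n \<Longrightarrow> F xs = 0"
  shows "linear (\<lambda>x. F (map P (x # xs)))"
    and "alternating n S F \<Longrightarrow> esym (-1) (\<lambda>xs. F (map P xs))"
    and "symmetric n S F \<Longrightarrow> esym 1 (\<lambda>xs. F (map P xs))"
proof -
  have t: "map P xs \<in> tuples n S \<longleftrightarrow> length xs = n" for xs
    using P(2) by (auto simp: tuples_def)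
  have l: "F (xs @ (r *\<^sub>R y + z) # ys) = r *\<^sub>R F (xs @ y # ys) + F (xs @ z # ys)"
    if "set xs \<subseteq> S" "set ys \<subseteq> S" "y \<in> S" "z \<in> S" "length xs + length ys + 1 = n" for xs ys r y z
    using lin[of "xs @ y # ys" "length xs" y z r] that by (simp add: tuples_def)
  have z: "F (xs @ 0 # ys) = 0"
    if "set xs \<subseteq> S" "set ys \<subseteq> S" "length xs + length ys + 1 = n" for xs ys
    using l[of xs ys 0 0 1] that subspace_0[OF S] by simp
  have lin': "linear (\<lambda>x. F (map P (x # xs)))" for xs
  proof (cases "length xs + 1 = n")
    case True
    have m: "set (map P xs) \<subseteq> S" using P(2) by auto
    have 1: "F (P (r *\<^sub>R x + y) # map P xs) = r *\<^sub>R F (P x # map P xs) + F (P y # map P xs)" for r x y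
      using l[of "[]" "map P xs" "P x" "P y" r] m P(2) True
      by (simp add: linear_add[OF P(1)] linear_scale[OF P(1)])
    have 2: "F (P 0 # map P xs) = 0"
      using z[of "[]" "map P xs"] m True by (simp add: linear_0[OF P(1)])
    show ?thesis using 1[of 1] 1[of _ _ 0] 2 by (simp add: linear_iff)
  qed (simp add: linear_iff out)
  then show "linear (\<lambda>x. F (map P (x # xs)))" .
  show "esym (-1) (\<lambda>xs. F (map P xs))" if a: "alternating n S F"
  proof (rule esymI[OF lin'])
    fix xs y z ys
    show "F (map P (xs @ y # z # ys)) = - 1 *\<^sub>R F (map P (xs @ z # y # ys))"
    proof (cases "length xs + length ys + 2 = n")
      case True
      let ?f = "\<lambda>u w. F (map P xs @ u # w # map P ys)"
      have d: "?f (P u) (P u) = 0" for u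
        using a t[of "xs @ u # u # ys"] True unfolding alternating_def by simp
      have s: "set (map P zs) \<subseteq> S" for zs using P(2) by auto
      have 1: "?f (P u + P u') (P w) = ?f (P u) (P w) + ?f (P u') (P w)" for u u' w
        using l[of "map P xs" "map P (w # ys)" "P u" "P u'" 1] s P(2) True by simp
      have 2: "?f (P w) (P u + P u') = ?f (P w) (P u) + ?f (P w) (P u')" for u u' w
        using l[of "map P (xs @ [w])" "map P ys" "P u" "P u'" 1] s P(2) True by simp
      have "0 = ?f (P (y + z)) (P (y + z))" by (simp only: d)
      also have "\<dots> = ?f (P y) (P (y + z)) + ?f (P z) (P (y + z))"
        unfolding linear_add[OF P(1), of y z] by (subst 1[of y z "y + z", unfolded linear_add[OF P(1)]]) simp
      also have "\<dots> = ?f (P y) (P z) + ?f (P z) (P y)"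
        unfolding linear_add[OF P(1)] 2 d by simp
      finally show ?thesis by (simp add: eq_neg_iff_add_eq_0)
    qed (simp add: out)
  qed
  show "esym 1 (\<lambda>xs. F (map P xs))" if a: "symmetric n S F"
  proof (rule esymI[OF lin'])
    fix xs y z ys
    show "F (map P (xs @ y # z # ys)) = 1 *\<^sub>R F (map P (xs @ z # y # ys))"
    proof (cases "length xs + length ys + 2 = n")
      case True
      then show ?thesis
        using a t[of "xs @ y # z # ys"] unfolding symmetric_def by (simp add: add_mset_commute)
    qed (simp add: out)
  qed
qed

lemma rscale_eq_scaleR: "r \<cdot> s = r *\<^sub>R s"
  by (simp add: rscale_def fun_eq_iff)

lemma const_fscale: "(\<lambda>_. r) \<odot> s = r *\<^sub>R s"
  by (simp add: fscale_def fun_eq_iff)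

lemma const_vscale: "vscale (\<lambda>_. r) X = r *\<^sub>R X"
  by (simp add: vscale_def fun_eq_iff)

lemma linear_fscale: "linear (\<lambda>s. f \<odot> s)"
  by (simp add: linear_iff fscale_def fun_eq_iff scaleR_add_right)

locale im_setting =
  fixes L :: "('m::{t2_space,second_countable_topology}, 'e::real_normed_vector, 'a::real_vector) algebroid"
    and K :: "'m \<Rightarrow> 'a set"
    and \<omega> :: "('m, 'a) cochain"
  assumes L: "lie_algebroid L"
    and K: "bundle_of_ideals L K"
    and omega: "\<omega> \<in> IM_connections L K"
begin

abbreviation "S \<equiv> sections L"
abbreviation "T \<equiv> vector_fields (charts L)"
abbreviation "Fn \<equiv> smooth_funs (charts L)"
abbreviation "KS \<equiv> sub_sections L K"

lemma atlas: "smooth_atlas (charts L)" and vb: "vector_bundle L"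
  using L by (simp_all add: lie_algebroid_def)

section \<open>Smooth functions, sections and vector fields as modules\<close>

lemma Fn_const: "(\<lambda>_. r) \<in> Fn"
  by (simp add: smooth_funs_def smooth_fun_on_const)

lemma Fn_add: "f \<in> Fn \<Longrightarrow> g \<in> Fn \<Longrightarrow> (\<lambda>x. f x + g x) \<in> Fn"
  by (simp add: smooth_funs_def smooth_fun_on_add atlas)

lemma Fn_mult: "f \<in> Fn \<Longrightarrow> g \<in> Fn \<Longrightarrow> (\<lambda>x. f x * g x) \<in> Fn"
  by (simp add: smooth_funs_def smooth_fun_on_mult atlas)

lemma Fn_lin: "f \<in> Fn \<Longrightarrow> g \<in> Fn \<Longrightarrow> (\<lambda>x. a * f x + b * g x) \<in> Fn"
  by (intro Fn_add Fn_mult Fn_const)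

lemma subspace_fibre: "subspace (fibre L x)"
  using vb by (simp add: vector_bundle_def)

lemma frames_open: "(U, es) \<in> frames L \<Longrightarrow> open U"
  using vb unfolding vector_bundle_def by fast

lemma smooth_coeffs_on_add:
  assumes "open W" "smooth_coeffs_on (charts L) W es s" "smooth_coeffs_on (charts L) W es t"
  shows "smooth_coeffs_on (charts L) W es (s + t)"
proof -
  obtain cs ds where cs: "length cs = length es" "\<forall>c\<in>set cs. smooth_fun_on (charts L) W c"
      "\<forall>x\<in>W. s x = (\<Sum>i<length es. (cs ! i) x *\<^sub>R (es ! i) x)"
    and ds: "length ds = length es" "\<forall>c\<in>set ds. smooth_fun_on (charts L) W c"
      "\<forall>x\<in>W. t x = (\<Sum>i<length es. (ds ! i) x *\<^sub>R (es ! i) x)"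
    using assms(2,3) unfolding smooth_coeffs_on_def by blast
  show ?thesis
    unfolding smooth_coeffs_on_def
  proof (intro exI[of _ "map2 (\<lambda>c d x. c x + d x) cs ds"] conjI ballI)
    fix c assume "c \<in> set (map2 (\<lambda>c d x. c x + d x) cs ds)"
    then obtain a b where ab: "(a, b) \<in> set (zip cs ds)" and c: "c = (\<lambda>x. a x + b x)" by auto
    show "smooth_fun_on (charts L) W c"
      unfolding c using set_zip_leftD[OF ab] set_zip_rightD[OF ab] cs(2) ds(2)
      by (intro smooth_fun_on_add[OF atlas assms(1)]) blast+
  qed (use cs ds in \<open>simp_all add: scaleR_add_left sum.distrib\<close>)
qed

lemma smooth_coeffs_on_fscale:
  assumes "open W" "f \<in> Fn" "smooth_coeffs_on (charts L) W es s"
  shows "smooth_coeffs_on (charts L) W es (f \<odot> s)"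
proof -
  obtain cs where cs: "length cs = length es" "\<forall>c\<in>set cs. smooth_fun_on (charts L) W c"
      "\<forall>x\<in>W. s x = (\<Sum>i<length es. (cs ! i) x *\<^sub>R (es ! i) x)"
    using assms(3) unfolding smooth_coeffs_on_def by blast
  have "smooth_fun_on (charts L) W f"
    using assms(2) smooth_fun_on_subset[of "charts L" UNIV f W] by (simp add: smooth_funs_def)
  then show ?thesis
    unfolding smooth_coeffs_on_def
    using cs by (intro exI[of _ "map (\<lambda>c x. f x * c x) cs"])
      (auto simp: fscale_def scaleR_sum_right intro!: smooth_fun_on_mult[OF atlas assms(1)])
qed

lemma S_add: "s \<in> S \<Longrightarrow> t \<in> S \<Longrightarrow> s + t \<in> S"
  unfolding sections_def section_on_def
  by (auto intro: subspace_add[OF subspace_fibre] smooth_coeffs_on_add frames_open)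

lemma S_fscale: "f \<in> Fn \<Longrightarrow> s \<in> S \<Longrightarrow> f \<odot> s \<in> S"
  unfolding sections_def section_on_def
  by (auto intro: smooth_coeffs_on_fscale frames_open)
     (simp add: fscale_def subspace_scale[OF subspace_fibre])

lemma S_zero: "0 \<in> S"
  unfolding sections_def section_on_def smooth_coeffs_on_def
  by (auto simp: subspace_0[OF subspace_fibre] smooth_fun_on_const
      intro!: exI[of _ "replicate _ (\<lambda>_. 0)"])

lemma subspace_S: "subspace S"
  using S_fscale[OF Fn_const] by (auto simp: subspace_def S_zero S_add const_fscale)

lemma subspace_fibre_K: "subspace (K x)"
  using K by (simp add: bundle_of_ideals_def vector_subbundle_def)

lemma KS_S: "s \<in> KS \<Longrightarrow> s \<in> S"
  by (simp add: sub_sections_def)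

lemma KS_fscale: "f \<in> Fn \<Longrightarrow> s \<in> KS \<Longrightarrow> f \<odot> s \<in> KS"
  by (simp add: sub_sections_def S_fscale) (simp add: fscale_def subspace_scale[OF subspace_fibre_K])

lemma subspace_KS: "subspace KS"
  using KS_fscale[OF Fn_const] subspace_0[OF subspace_fibre_K] subspace_add[OF subspace_fibre_K]
  by (auto simp: subspace_def sub_sections_def S_zero S_add const_fscale)

lemma T_iff: "X \<in> T \<longleftrightarrow>
   (\<forall>f\<in>Fn. \<forall>g\<in>Fn. \<forall>a b. X (\<lambda>y. a * f y + b * g y) = (\<lambda>x. a * X f x + b * X g x) \<and>
      X (\<lambda>y. f y * g y) = (\<lambda>x. f x * X g x + g x * X f x)) \<and>
   (\<forall>f. f \<notin> Fn \<longrightarrow> X f = 0) \<and> (\<forall>f\<in>Fn. X f \<in> Fn)"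
  unfolding vector_fields_def tangent_space_def by (auto simp: fun_eq_iff)

lemma T_D:
  assumes "X \<in> T"
  shows T_lin: "f \<in> Fn \<Longrightarrow> g \<in> Fn \<Longrightarrow> X (\<lambda>y. a * f y + b * g y) = (\<lambda>x. a * X f x + b * X g x)"
    and T_mult: "f \<in> Fn \<Longrightarrow> g \<in> Fn \<Longrightarrow> X (\<lambda>y. f y * g y) = (\<lambda>x. f x * X g x + g x * X f x)"
    and T_out: "f \<notin> Fn \<Longrightarrow> X f = 0"
    and T_Fn: "f \<in> Fn \<Longrightarrow> X f \<in> Fn"
  using assms unfolding T_iff by blast+

lemma T_zero_fun: "X \<in> T \<Longrightarrow> X 0 = 0"
  using T_lin[of X "\<lambda>_. 0" "\<lambda>_. 0" 0 0] Fn_const[of 0] by (simp add: zero_fun_def)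

lemma T_zero_lambda: "X \<in> T \<Longrightarrow> X (\<lambda>_. 0) = (\<lambda>_. 0)"
  using T_zero_fun[of X] by (simp add: zero_fun_def)

lemma T_diff: "X \<in> T \<Longrightarrow> f \<in> Fn \<Longrightarrow> g \<in> Fn \<Longrightarrow> X (f - g) = X f - X g"
  using T_lin[of X f g 1 "-1"] by (simp add: fun_diff_def)

lemma Fn_diff: "f \<in> Fn \<Longrightarrow> g \<in> Fn \<Longrightarrow> f - g \<in> Fn"
  using Fn_lin[of f g 1 "-1"] by (simp add: fun_diff_def)

lemma T_add: "X \<in> T \<Longrightarrow> Y \<in> T \<Longrightarrow> X + Y \<in> T"
  unfolding T_iff[of "X + Y"]
  by (intro conjI ballI allI impI)
    (simp_all add: T_lin T_mult T_out T_Fn Fn_add plus_fun_def zero_fun_def algebra_simps)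

lemma T_vscale: "f \<in> Fn \<Longrightarrow> X \<in> T \<Longrightarrow> vscale f X \<in> T"
  unfolding T_iff[of "vscale f X"]
  by (intro conjI ballI allI impI)
    (simp_all add: vscale_def T_lin T_mult T_out T_Fn Fn_mult times_fun_def zero_fun_def algebra_simps)

lemma T_zero: "0 \<in> T"
  unfolding T_iff by (simp add: zero_fun_def Fn_const)

lemma subspace_T: "subspace T"
  using T_vscale[OF Fn_const] by (auto simp: subspace_def T_zero T_add const_vscale)

lemma T_vbracket:
  assumes X: "X \<in> T" and Y: "Y \<in> T" shows "vbracket X Y \<in> T"
proof -
  have lin: "Z (\<lambda>x. a * W f x + b * W g x) = (\<lambda>x. a * Z (W f) x + b * Z (W g) x)"
    if "Z \<in> T" "W \<in> T" "f \<in> Fn" "g \<in> Fn" for Z W f g a b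
    using T_lin[OF that(1) T_Fn[OF that(2,3)] T_Fn[OF that(2,4)]] by simp
  have mult: "Z (\<lambda>x. f x * W g x + g x * W f x) =
      (\<lambda>x. f x * Z (W g) x + W g x * Z f x + (g x * Z (W f) x + W f x * Z g x))"
    if "Z \<in> T" "W \<in> T" "f \<in> Fn" "g \<in> Fn" for Z W f g
    using T_lin[OF that(1) Fn_mult[OF that(3) T_Fn[OF that(2,4)]] Fn_mult[OF that(4) T_Fn[OF that(2,3)]], of 1 1]
    by (simp add: T_mult[OF that(1) that(3) T_Fn[OF that(2,4)]] T_mult[OF that(1) that(4) T_Fn[OF that(2,3)]])
  show ?thesis
    unfolding T_iff[of "vbracket X Y"] unfolding vbracket_def
    using X Y by (intro conjI ballI allI impI)
      (simp_all add: T_lin T_mult T_out T_Fn T_zero_fun lin mult Fn_diff fun_diff_def zero_fun_def algebra_simps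
        del: fun_diff_def, simp_all add: fun_eq_iff T_zero_fun T_zero_lambda Fn_diff T_Fn T_out algebra_simps)
qed

lemma vbracket_anti: "vbracket X Y = - vbracket Y X"
  by (simp add: vbracket_def fun_eq_iff)

text \<open>A vector field is known to be linear on smooth functions only. On other functions all
  vector fields are 0 by convention, and so are both sides; the Jacobi identity below needs the same
  distinction.\<close>

lemma linear_on_T: "Z \<in> T \<Longrightarrow> X \<in> T \<Longrightarrow> Y \<in> T \<Longrightarrow>
   vbracket Z (a *\<^sub>R X + Y) = a *\<^sub>R vbracket Z X + vbracket Z Y"
proof
  fix f assume Z: "Z \<in> T" "X \<in> T" "Y \<in> T"
  show "vbracket Z (a *\<^sub>R X + Y) f = (a *\<^sub>R vbracket Z X + vbracket Z Y) f"
  proof (cases "f \<in> Fn")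
    case True
    have "Z (a *\<^sub>R X f + Y f) = a *\<^sub>R Z (X f) + Z (Y f)"
      using T_lin[OF Z(1) T_Fn[OF Z(2) True] T_Fn[OF Z(3) True], of a 1]
      by (simp add: plus_fun_def scaleR_fun_def)
    then show ?thesis by (simp add: vbracket_def algebra_simps)
  next
    case False
    note 0 = T_out[OF Z(1) False] T_out[OF Z(2) False] T_out[OF Z(3) False]
      T_zero_fun[OF Z(1)] T_zero_fun[OF Z(2)] T_zero_fun[OF Z(3)]
    show ?thesis
      by (simp only: vbracket_def plus_fun_apply scaleR_fun_apply 0 scaleR_zero_right add_0_right diff_self)
  qed
qed

lemma vbracket_jacobi:
  assumes "X \<in> T" "Y \<in> T" "Z \<in> T"
  shows "vbracket X (vbracket Y Z) + vbracket Y (vbracket Z X) + vbracket Z (vbracket X Y) = 0"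
proof
  fix f
  show "(vbracket X (vbracket Y Z) + vbracket Y (vbracket Z X) + vbracket Z (vbracket X Y)) f = 0 f"
  proof (cases "f \<in> Fn")
    case True
    have "(a - b) - (c - d) + ((c - e) - (h - b)) + ((h - d) - (a - e)) = 0" for a b c d e h :: "'m \<Rightarrow> real"
      by (simp add: fun_eq_iff)
    then show ?thesis
      by (simp only: vbracket_def plus_fun_apply zero_fun_apply T_diff T_Fn assms True)
  next
    case False
    note 0 = T_out[OF assms(1) False] T_out[OF assms(2) False] T_out[OF assms(3) False]
      T_zero_fun[OF assms(1)] T_zero_fun[OF assms(2)] T_zero_fun[OF assms(3)]
    show ?thesis
      by (simp only: vbracket_def plus_fun_apply zero_fun_apply 0 add_0_right diff_self)
  qed
qed

end

section \<open>Weil cochains as cochains on ambient vector spaces\<close>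

lemma dsum_map: "dsum e F (map Q Xs) = dsum e (\<lambda>X Ys. F (Q X) (map Q Ys)) Xs"
  by (induction Xs arbitrary: F) simp_all

lemma df_wedge_dsum: "df_wedge f eta Xs = dsum (-1) (\<lambda>X Ys. X f \<odot> eta Ys) Xs"
  unfolding df_wedge_def rscale_eq_scaleR
  by (rule sum_nths_dsum[of "-1" "\<lambda>X Ys. X f \<odot> eta Ys"])

text \<open>The lengths of the three lists determine \<open>k\<close>, \<open>p\<close> and
  \<open>q\<close>, and truncated subtraction disappears. This is what allows cochains to be handled
  without recording their bidegree.\<close>

lemma args_iff: "args L p q k as bs Xs \<longleftrightarrow> k = length bs \<and> length as + length bs = p \<and>
   length bs + length Xs = q \<and> set as \<subseteq> sections L \<and> set bs \<subseteq> sections L \<and> set Xs \<subseteq> vector_fields (charts L)"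
proof -
  have "(k \<le> p \<and> k \<le> q \<and> la = p - k \<and> lb = k \<and> lX = q - k) \<longleftrightarrow>
      k = lb \<and> la + lb = p \<and> lb + lX = q" for la lb lX :: nat
    by (cases "k = lb") auto
  from this[of "length as" "length bs" "length Xs"] show ?thesis
    unfolding args_def tuples_def mem_Collect_eq by blast
qed

context im_setting
begin

lemma weil_D:
  assumes c: "c \<in> weil L K p q"
  shows weil_form: "args L p q k as bs Xs \<Longrightarrow> c k as \<in> forms L K (q - k) k"
    and weil_out: "\<not> args L p q k as bs Xs \<Longrightarrow> c k as bs Xs = 0"
    and weil_alpha: "k \<le> p \<Longrightarrow> multilinear UNIV (\<cdot>) (\<cdot>) (p - k) S (\<lambda>as. c k as bs Xs)"
    and weil_alternating: "k \<le> p \<Longrightarrow> alternating (p - k) S (\<lambda>as. c k as bs Xs)"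
    and weil_leibniz: "args L p q k (a # as) bs Xs \<Longrightarrow> f \<in> Fn \<Longrightarrow>
      c k (f \<odot> a # as) bs Xs = f \<odot> c k (a # as) bs Xs + df_wedge f (c (Suc k) as (a # bs)) Xs"
proof -
  note W = c[unfolded weil_def mem_Collect_eq]
  have 1: "if k \<le> p \<and> k \<le> q \<and> as \<in> tuples (p - k) S then c k as \<in> forms L K (q - k) k else c k as = 0" for k as
    by (rule conjunct1[OF W, THEN spec, THEN spec])
  show "args L p q k as bs Xs \<Longrightarrow> c k as \<in> forms L K (q - k) k"
    using 1[of k as] unfolding args_def by simp
  show "c k as bs Xs = 0" if n: "\<not> args L p q k as bs Xs"
  proof (cases "k \<le> p \<and> k \<le> q \<and> as \<in> tuples (p - k) S")
    case True
    with 1[of k as] have "c k as \<in> forms L K (q - k) k" by simp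
    from conjunct1[OF this[unfolded forms_def mem_Collect_eq], THEN spec, THEN spec]
    have "if bs \<in> tuples k S \<and> Xs \<in> tuples (q - k) T then c k as bs Xs \<in> KS else c k as bs Xs = 0" .
    moreover have "\<not> (bs \<in> tuples k S \<and> Xs \<in> tuples (q - k) T)" using n True unfolding args_def by blast
    ultimately show ?thesis by simp
  next
    case False
    then have "c k as = 0" using 1[of k as] by (simp only: if_False)
    then show ?thesis by simp
  qed
  show "k \<le> p \<Longrightarrow> multilinear UNIV (\<cdot>) (\<cdot>) (p - k) S (\<lambda>as. c k as bs Xs)"
    "k \<le> p \<Longrightarrow> alternating (p - k) S (\<lambda>as. c k as bs Xs)"
    using conjunct1[OF conjunct2[OF W]] by blast+
  have 2: "\<forall>k<p. \<forall>f\<in>Fn. \<forall>\<alpha>\<in>S. \<forall>\<alpha>s\<in>tuples (p - k - 1) S. \<forall>\<beta>s\<in>tuples k S. \<forall>Xs\<in>tuples (q - k) T.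
          c k (f \<odot> \<alpha> # \<alpha>s) \<beta>s Xs = f \<odot> c k (\<alpha> # \<alpha>s) \<beta>s Xs + df_wedge f (c (Suc k) \<alpha>s (\<alpha> # \<beta>s)) Xs"
    by (rule conjunct2[OF conjunct2[OF W]])
  show "args L p q k (a # as) bs Xs \<Longrightarrow> f \<in> Fn \<Longrightarrow>
      c k (f \<odot> a # as) bs Xs = f \<odot> c k (a # as) bs Xs + df_wedge f (c (Suc k) as (a # bs)) Xs"
    using 2[THEN spec[of _ k], THEN mp, THEN bspec[of _ _ f], THEN bspec[of _ _ a], THEN bspec[of _ _ as],
      THEN bspec[of _ _ bs], THEN bspec[of _ _ Xs]]
    by (auto simp: args_def tuples_def)
qed

lemma forms_D:
  assumes g: "g \<in> forms L K m n"
  shows forms_KS: "bs \<in> tuples n S \<Longrightarrow> Xs \<in> tuples m T \<Longrightarrow> g bs Xs \<in> KS"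
    and forms_beta: "Xs \<in> tuples m T \<Longrightarrow> multilinear Fn (\<odot>) (\<odot>) n S (\<lambda>bs. g bs Xs)"
    and forms_sym: "Xs \<in> tuples m T \<Longrightarrow> symmetric n S (\<lambda>bs. g bs Xs)"
    and forms_X: "bs \<in> tuples n S \<Longrightarrow> multilinear Fn vscale (\<odot>) m T (g bs)"
    and forms_alt: "bs \<in> tuples n S \<Longrightarrow> alternating m T (g bs)"
proof -
  note W = g[unfolded forms_def mem_Collect_eq]
  show "bs \<in> tuples n S \<Longrightarrow> Xs \<in> tuples m T \<Longrightarrow> g bs Xs \<in> KS"
    using conjunct1[OF W, THEN spec, THEN spec, of bs Xs] by simp
  show "Xs \<in> tuples m T \<Longrightarrow> multilinear Fn (\<odot>) (\<odot>) n S (\<lambda>bs. g bs Xs)"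
    "Xs \<in> tuples m T \<Longrightarrow> symmetric n S (\<lambda>bs. g bs Xs)"
    using conjunct1[OF conjunct2[OF W]] by blast+
  show "bs \<in> tuples n S \<Longrightarrow> multilinear Fn vscale (\<odot>) m T (g bs)"
    "bs \<in> tuples n S \<Longrightarrow> alternating m T (g bs)"
    using conjunct2[OF conjunct2[OF W]] by blast+
qed

definition P where "P = (SOME P. linear P \<and> (\<forall>x. P x \<in> S) \<and> (\<forall>x\<in>S. P x = x))"
definition Q where "Q = (SOME P. linear P \<and> (\<forall>x. P x \<in> T) \<and> (\<forall>x\<in>T. P x = x))"

lemma P: shows linear_P: "linear P" and P_S: "P x \<in> S" and P_id: "s \<in> S \<Longrightarrow> P s = s"
proof -
  have "\<exists>P. linear P \<and> (\<forall>x. P x \<in> S) \<and> (\<forall>x\<in>S. P x = x)"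
    by (rule linear_projection_onto[OF subspace_S]) blast
  from someI_ex[OF this] show "linear P" "P x \<in> S" "s \<in> S \<Longrightarrow> P s = s" unfolding P_def by blast+
qed

lemma Q: shows linear_Q: "linear Q" and Q_T: "Q X \<in> T" and Q_id: "Y \<in> T \<Longrightarrow> Q Y = Y"
proof -
  have "\<exists>P. linear P \<and> (\<forall>x. P x \<in> T) \<and> (\<forall>x\<in>T. P x = x)"
    by (rule linear_projection_onto[OF subspace_T]) blast
  from someI_ex[OF this] show "linear Q" "Q X \<in> T" "Y \<in> T \<Longrightarrow> Q Y = Y" unfolding Q_def by blast+
qed

definition tot :: "('m, 'a) cochain \<Rightarrow> (('m, 'a) sect, 'm vfield) tcochain" where
  "tot c as bs Xs = c (length bs) (map P as) (map P bs) (map Q Xs)"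

definition sA :: "('m \<Rightarrow> real) \<Rightarrow> ('m, 'a) sect \<Rightarrow> ('m, 'a) sect" where "sA f a = f \<odot> P a"
definition sX :: "('m \<Rightarrow> real) \<Rightarrow> 'm vfield \<Rightarrow> 'm vfield" where "sX f X = vscale f (Q X)"
definition ap :: "'m vfield \<Rightarrow> ('m \<Rightarrow> real) \<Rightarrow> ('m \<Rightarrow> real)" where "ap X f = Q X f"

lemma sA_zero: "sA f 0 = 0"
  by (simp add: sA_def linear_0[OF linear_P] linear_0[OF linear_fscale])

lemma P_sA: "f \<in> Fn \<Longrightarrow> P (sA f a) = f \<odot> P a"
  by (simp add: sA_def P_id S_fscale P_S)

lemma Q_sX: "f \<in> Fn \<Longrightarrow> Q (sX f X) = vscale f (Q X)"
  by (simp add: sX_def Q_id T_vscale Q_T)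

lemma map_P_tuples: "map P as \<in> tuples n S \<longleftrightarrow> length as = n"
  using P_S by (auto simp: tuples_def)

lemma map_Q_tuples: "map Q Xs \<in> tuples n T \<longleftrightarrow> length Xs = n"
  using Q_T by (auto simp: tuples_def)

lemma args_map: "args L p q k (map P as) (map P bs) (map Q Xs) \<longleftrightarrow>
    k = length bs \<and> length as + length bs = p \<and> length bs + length Xs = q"
  using P_S Q_T by (auto simp: args_iff)

context
  fixes c p q
  assumes c: "c \<in> weil L K p q"
begin

lemma tot_out: "\<not> (length as + length bs = p \<and> length bs + length Xs = q) \<Longrightarrow> tot c as bs Xs = 0"
  unfolding tot_def by (rule weil_out[OF c]) (simp add: args_map)

lemma tot_form:
  fixes as bs :: "('m, 'a) sect list"
  assumes "length as + length bs = p" "length bs \<le> q"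
  shows "c (length bs) (map P as) \<in> forms L K (q - length bs) (length bs)"
proof -
  have "args L p q (length bs) (map P as) (map P bs) (map Q (replicate (q - length bs) 0))"
    unfolding args_map using assms by simp
  then show ?thesis by (rule weil_form[OF c])
qed

lemma tot_KS: "tot c as bs Xs \<in> KS"
proof (cases "length as + length bs = p \<and> length bs + length Xs = q")
  case True
  then show ?thesis
    unfolding tot_def by (intro forms_KS[OF tot_form]) (auto simp: map_P_tuples map_Q_tuples)
qed (simp add: tot_out subspace_0[OF subspace_KS])

lemma tot_alpha: "esym (-1) (\<lambda>as. tot c as bs Xs)"
proof (cases "length bs \<le> p")
  case True
  show ?thesis
    unfolding tot_def
  proof (rule esym_alternating_proj(2)[OF linear_P P_S subspace_S])
    show "c (length bs) (xs[i := r *\<^sub>R y + z]) (map P bs) (map Q Xs) =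
      r *\<^sub>R c (length bs) (xs[i := y]) (map P bs) (map Q Xs) + c (length bs) (xs[i := z]) (map P bs) (map Q Xs)"
      if "xs \<in> tuples (p - length bs) S" "i < p - length bs" "y \<in> S" "z \<in> S" for xs i r y z
      using weil_alpha[OF c True] that unfolding multilinear_def rscale_eq_scaleR by blast
    show "alternating (p - length bs) S (\<lambda>as. c (length bs) as (map P bs) (map Q Xs))"
      by (rule weil_alternating[OF c True])
  qed (rule weil_out[OF c], auto simp: args_iff)
next
  case False
  then show ?thesis by (simp add: tot_out esym_zero)
qed

lemma tot_beta: "esym 1 (\<lambda>bs. tot c as bs Xs)"
proof (cases "length as \<le> p \<and> p - length as + length Xs = q")
  case True
  let ?k = "p - length as"
  have f: "c ?k (map P as) \<in> forms L K (q - ?k) ?k"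
    \<comment> \<open>\<open>tot_form\<close> depends on its second list only through the length, so
      any list of length \<open>?k\<close> will do.\<close>
    using tot_form[of as "replicate ?k undefined"] True by simp
  have X: "map Q Xs \<in> tuples (q - ?k) T" using True by (auto simp: map_Q_tuples)
  have eq: "tot c as bs Xs = c ?k (map P as) (map P bs) (map Q Xs)" for bs
  proof (cases "length bs = ?k")
    case False
    then have "c ?k (map P as) (map P bs) (map Q Xs) = 0"
      by (intro weil_out[OF c]) (auto simp: args_iff)
    moreover have "tot c as bs Xs = 0" using False by (intro tot_out) auto
    ultimately show ?thesis by simp
  qed (simp add: tot_def)
  show ?thesis
    unfolding eq
  proof (rule esym_alternating_proj(3)[OF linear_P P_S subspace_S])
    show "c ?k (map P as) (xs[i := r *\<^sub>R y + z]) (map Q Xs) =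
      r *\<^sub>R c ?k (map P as) (xs[i := y]) (map Q Xs) + c ?k (map P as) (xs[i := z]) (map Q Xs)"
      if "xs \<in> tuples ?k S" "i < ?k" "y \<in> S" "z \<in> S" for xs i r y z
      using forms_beta[OF f X, unfolded multilinear_def, rule_format, OF that(1,2) Fn_const that(3,4), of r]
      unfolding const_fscale .
    show "symmetric ?k S (\<lambda>bs. c ?k (map P as) bs (map Q Xs))" by (rule forms_sym[OF f X])
  qed (rule weil_out[OF c], auto simp: args_iff)
next
  case False
  have "tot c as bs Xs = 0" for bs using False by (intro tot_out) auto
  then show ?thesis by (simp add: esym_zero)
qed

lemma tot_X: "esym (-1) (tot c as bs)"
proof (cases "length as + length bs = p \<and> length bs \<le> q")
  case True
  let ?k = "length bs"
  have f: "c ?k (map P as) \<in> forms L K (q - ?k) ?k" by (rule tot_form) (use True in auto)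
  have b: "map P bs \<in> tuples ?k S" by (simp add: map_P_tuples)
  show ?thesis
    unfolding tot_def
  proof (rule esym_alternating_proj(2)[OF linear_Q Q_T subspace_T])
    show "c ?k (map P as) (map P bs) (xs[i := r *\<^sub>R y + z]) =
      r *\<^sub>R c ?k (map P as) (map P bs) (xs[i := y]) + c ?k (map P as) (map P bs) (xs[i := z])"
      if "xs \<in> tuples (q - ?k) T" "i < q - ?k" "y \<in> T" "z \<in> T" for xs i r y z
      using forms_X[OF f b, unfolded multilinear_def, rule_format, OF that(1,2) Fn_const that(3,4), of r]
      unfolding const_fscale const_vscale .
    show "alternating (q - ?k) T (c ?k (map P as) (map P bs))" by (rule forms_alt[OF f b])
  qed (rule weil_out[OF c], use True in \<open>auto simp: args_iff\<close>)
next
  case False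
  have "tot c as bs = (\<lambda>_. 0)" using False by (intro ext tot_out) auto
  then show ?thesis by (simp add: esym_zero)
qed

lemma sA_tot: "sA f (tot c as bs Xs) = f \<odot> tot c as bs Xs"
  by (simp add: sA_def P_id[OF KS_S[OF tot_KS]])

lemma tot_sA_alpha:
  assumes f: "f \<in> Fn"
  shows "tot c (sA f a # as) bs Xs = sA f (tot c (a # as) bs Xs) + dsum (-1) (\<lambda>X Ys. sA (ap X f) (tot c as (a # bs) Ys)) Xs"
proof (cases "length (a # as) + length bs = p \<and> length bs + length Xs = q")
  case True
  then have "args L p q (length bs) (P a # map P as) (map P bs) (map Q Xs)"
    using args_map[of p q _ "a # as"] by simp
  from weil_leibniz[OF c this f] show ?thesis
    unfolding sA_tot unfolding tot_def by (simp add: P_sA[OF f] df_wedge_dsum dsum_map ap_def)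
next
  case False
  have "dsum (-1) (\<lambda>X Ys. sA (ap X f) (tot c as (a # bs) Ys)) Xs = dsum (-1) (\<lambda>_ _. 0) Xs"
  proof (rule dsum_cong)
    fix X Ys assume "set Ys \<subseteq> set Xs" "length Xs = Suc (length Ys)"
    then have "tot c as (a # bs) Ys = 0" using False by (intro tot_out) simp
    then show "sA (ap X f) (tot c as (a # bs) Ys) = 0"
      by (simp add: sA_zero)
  qed
  then show ?thesis
    using False by (simp add: tot_out sA_zero)
qed

lemma tot_sA_beta:
  assumes f: "f \<in> Fn"
  shows "tot c as (sA f b # bs) Xs = sA f (tot c as (b # bs) Xs)"
proof (cases "length as + length (b # bs) = p \<and> length (b # bs) + length Xs = q")
  case True
  let ?k = "length (b # bs)"
  have fm: "c ?k (map P as) \<in> forms L K (q - ?k) ?k" by (rule tot_form) (use True in auto)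
  have X: "map Q Xs \<in> tuples (q - ?k) T" using True by (auto simp: map_Q_tuples)
  have t: "P b # map P bs \<in> tuples ?k S" using map_P_tuples[of "b # bs"] by simp
  have l: "c ?k (map P as) ((f \<odot> P b + z) # map P bs) (map Q Xs) =
      f \<odot> c ?k (map P as) (P b # map P bs) (map Q Xs) + c ?k (map P as) (z # map P bs) (map Q Xs)"
    if "f \<in> Fn" "z \<in> S" for f z
    using forms_beta[OF fm X, unfolded multilinear_def, rule_format, OF t, of 0 f "P b" z] that P_S by simp
  \<comment> \<open>\<open>multilinear\<close> joins scaling and addition in one equation; the
    summand 0 isolates the scaling.\<close>
  have "c ?k (map P as) (0 # map P bs) (map Q Xs) = 0"
  proof -
    have "linear (\<lambda>x. tot c as (x # bs) Xs)" by (rule esym_linear[OF tot_beta])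
    from linear_0[OF this] show ?thesis by (simp add: tot_def linear_0[OF linear_P])
  qed
  with l[OF f S_zero] show ?thesis unfolding sA_tot unfolding tot_def by (simp add: P_sA[OF f])
next
  case False
  then show ?thesis by (simp add: tot_out sA_zero)
qed

lemma tot_sX:
  assumes f: "f \<in> Fn"
  shows "tot c as bs (sX f X # Xs) = sA f (tot c as bs (X # Xs))"
proof (cases "length as + length bs = p \<and> length bs + length (X # Xs) = q")
  case True
  let ?k = "length bs"
  have fm: "c ?k (map P as) \<in> forms L K (q - ?k) ?k" by (rule tot_form) (use True in auto)
  have b: "map P bs \<in> tuples ?k S" by (simp add: map_P_tuples)
  have qk: "q - ?k = Suc (length Xs)" using True by auto
  have t: "Q X # map Q Xs \<in> tuples (q - ?k) T" using map_Q_tuples[of "X # Xs" "q - ?k"] qk by simp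
  have l: "c ?k (map P as) (map P bs) ((vscale f (Q X) + Z) # map Q Xs) =
      f \<odot> c ?k (map P as) (map P bs) (Q X # map Q Xs) + c ?k (map P as) (map P bs) (Z # map Q Xs)"
    if "f \<in> Fn" "Z \<in> T" for f Z
    using forms_X[OF fm b, unfolded multilinear_def, rule_format, OF t, of 0 f "Q X" Z] that Q_T qk by simp
  have "c ?k (map P as) (map P bs) (0 # map Q Xs) = 0"
  proof -
    have "linear (\<lambda>x. tot c as bs (x # Xs))" by (rule esym_linear[OF tot_X])
    from linear_0[OF this] show ?thesis by (simp add: tot_def linear_0[OF linear_Q])
  qed
  with l[OF f T_zero] show ?thesis unfolding sA_tot unfolding tot_def by (simp add: Q_sX[OF f])
next
  case False
  then show ?thesis by (simp add: tot_out sA_zero)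
qed

end

section \<open>The IM connection as algebraic data\<close>

lemma omega_weil: "\<omega> \<in> weil L K 1 1" and omega_closed: "delta L 1 1 \<omega> = 0" and omega_id: "\<xi> \<in> KS \<Longrightarrow> conn_v \<omega> \<xi> = \<xi>"
  using omega by (auto simp: IM_connections_def IM_forms_def)

definition tbr where "tbr a b = lie L (P a) (P b)"
definition tvbr where "tvbr X Y = vbracket (Q X) (Q Y)"
definition trh where "trh a = rho L (P a)"
definition tC where "tC a X = conn_C \<omega> (P a) (Q X)"
definition tv where "tv a = conn_v \<omega> (P a)"

lemma tC_tot: "tC a X = tot \<omega> [a] [] [X]"
  by (simp add: tC_def conn_C_def tot_def)

lemma tv_tot: "tv a = tot \<omega> [] [a] []"
  by (simp add: tv_def conn_v_def tot_def)

lemma lie_S: "a \<in> S \<Longrightarrow> b \<in> S \<Longrightarrow> lie L a b \<in> S"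
  using L unfolding lie_algebroid_def by blast

lemma lie_anti: "a \<in> S \<Longrightarrow> b \<in> S \<Longrightarrow> lie L a b = - lie L b a"
  using L unfolding lie_algebroid_def by blast

lemma lie_lin: "a \<in> S \<Longrightarrow> b \<in> S \<Longrightarrow> c \<in> S \<Longrightarrow> lie L (r *\<^sub>R a + t *\<^sub>R b) c = r *\<^sub>R lie L a c + t *\<^sub>R lie L b c"
  using L unfolding lie_algebroid_def rscale_eq_scaleR by blast

lemma rho_T: "a \<in> S \<Longrightarrow> rho L a \<in> T"
  using L unfolding lie_algebroid_def by blast

lemma S_fibre: "a \<in> S \<Longrightarrow> a x \<in> fibre L x"
  by (simp add: sections_def section_on_def)

lemma rho_lin: "a \<in> S \<Longrightarrow> b \<in> S \<Longrightarrow> rho L (r *\<^sub>R a + t *\<^sub>R b) = r *\<^sub>R rho L a + t *\<^sub>R rho L b"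
proof (intro ext)
  fix f x assume ab: "a \<in> S" "b \<in> S"
  have "\<forall>x f. \<forall>u\<in>fibre L x. \<forall>w\<in>fibre L x. \<forall>a b.
        anchor L x (a *\<^sub>R u + b *\<^sub>R w) f = a * anchor L x u f + b * anchor L x w f"
    using L unfolding lie_algebroid_def by (elim conjE)
  then show "rho L (r *\<^sub>R a + t *\<^sub>R b) f x = (r *\<^sub>R rho L a + t *\<^sub>R rho L b) f x"
    using S_fibre[OF ab(1)] S_fibre[OF ab(2)] by (simp add: rho_def)
qed

lemma rho_KS: "\<xi> \<in> KS \<Longrightarrow> rho L \<xi> = 0"
  using K by (auto simp: bundle_of_ideals_def sub_sections_def rho_def fun_eq_iff)

lemma lie_KS: "a \<in> S \<Longrightarrow> \<xi> \<in> KS \<Longrightarrow> lie L a \<xi> \<in> KS"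
  using K unfolding bundle_of_ideals_def by blast

text \<open>The component k = 0 of the closedness of \<open>\<omega>\<close>, at two sections and
  one vector field; it becomes \<open>im0\<close>.\<close>

lemma omega_C: "a \<in> S \<Longrightarrow> b \<in> S \<Longrightarrow> X \<in> T \<Longrightarrow>
   lie L a (conn_C \<omega> b X) - conn_C \<omega> b (vbracket (rho L a) X)
   - (lie L b (conn_C \<omega> a X) - conn_C \<omega> a (vbracket (rho L b) X)) = conn_C \<omega> (lie L a b) X"
proof -
  assume ab: "a \<in> S" "b \<in> S" "X \<in> T"
  then have A: "args L (1 + 1) 1 0 [a, b] [] [X]" by (simp add: args_iff)
  have "delta L 1 1 \<omega> 0 [a, b] [] [X] = 0" unfolding omega_closed by simp
  from this[unfolded delta_def if_P[OF A]] show ?thesis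
    by (simp add: lie_deriv_def conn_C_def nths_Cons rscale_eq_scaleR eval_nat_numeral algebra_simps)
qed

text \<open>The component k = 1, whose right side is the contraction with the anchor in
  \<open>delta\<close>; it becomes \<open>im1\<close>.\<close>

lemma omega_v: "a \<in> S \<Longrightarrow> b \<in> S \<Longrightarrow>
   lie L a (conn_v \<omega> b) - conn_v \<omega> (lie L a b) = conn_C \<omega> a (rho L b)"
proof -
  assume ab: "a \<in> S" "b \<in> S"
  then have A: "args L (1 + 1) 1 1 [a] [b] []" by (simp add: args_iff)
  have "delta L 1 1 \<omega> 1 [a] [b] [] = 0" unfolding omega_closed by simp
  from this[unfolded delta_def if_P[OF A]] show ?thesis
    by (simp add: lie_deriv_def conn_C_def conn_v_def nths_Cons rscale_eq_scaleR algebra_simps)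
qed

lemma fscale_diff_left: "(f - g) \<odot> a = f \<odot> a - g \<odot> a"
  by (simp add: fscale_def fun_eq_iff scaleR_diff_left)

sublocale im_module tbr tvbr trh KS tC tv Fn sA sX ap
proof (intro im_module.intro im_algebra.intro im_module_axioms.intro)
  have lin_lie: "linear (\<lambda>x. lie L (P x) c)" if "c \<in> S" for c
    using lie_lin[OF P_S P_S that, of 1 _ 1] lie_lin[OF P_S P_S that, of _ _ 0]
    by (simp add: linear_iff linear_add[OF linear_P] linear_scale[OF linear_P])
  show "linear (tbr a)" for a
    unfolding tbr_def lie_anti[OF P_S P_S, of a] by (intro linear_compose_neg lin_lie P_S)
  show "tbr a b = - tbr b a" for a b
    unfolding tbr_def by (rule lie_anti[OF P_S P_S])
  show "linear (tvbr X)" for X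
    using linear_on_T[OF Q_T Q_T Q_T, of X 1] linear_on_T[OF Q_T Q_T T_zero, of X]
      linear_on_T[OF Q_T T_zero T_zero, of X 1]
    by (simp add: linear_iff tvbr_def linear_add[OF linear_Q] linear_scale[OF linear_Q])
  show "tvbr X Y = - tvbr Y X" for X Y
    unfolding tvbr_def by (rule vbracket_anti)
  show "tvbr X (tvbr Y Z) + tvbr Y (tvbr Z X) + tvbr Z (tvbr X Y) = 0" for X Y Z
    unfolding tvbr_def Q_id[OF T_vbracket[OF Q_T Q_T]] by (rule vbracket_jacobi[OF Q_T Q_T Q_T])
  show "linear trh"
    using rho_lin[OF P_S P_S, of 1 _ 1] rho_lin[OF P_S P_S, of _ _ 0]
    by (simp add: linear_iff trh_def linear_add[OF linear_P] linear_scale[OF linear_P])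
  show "subspace KS" by (rule subspace_KS)
  show "k \<in> KS \<Longrightarrow> tbr a k \<in> KS" for k a
    by (simp add: tbr_def P_id[OF KS_S] lie_KS P_S)
  show "k \<in> KS \<Longrightarrow> trh k = 0" for k
    by (simp add: trh_def P_id[OF KS_S] rho_KS)
  show "tC a X \<in> KS" for a X unfolding tC_tot by (rule tot_KS[OF omega_weil])
  show v: "tv a \<in> KS" for a unfolding tv_tot by (rule tot_KS[OF omega_weil])
  show "k \<in> KS \<Longrightarrow> tv k = k" for k
    by (simp add: tv_def P_id[OF KS_S] omega_id)
  show "linear tv" unfolding tv_tot by (rule esym_linear[OF tot_beta[OF omega_weil]])
  show "linear (\<lambda>a. tC a X)" for X unfolding tC_tot by (rule esym_linear[OF tot_alpha[OF omega_weil]])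
  show "linear (tC a)" for a unfolding tC_tot by (rule esym_linear[OF tot_X[OF omega_weil]])
  show "tbr a (tC b X) - tC b (tvbr (trh a) X) - (tbr b (tC a X) - tC a (tvbr (trh b) X)) = tC (tbr a b) X" for a b X
  proof -
    \<comment> \<open>Values of \<open>tC\<close> are genuine sections, so the projection
      \<open>P\<close> inside the outer \<open>tbr\<close> acts on them as the identity.\<close>
    have "tC a X \<in> S" for a X unfolding tC_tot by (rule KS_S[OF tot_KS[OF omega_weil]])
    then show ?thesis
      using omega_C[OF P_S P_S Q_T, of a b X]
      by (simp add: tbr_def P_id tvbr_def trh_def Q_id[OF rho_T[OF P_S]] tC_def Q_id[OF T_vbracket[OF rho_T[OF P_S] Q_T]]
        lie_S P_S)
  qed
  show "tbr a (tv b) - tv (tbr a b) = tC a (trh b)" for a b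
    using omega_v[OF P_S P_S, of a b] KS_S[OF v]
    by (simp add: tbr_def P_id tv_def trh_def tC_def Q_id[OF rho_T[OF P_S]] lie_S P_S)
  show "linear (sA f)" for f
    unfolding sA_def using linear_compose[OF linear_P linear_fscale] by (simp add: o_def)
  show "f \<in> Fn \<Longrightarrow> sA (ap (tvbr X Y) f) a = sA (ap X (ap Y f)) a - sA (ap Y (ap X f)) a" for f X Y a
    unfolding sA_def ap_def tvbr_def Q_id[OF T_vbracket[OF Q_T Q_T]]
    unfolding vbracket_def fscale_diff_left ..
  show "f \<in> Fn \<Longrightarrow> ap X f \<in> Fn" for f X
    by (simp add: ap_def T_Fn Q_T)
  show "f \<in> Fn \<Longrightarrow> tC (sA f a) X = sA f (tC a X) + sA (ap X f) (tv a)" for f a X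
    unfolding tC_tot tv_tot tot_sA_alpha[OF omega_weil] by simp
  show "f \<in> Fn \<Longrightarrow> tC a (sX f X) = sA f (tC a X)" for f a X
    unfolding tC_tot by (rule tot_sX[OF omega_weil])
  show "f \<in> Fn \<Longrightarrow> tv (sA f a) = sA f (tv a)" for f a
    unfolding tv_tot by (rule tot_sA_beta[OF omega_weil])
  show "tvbr (sX f X) Y = sX f (tvbr X Y) - sX (ap Y f) X" if f: "f \<in> Fn" for f X Y
  proof
    fix g
    have "vbracket (vscale f (Q X)) (Q Y) g = (vscale f (vbracket (Q X) (Q Y)) - vscale (Q Y f) (Q X)) g"
    proof (cases "g \<in> Fn")
      case True
      have "Q Y (f * Q X g) = f * Q Y (Q X g) + Q X g * Q Y f"
        using T_mult[OF Q_T f T_Fn[OF Q_T True], of Y X] by (simp add: times_fun_def plus_fun_def)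
      then show ?thesis
        by (simp add: vbracket_def vscale_def fun_eq_iff algebra_simps)
    next
      case False
      note 0 = T_out[OF Q_T False] T_zero_fun[OF Q_T]
      show ?thesis by (simp only: vbracket_def vscale_def minus_apply 0 mult_zero_right diff_self)
    qed
    then show "tvbr (sX f X) Y g = (sX f (tvbr X Y) - sX (ap Y f) X) g"
      using f by (simp add: tvbr_def Q_sX) (simp add: sX_def ap_def Q_id[OF T_vbracket[OF Q_T Q_T]])
  qed
qed

lemma coch_tot: "c \<in> weil L K p q \<Longrightarrow> coch (tot c)"
  by (intro cochI tot_alpha tot_beta tot_X tot_KS)

lemma flin_tot: "c \<in> weil L K p q \<Longrightarrow> flin (tot c)"
  by (rule flinI) (simp_all add: tot_sA_alpha tot_sA_beta tot_sX dw_def)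

end

section \<open>Return from ambient vector spaces to Weil cochains\<close>

lemma esym_alternating:
  assumes F: "esym (-1) F" and "\<not> distinct xs" shows "F xs = 0"
proof -
  obtain as bs cs x where xs: "xs = as @ [x] @ bs @ [x] @ cs"
    using not_distinct_decomp[OF assms(2)] by blast
  have z: "F (x # x # ys) = 0" for ys
    using eq_neg_imp_zero[OF esym_altD[OF F, of x x ys]] .
  have "F xs = (-1) ^ length as *\<^sub>R F (x # (as @ bs) @ x # cs)"
    using esym_front_sign[OF F, of as x "bs @ x # cs"] by (simp add: xs)
  also have "F (x # (as @ bs) @ x # cs) = (-1) ^ length (as @ bs) *\<^sub>R F (x # x # (as @ bs) @ cs)"
    by (rule esym_front_sign[OF esym_Cons[OF F]])
  finally show ?thesis by (simp add: z)
qed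

lemma esym_mset:
  assumes "esym 1 F" "mset xs = mset ys" shows "F xs = F ys"
  using assms
proof (induction xs arbitrary: F ys)
  case (Cons x xs)
  then have "x \<in> set ys" by (metis list.set_intros(1) mset_eq_setD)
  then obtain as bs where ys: "ys = as @ x # bs" by (auto dest: split_list)
  then have "mset xs = mset (as @ bs)" using Cons.prems(2) by simp
  then have "F (x # xs) = F (x # as @ bs)" by (rule Cons.IH[OF esym_Cons[OF Cons.prems(1)]])
  then show ?case using esym_front[OF Cons.prems(1), of as x bs] by (simp add: ys)
qed simp

text \<open>Every slot can be moved to the front by \<open>esym_front_sign\<close>, so homogeneity
  has to be checked in the head only.\<close>

lemma multilinear_esym:
  assumes F: "esym e F"
    and sc: "\<And>r y ys. r \<in> R \<Longrightarrow> y \<in> V \<Longrightarrow> set ys \<subseteq> V \<Longrightarrow> length ys + 1 = n \<Longrightarrow> F (sc r y # ys) = sc' r (F (y # ys))"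
    and sc': "\<And>r a y. sc' r (a *\<^sub>R y) = a *\<^sub>R sc' r y"
  shows "multilinear R sc sc' n V F"
  unfolding multilinear_def
proof (intro ballI allI impI)
  fix xs i r y z
  assume *: "xs \<in> tuples n V" "i < n" "r \<in> R" "y \<in> V" "z \<in> V"
  let ?u = "take i xs" and ?w = "drop (Suc i) xs"
  have u: "xs[i := x] = ?u @ x # ?w" for x
    using * by (simp add: upd_conv_take_nth_drop tuples_def)
  have s: "set (?u @ ?w) \<subseteq> V" "length (?u @ ?w) + 1 = n"
    using * set_take_subset[of i xs] set_drop_subset[of "Suc i" xs] by (auto simp: tuples_def)
  show "F (xs[i := sc r y + z]) = sc' r (F (xs[i := y])) + F (xs[i := z])"
    unfolding u esym_front_sign[OF F, of ?u] linear_add[OF esym_linear[OF F]]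
      sc[OF *(3,4) s] sc' by (simp add: scaleR_add_right)
qed

lemma list_update_subset: "set xs \<subseteq> V \<Longrightarrow> x \<in> V \<Longrightarrow> set (xs[i := x]) \<subseteq> V"
  using set_update_subset_insert[of xs i x] by blast

lemma tuples_update: "xs \<in> tuples n V \<Longrightarrow> x \<in> V \<Longrightarrow> xs[i := x] \<in> tuples n V"
  by (simp add: tuples_def list_update_subset)

lemma multilinear_cong:
  assumes "multilinear D sc sc' n V F" "\<And>xs. xs \<in> tuples n V \<Longrightarrow> F' xs = F xs"
    and "\<And>r y z. r \<in> D \<Longrightarrow> y \<in> V \<Longrightarrow> z \<in> V \<Longrightarrow> sc r y + z \<in> V"
  shows "multilinear D sc sc' n V F'"
  unfolding multilinear_def
proof (intro ballI allI impI)
  fix xs i r y z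
  assume *: "xs \<in> tuples n V" "i < n" "r \<in> D" "y \<in> V" "z \<in> V"
  have "F (xs[i := sc r y + z]) = sc' r (F (xs[i := y])) + F (xs[i := z])"
    using assms(1) * unfolding multilinear_def by blast
  then show "F' (xs[i := sc r y + z]) = sc' r (F' (xs[i := y])) + F' (xs[i := z])"
    using * by (simp add: assms(2,3) tuples_update)
qed

lemma length_nths_minus2: "i < j \<Longrightarrow> j < length xs \<Longrightarrow> length (nths xs (- {i, j})) = length xs - 2"
proof -
  assume "i < j" "j < length xs"
  moreover have "{k. k < length xs \<and> k \<in> - {i, j}} = {..<length xs} - {i, j}" by auto
  ultimately show ?thesis by (simp add: length_nths card_Diff_subset)
qed

lemma length_nths_minus1: "i < length xs \<Longrightarrow> length (nths xs (- {i})) = length xs - 1"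
  by (simp add: nths_minus_single)

context im_setting
begin

text \<open>The way back: on genuine sections and vector fields the projections \<open>P\<close> and
  \<open>Q\<close> are identities, so \<open>cut\<close> undoes \<open>tot\<close> on Weil cochains.
  The operators \<open>delta\<close>, \<open>d_nabla\<close> and \<open>hproj\<close> are then
  matched with their algebraic counterparts through \<open>cut\<close>.\<close>

definition cut :: "nat \<Rightarrow> nat \<Rightarrow> (('m, 'a) sect, 'm vfield) tcochain \<Rightarrow> ('m, 'a) cochain" where
  "cut p q E = (\<lambda>k as bs Xs. if args L p q k as bs Xs then E as bs Xs else 0)"

lemma cut_eq: "args L p q k as bs Xs \<Longrightarrow> cut p q E k as bs Xs = E as bs Xs"
  by (simp add: cut_def)

lemma cut_out: "\<not> args L p q k as bs Xs \<Longrightarrow> cut p q E k as bs Xs = 0"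
  by (simp add: cut_def)

lemma map_P_id: "set as \<subseteq> S \<Longrightarrow> map P as = as"
  by (rule map_idI) (auto intro: P_id)

lemma map_Q_id: "set as \<subseteq> T \<Longrightarrow> map Q as = as"
  by (rule map_idI) (auto intro: Q_id)

lemma cut_tot:
  assumes c: "c \<in> weil L K p q" shows "cut p q (tot c) = c"
proof (rule ext, rule ext, rule ext, rule ext)
  fix k as bs Xs
  show "cut p q (tot c) k as bs Xs = c k as bs Xs"
  proof (cases "args L p q k as bs Xs")
    case True
    then have "k = length bs" "set as \<subseteq> S" "set bs \<subseteq> S" "set Xs \<subseteq> T" by (auto simp: args_iff)
    then show ?thesis using True by (simp add: cut_eq tot_def map_P_id map_Q_id)
  qed (simp add: cut_out weil_out[OF c])
qed

lemma cut_cong: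
  "(\<And>as bs Xs. length as + length bs = p \<Longrightarrow> E as bs Xs = E' as bs Xs) \<Longrightarrow> cut p q E = cut p q E'"
  by (auto simp: cut_def fun_eq_iff args_iff)

lemma tbr_S: "a \<in> S \<Longrightarrow> b \<in> S \<Longrightarrow> tbr a b = lie L a b"
  by (simp add: tbr_def P_id)

lemma tvbr_T: "X \<in> T \<Longrightarrow> Y \<in> T \<Longrightarrow> tvbr X Y = vbracket X Y"
  by (simp add: tvbr_def Q_id)

lemma trh_S: "a \<in> S \<Longrightarrow> trh a = rho L a"
  by (simp add: trh_def P_id)

lemma tC_S: "a \<in> S \<Longrightarrow> X \<in> T \<Longrightarrow> tC a X = conn_C \<omega> a X"
  by (simp add: tC_def P_id Q_id)

lemma hor_S: "a \<in> S \<Longrightarrow> hor a = conn_h \<omega> a"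
  by (simp add: hor_def tv_def conn_h_def P_id)

lemma sA_S: "a \<in> S \<Longrightarrow> sA f a = f \<odot> a"
  by (simp add: sA_def P_id)

lemma lie_deriv_cut:
  assumes E: "coch E" and a: "a \<in> S" and A: "args L p q k as bs Xs"
  shows "lie_deriv L a (cut p q E k as) bs Xs = lied a E as bs Xs"
proof -
  have s: "set as \<subseteq> S" "set bs \<subseteq> S" "set Xs \<subseteq> T" and l: "k = length bs" "length as + length bs = p" "length bs + length Xs = q"
    using A by (auto simp: args_iff)
  have "cut p q E k as (bs[i := lie L a (bs ! i)]) Xs = E as (bs[i := tbr a (bs ! i)]) Xs" if "i < length bs" for i
  proof -
    have "bs ! i \<in> S" using s(2) that by auto
    then show ?thesis
      using a s l list_update_subset[OF s(2)] by (subst cut_eq) (simp_all add: args_iff lie_S tbr_S)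
  qed
  then have 1: "(\<Sum>i<length bs. cut p q E k as (bs[i := lie L a (bs ! i)]) Xs) = dsum 1 (\<lambda>b bs. E as (tbr a b # bs) Xs) bs"
    using sum_list_update_dsum[OF _ coch_beta[OF E], where xs = bs and g = "tbr a"] by simp
  have "cut p q E k as bs (Xs[i := vbracket (rho L a) (Xs ! i)]) = E as bs (Xs[i := tvbr (trh a) (Xs ! i)])" if "i < length Xs" for i
  proof -
    have "Xs ! i \<in> T" using s(3) that by auto
    then show ?thesis
      using a s l list_update_subset[OF s(3)] by (subst cut_eq) (simp_all add: args_iff T_vbracket rho_T tvbr_T trh_S)
  qed
  then have 2: "(\<Sum>i<length Xs. cut p q E k as bs (Xs[i := vbracket (rho L a) (Xs ! i)])) = dsum (-1) (\<lambda>X Ys. E as bs (tvbr (trh a) X # Ys)) Xs"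
    using sum_list_update_dsum[OF _ coch_X[OF E], where xs = Xs and g = "tvbr (trh a)"] by simp
  show ?thesis
    unfolding lie_deriv_def lied_def 1 2 cut_eq[OF A] tbr_S[OF a KS_S[OF coch_K[OF E]]] ..
qed

lemma delta_cut:
  assumes E: "coch E" shows "delta L p q (cut p q E) = cut (p + 1) q (del E)"
proof (rule ext, rule ext, rule ext, rule ext)
  fix k as bs Xs
  show "delta L p q (cut p q E) k as bs Xs = cut (p + 1) q (del E) k as bs Xs"
  proof (cases "args L (p + 1) q k as bs Xs")
    case A: True
    have s: "set as \<subseteq> S" "set bs \<subseteq> S" "set Xs \<subseteq> T" and l: "k = length bs" "length as + length bs = p + 1" "length bs + length Xs = q"
      using A by (auto simp: args_iff)
    have "lie_deriv L (as ! i) (cut p q E k (nths as (- {i}))) bs Xs = lied (as ! i) E (nths as (- {i})) bs Xs" if i: "i < length as" for i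
    proof (rule lie_deriv_cut[OF E])
      show "as ! i \<in> S" using i s by auto
      show "args L p q k (nths as (- {i})) bs Xs"
        using s l i set_nths_subset[of as "- {i}"] by (auto simp: args_iff length_nths_minus1)
    qed
    then have 1: "(\<Sum>i<length as. (-1) ^ i \<cdot> lie_deriv L (as ! i) (cut p q E k (nths as (- {i}))) bs Xs) =
        dsum (-1) (\<lambda>a as. lied a E as bs Xs) as"
      using sum_nths_dsum[of "-1" "\<lambda>a as. lied a E as bs Xs" as] by (simp add: rscale_eq_scaleR)
    have "cut p q E k (lie L (as ! i) (as ! j) # nths as (- {i, j})) bs Xs = E (tbr (as ! i) (as ! j) # nths as (- {i, j})) bs Xs"
      if ij: "i < j" "j < length as" for i j
    proof -
      have "as ! i \<in> S" "as ! j \<in> S" using ij s by auto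
      then show ?thesis
        using s l ij set_nths_subset[of as "- {i, j}"]
        by (subst cut_eq) (auto simp: args_iff length_nths_minus2 lie_S tbr_S)
    qed
    then have 2: "(\<Sum>j<length as. \<Sum>i<j. (-1) ^ (i + j) \<cdot> cut p q E k (lie L (as ! i) (as ! j) # nths as (- {i, j})) bs Xs) =
        bsum tbr (\<lambda>g as. E (g # as) bs Xs) as"
      using sum_nths_bsum[of "\<lambda>g as. E (g # as) bs Xs" tbr as] by (simp add: rscale_eq_scaleR)
    have "cut p q E (k - 1) as (nths bs (- {j})) (rho L (bs ! j) # Xs) = E as (nths bs (- {j})) (trh (bs ! j) # Xs)"
      if j: "j < k" for j
    proof -
      have "bs ! j \<in> S" using j s l by auto
      then show ?thesis
        using s l j set_nths_subset[of bs "- {j}"]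
        by (subst cut_eq) (auto simp: args_iff length_nths_minus1 rho_T trh_S)
    qed
    then have 3: "(\<Sum>j<k. cut p q E (k - 1) as (nths bs (- {j})) (rho L (bs ! j) # Xs)) = del2 E as bs Xs"
      using sum_nths_dsum[of 1 "\<lambda>b bs. E as bs (trh b # Xs)" bs] l(1) by (simp add: del2_def)
    show ?thesis
      unfolding delta_def if_P[OF A] 1 2 3 cut_eq[OF A] del_def sg_def
      by (simp add: rscale_eq_scaleR del1_def l(1))
  qed (simp add: delta_def cut_out)
qed

lemma d_nabla_cut:
  assumes E: "coch E" shows "d_nabla L \<omega> p q (cut p q E) = cut p (q + 1) (dn E)"
proof (rule ext, rule ext, rule ext, rule ext)
  fix k as bs Xs
  show "d_nabla L \<omega> p q (cut p q E) k as bs Xs = cut p (q + 1) (dn E) k as bs Xs"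
  proof (cases "args L p (q + 1) k as bs Xs")
    case A: True
    have s: "set as \<subseteq> S" "set bs \<subseteq> S" "set Xs \<subseteq> T" and l: "k = length bs" "length as + length bs = p" "length bs + length Xs = q + 1"
      using A by (auto simp: args_iff)
    have "nabla \<omega> (Xs ! i) (cut p q E k as bs (nths Xs (- {i}))) = tC (E as bs (nths Xs (- {i}))) (Xs ! i)"
      if i: "i < length Xs" for i
    proof -
      have "Xs ! i \<in> T" using i s by auto
      moreover have "args L p q k as bs (nths Xs (- {i}))"
        using s l i set_nths_subset[of Xs "- {i}"] by (auto simp: args_iff length_nths_minus1)
      ultimately show ?thesis
        by (simp add: nabla_def cut_eq tC_S KS_S coch_K[OF E])
    qed
    then have 1: "(\<Sum>i<length Xs. (-1) ^ i \<cdot> nabla \<omega> (Xs ! i) (cut p q E k as bs (nths Xs (- {i})))) =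
        dsum (-1) (\<lambda>X Ys. tC (E as bs Ys) X) Xs"
      using sum_nths_dsum[of "-1" "\<lambda>X Ys. tC (E as bs Ys) X" Xs] by (simp add: rscale_eq_scaleR)
    have "cut p q E k as bs (vbracket (Xs ! i) (Xs ! j) # nths Xs (- {i, j})) = E as bs (tvbr (Xs ! i) (Xs ! j) # nths Xs (- {i, j}))"
      if ij: "i < j" "j < length Xs" for i j
    proof -
      have "Xs ! i \<in> T" "Xs ! j \<in> T" using ij s by auto
      then show ?thesis
        using s l ij set_nths_subset[of Xs "- {i, j}"]
        by (subst cut_eq) (auto simp: args_iff length_nths_minus2 T_vbracket tvbr_T)
    qed
    then have 2: "(\<Sum>j<length Xs. \<Sum>i<j. (-1) ^ (i + j) \<cdot> cut p q E k as bs (vbracket (Xs ! i) (Xs ! j) # nths Xs (- {i, j}))) =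
        bsum tvbr (\<lambda>X Ys. E as bs (X # Ys)) Xs"
      using sum_nths_bsum[of "\<lambda>X Ys. E as bs (X # Ys)" tvbr Xs] by (simp add: rscale_eq_scaleR)
    have "cut p q E (k - 1) (bs ! i # as) (nths bs (- {i})) Xs = E (bs ! i # as) (nths bs (- {i})) Xs"
      if i: "i < k" for i
    proof -
      have "bs ! i \<in> S" using i s l by auto
      then show ?thesis
        using s l i set_nths_subset[of bs "- {i}"]
        by (subst cut_eq) (auto simp: args_iff length_nths_minus1)
    qed
    then have 3: "(\<Sum>i<k. cut p q E (k - 1) (bs ! i # as) (nths bs (- {i})) Xs) = d2 E as bs Xs"
      using sum_nths_dsum[of 1 "\<lambda>b bs. E (b # as) bs Xs" bs] l(1) by (simp add: d2_def)
    show ?thesis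
      unfolding d_nabla_def if_P[OF A] d_nabla_form_def 1 2 3 cut_eq[OF A] dn_def sg_def
      by (simp add: rscale_eq_scaleR d1_def l(1))
  qed (simp add: d_nabla_def cut_out)
qed

lemma conn_h_S: "a \<in> S \<Longrightarrow> conn_h \<omega> a \<in> S"
  using hor_S[of a] subspace_diff[OF subspace_S, of a "tv a"] KS_S[OF v_K] by (simp add: hor_def)

lemma pairing_cut:
  assumes E: "coch E" and us: "set us \<subseteq> S" and ys: "set ys \<subseteq> S" and bs: "set bs \<subseteq> S" and Xs: "set Xs \<subseteq> T"
    and l: "length us + length ys + length bs = p" "length bs + length Xs = q"
  shows "pairing (\<lambda>bs'. cut p q E (length bs + length us) ys (map (conn_h \<omega>) bs @ bs')) (map (conn_C \<omega>) us) [] Xs =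
    pr (\<lambda>bs'. E ys (map hor bs @ bs')) (map tC us) Xs"
proof (cases "length us \<le> length Xs")
  case True
  let ?n = "length us"
  have hb: "map (conn_h \<omega>) bs = map hor bs" using bs by (auto simp: hor_S)
  have eq: "cut p q E (length bs + ?n) ys (map (conn_h \<omega>) bs @ map2 (\<lambda>t X. t X) (map (conn_C \<omega>) us) (take ?n Ys)) (drop ?n Ys) =
      E ys (map hor bs @ map2 (\<lambda>t X. t X) (map tC us) (take ?n Ys)) (drop ?n Ys)"
    if Ys: "set Ys \<subseteq> T" "length Ys = length Xs" for Ys
  proof -
    have "conn_C \<omega> a X = tC a X" if z: "(a, X) \<in> set (zip us (take ?n Ys))" for a X
    proof -
      have "a \<in> S" using set_zip_leftD[OF z] us by blast
      moreover have "X \<in> T" using in_set_takeD[OF set_zip_rightD[OF z]] Ys(1) by blast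
      ultimately show ?thesis by (simp add: tC_S)
    qed
    then have m: "map2 (\<lambda>t X. t X) (map (conn_C \<omega>) us) (take ?n Ys) = map2 (\<lambda>t X. t X) (map tC us) (take ?n Ys)"
      by (simp add: zip_map1 case_prod_beta)
    have "args L p q (length bs + ?n) ys (map (conn_h \<omega>) bs @ map2 (\<lambda>t X. t X) (map tC us) (take ?n Ys)) (drop ?n Ys)"
      unfolding args_iff
    proof (intro conjI)
      show "set (map (conn_h \<omega>) bs @ map2 (\<lambda>t X. t X) (map tC us) (take ?n Ys)) \<subseteq> S"
        using bs conn_h_S KS_S[OF C_K] by (auto simp: zip_map1)
      show "set (drop ?n Ys) \<subseteq> T" using Ys(1) set_drop_subset[of ?n Ys] by blast
    qed (use l True Ys ys in auto)
    then show ?thesis unfolding m by (simp add: cut_eq hb)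
  qed
  have "pairing (\<lambda>bs'. cut p q E (length bs + ?n) ys (map (conn_h \<omega>) bs @ bs')) (map (conn_C \<omega>) us) [] Xs =
    (1 / fact (length Xs - ?n)) *\<^sub>R asum (\<lambda>Ys. E ys (map hor bs @ map2 (\<lambda>t X. t X) (map tC us) (take ?n Ys)) (drop ?n Ys)) Xs"
    unfolding pairing_def rscale_eq_scaleR asum_def length_map append_Nil2
    by (intro arg_cong2[where f = scaleR] refl sum.cong eq) (use Xs in auto)
  also have "\<dots> = pr (\<lambda>bs'. E ys (map hor bs @ bs')) (map tC us) Xs"
    using asum_pr[of "\<lambda>bs'. E ys (map hor bs @ bs')" "map tC us" Xs] coch_X[OF E] True by simp
  finally show ?thesis .
next
  case False
  \<comment> \<open>With more one-forms than vector fields, \<open>take\<close> and the zipping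
    truncate, the list of core sections becomes too short for the component index, and every summand
    lies outside \<open>args\<close>.\<close>
  have "pairing (\<lambda>bs'. cut p q E (length bs + length us) ys (map (conn_h \<omega>) bs @ bs')) (map (conn_C \<omega>) us) [] Xs = 0"
    unfolding pairing_def using False l by (simp add: cut_out args_iff rscale_eq_scaleR)
  then show ?thesis using False by (simp add: pr_too_long)
qed

lemma hproj_cut:
  assumes E: "coch E" shows "hproj L \<omega> p q (cut p q E) = cut p q (\<lambda>as. hpull as E)"
proof (rule ext, rule ext, rule ext, rule ext)
  fix k as bs Xs
  show "hproj L \<omega> p q (cut p q E) k as bs Xs = cut p q (\<lambda>as. hpull as E) k as bs Xs"
  proof (cases "args L p q k as bs Xs")
    case A: True
    have s: "set as \<subseteq> S" "set bs \<subseteq> S" "set Xs \<subseteq> T" and l: "k = length bs" "length as + length bs = p" "length bs + length Xs = q"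
      using A by (auto simp: args_iff)
    then have pk: "p - k = length as" by auto
    have *: "(\<Sum>s\<in>shuffle_perms t (p - (k + t)). of_int (sign s) \<cdot> pairing
             (\<lambda>bs'. cut p q E (k + t) (map (\<lambda>i. as ! s i) [t..<p - k]) (map (conn_h \<omega>) bs @ bs'))
             (map (\<lambda>i. conn_C \<omega> (as ! s i)) [0..<t]) [] Xs) =
        shsum (\<lambda>us vs. pr (\<lambda>bs'. E vs (map hor bs @ bs')) (map tC us) Xs) t as" if t: "t \<le> length as" for t
    proof -
      have b: "p - (k + t) = length as - t" using pk by simp
      have "pairing (\<lambda>bs'. cut p q E (k + t) (map (\<lambda>i. as ! s i) [t..<length as]) (map (conn_h \<omega>) bs @ bs'))
             (map (\<lambda>i. conn_C \<omega> (as ! s i)) [0..<t]) [] Xs =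
          pr (\<lambda>bs'. E (map (\<lambda>i. as ! s i) [t..<length as]) (map hor bs @ bs')) (map tC (map (\<lambda>i. as ! s i) [0..<t])) Xs"
        if "s \<in> shuffle_perms t (length as - t)" for s
      proof -
        have p: "s permutes {..<length as}" using that t by (simp add: shuffle_perms_def)
        have sub: "set (map (\<lambda>i. as ! s i) xs) \<subseteq> S" if "set xs \<subseteq> {..<length as}" for xs
          using that permutes_in_image[OF p] s(1) by (auto simp: subset_iff)
        have "set [0..<t] \<subseteq> {..<length as}" "set [t..<length as] \<subseteq> {..<length as}" using t by auto
        from pairing_cut[OF E sub[OF this(1)] sub[OF this(2)] s(2,3), of p q] show ?thesis
          using t l by (simp add: o_def)
      qed
      then show ?thesis
        unfolding pk b using t by (simp add: shsum_def rscale_eq_scaleR)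
    qed
    \<comment> \<open>The index j counts all core slots; k of them are filled by \<open>bs\<close>,
      and t = j - k by the one-forms.\<close>
    have "(\<Sum>j=k..p. (-1) ^ (j - k) \<cdot> (\<Sum>s\<in>shuffle_perms (j - k) (p - j). of_int (sign s) \<cdot> pairing
             (\<lambda>bs'. cut p q E j (map (\<lambda>i. as ! s i) [j - k..<p - k]) (map (conn_h \<omega>) bs @ bs'))
             (map (\<lambda>i. conn_C \<omega> (as ! s i)) [0..<j - k]) [] Xs)) =
       (\<Sum>t\<le>length as. (-1) ^ t \<cdot> (\<Sum>s\<in>shuffle_perms t (p - (k + t)). of_int (sign s) \<cdot> pairing
             (\<lambda>bs'. cut p q E (k + t) (map (\<lambda>i. as ! s i) [t..<p - k]) (map (conn_h \<omega>) bs @ bs'))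
             (map (\<lambda>i. conn_C \<omega> (as ! s i)) [0..<t]) [] Xs))"
      by (rule sum.reindex_bij_witness[of _ "\<lambda>t. k + t" "\<lambda>j. j - k"]) (use l pk in auto)
    also have "\<dots> = (\<Sum>t\<le>length as. (-1) ^ t *\<^sub>R shsum (\<lambda>us vs. pr (\<lambda>bs'. E vs (map hor bs @ bs')) (map tC us) Xs) t as)"
      by (rule sum.cong[OF refl]) (simp add: *[unfolded rscale_eq_scaleR] rscale_eq_scaleR)
    also have "\<dots> = hpull as E bs Xs"
      by (rule hpull_shuffle[OF E, symmetric])
    finally show ?thesis
      unfolding hproj_def if_P[OF A] cut_eq[OF A] .
  qed (simp add: hproj_def cut_out)
qed

section \<open>Membership in the space of Weil cochains\<close>

lemma cut_forms:
  assumes E: "coch E" and w: "flin E" and kp: "k \<le> p" "k \<le> q" and as: "as \<in> tuples (p - k) S"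
  shows "cut p q E k as \<in> forms L K (q - k) k"
proof -
  have A: "args L p q k as bs Xs \<longleftrightarrow> bs \<in> tuples k S \<and> Xs \<in> tuples (q - k) T" for bs Xs
    using kp as unfolding args_def by blast
  have 1: "if bs \<in> tuples k S \<and> Xs \<in> tuples (q - k) T then cut p q E k as bs Xs \<in> KS else cut p q E k as bs Xs = 0" for bs Xs
    unfolding cut_def A using coch_K[OF E] by simp
  have comm: "f \<odot> (a *\<^sub>R y) = a *\<^sub>R f \<odot> y" for f a and y :: "('m, 'a) sect"
    by (rule linear_scale[OF linear_fscale])
  have Vs: "f \<odot> y + z \<in> S" if "f \<in> Fn" "y \<in> S" "z \<in> S" for f y z
    using that by (simp add: S_add S_fscale)
  have Vt: "vscale f y + z \<in> T" if "f \<in> Fn" "y \<in> T" "z \<in> T" for f y z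
    using that by (simp add: T_add T_vscale)
  have 2: "multilinear Fn (\<odot>) (\<odot>) k S (\<lambda>bs. cut p q E k as bs Xs)" "symmetric k S (\<lambda>bs. cut p q E k as bs Xs)"
    if X: "Xs \<in> tuples (q - k) T" for Xs
  proof -
    have eq: "cut p q E k as bs Xs = E as bs Xs" if "bs \<in> tuples k S" for bs
      using A that X by (simp add: cut_eq)
    have "multilinear Fn (\<odot>) (\<odot>) k S (\<lambda>bs. E as bs Xs)"
      using flin_beta[OF w] by (intro multilinear_esym[OF coch_beta[OF E]] comm)
        (simp add: sA_S KS_S[OF coch_K[OF E]] flip: sA_S)
    then show "multilinear Fn (\<odot>) (\<odot>) k S (\<lambda>bs. cut p q E k as bs Xs)"
      by (rule multilinear_cong) (simp_all add: eq Vs)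
    show "symmetric k S (\<lambda>bs. cut p q E k as bs Xs)"
      unfolding symmetric_def
    proof (intro ballI allI impI)
      fix xs ys assume xy: "xs \<in> tuples k S" "mset xs = mset ys"
      have "ys \<in> tuples k S"
        using xy(1) mset_eq_length[OF xy(2)] mset_eq_setD[OF xy(2)] by (simp add: tuples_def)
      then show "cut p q E k as xs Xs = cut p q E k as ys Xs"
        unfolding eq[OF xy(1)] by (simp only: eq esym_mset[OF coch_beta[OF E] xy(2)])
    qed
  qed
  have 3: "multilinear Fn vscale (\<odot>) (q - k) T (cut p q E k as bs)" "alternating (q - k) T (cut p q E k as bs)"
    if b: "bs \<in> tuples k S" for bs
  proof -
    have eq: "cut p q E k as bs Xs = E as bs Xs" if "Xs \<in> tuples (q - k) T" for Xs
      using A that b by (simp add: cut_eq)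
    have "E as bs (vscale f Y # Ys) = f \<odot> E as bs (Y # Ys)" if "f \<in> Fn" "Y \<in> T" for f Y Ys
      using flin_X[OF w that(1), of as bs Y Ys] that
      by (simp add: sX_def Q_id sA_S KS_S[OF coch_K[OF E]])
    then have "multilinear Fn vscale (\<odot>) (q - k) T (E as bs)"
      by (intro multilinear_esym[OF coch_X[OF E]] comm) simp
    then show "multilinear Fn vscale (\<odot>) (q - k) T (cut p q E k as bs)"
      by (rule multilinear_cong) (simp_all add: eq Vt)
    show "alternating (q - k) T (cut p q E k as bs)"
      unfolding alternating_def by (simp add: eq esym_alternating[OF coch_X[OF E]])
  qed
  show ?thesis
    unfolding forms_def using 1 2 3 by blast
qed

lemma cut_weil:
  assumes E: "coch E" and w: "flin E" shows "cut p q E \<in> weil L K p q"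
  unfolding weil_def mem_Collect_eq
proof (intro conjI allI impI ballI)
  fix k as
  show "if k \<le> p \<and> k \<le> q \<and> as \<in> tuples (p - k) S then cut p q E k as \<in> forms L K (q - k) k else cut p q E k as = 0"
    using cut_forms[OF E w] by (auto simp: cut_def args_def fun_eq_iff)
next
  fix k bs Xs assume k: "k \<le> p"
  have "multilinear UNIV (\<cdot>) (\<cdot>) (p - k) S (\<lambda>as. cut p q E k as bs Xs) \<and> alternating (p - k) S (\<lambda>as. cut p q E k as bs Xs)"
  proof (cases "k \<le> q \<and> bs \<in> tuples k S \<and> Xs \<in> tuples (q - k) T")
    case True
    have eq: "cut p q E k as bs Xs = E as bs Xs" if "as \<in> tuples (p - k) S" for as
      using k True that by (simp add: cut_eq args_def)
    have "multilinear UNIV (\<cdot>) (\<cdot>) (p - k) S (\<lambda>as. E as bs Xs)"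
      by (rule multilinear_esym[OF coch_alpha[OF E]])
        (simp_all add: rscale_eq_scaleR linear_scale[OF lin_alpha[OF E]])
    then have "multilinear UNIV (\<cdot>) (\<cdot>) (p - k) S (\<lambda>as. cut p q E k as bs Xs)"
      by (rule multilinear_cong)
        (simp_all add: eq rscale_eq_scaleR subspace_add[OF subspace_S] subspace_scale[OF subspace_S])
    moreover have "alternating (p - k) S (\<lambda>as. cut p q E k as bs Xs)"
      unfolding alternating_def by (simp add: eq esym_alternating[OF coch_alpha[OF E]])
    ultimately show ?thesis ..
  next
    case False
    then have "cut p q E k as bs Xs = 0" for as by (auto simp: cut_def args_def)
    then show ?thesis by (simp add: multilinear_def alternating_def rscale_eq_scaleR)
  qed
  then show "multilinear UNIV (\<cdot>) (\<cdot>) (p - k) S (\<lambda>as. cut p q E k as bs Xs)"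
    "alternating (p - k) S (\<lambda>as. cut p q E k as bs Xs)" by blast+
next
  fix k f a as bs Xs
  assume k: "k < p" and f: "f \<in> Fn" and a: "a \<in> S" and as: "as \<in> tuples (p - k - 1) S"
    and bs: "bs \<in> tuples k S" and Xs: "Xs \<in> tuples (q - k) T"
  show "cut p q E k (f \<odot> a # as) bs Xs = f \<odot> cut p q E k (a # as) bs Xs + df_wedge f (cut p q E (Suc k) as (a # bs)) Xs"
  proof (cases "k \<le> q")
    case True
    have A: "args L p q k (x # as) bs Xs" if "x \<in> S" for x
      using k True as bs Xs that by (auto simp: args_def tuples_def)
    have df: "df_wedge f (cut p q E (Suc k) as (a # bs)) Xs = dsum (-1) (\<lambda>X Ys. ap X f \<odot> E as (a # bs) Ys) Xs"
      unfolding df_wedge_dsum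
    proof (rule dsum_cong)
      fix X Ys assume X: "X \<in> set Xs" "set Ys \<subseteq> set Xs" "length Xs = Suc (length Ys)"
      then have "args L p q (Suc k) as (a # bs) Ys"
        using k True a as bs Xs by (auto simp: args_def tuples_def)
      moreover have "X \<in> T" using X Xs by (auto simp: tuples_def)
      ultimately show "X f \<odot> cut p q E (Suc k) as (a # bs) Ys = ap X f \<odot> E as (a # bs) Ys"
        by (simp add: cut_eq ap_def Q_id)
    qed
    show ?thesis
      using flin_alpha[OF w f, of a as bs Xs]
      unfolding df cut_eq[OF A[OF S_fscale[OF f a]]] cut_eq[OF A[OF a]] sA_S[OF a] dw_def
        sA_S[OF KS_S[OF coch_K[OF E]]] .
  next
    case False
    \<comment> \<open>For k > q the truncated q - k is 0, so there are no vector fields, the df-term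
      is an empty sum, and both components of the cochain vanish.\<close>
    then have "Xs = []" using Xs by (simp add: tuples_def)
    then show ?thesis
      using False by (simp add: cut_def args_def df_wedge_dsum linear_0[OF linear_fscale])
  qed
qed

text \<open>For fixed p, \<open>hpull\<close> coincides with a polynomial in \<open>N\<close>, for
  which the symmetries and the Leibniz rule are already known. Neither has to be checked on the
  shuffle formula.\<close>

lemma hpull_cut_weil:
  assumes E: "coch E" and w: "flin E" shows "cut p q (\<lambda>as. hpull as E) \<in> weil L K p q"
proof -
  have "cut p q (\<lambda>as. hpull as E) = cut p q ((1 / fact p) *\<^sub>R hpoly p E)"
    by (rule cut_cong) (simp add: hpoly_eq_hpull[OF E])
  also have "\<dots> \<in> weil L K p q"
    by (intro cut_weil coch_scaleR flin_scaleR coch_hpoly flin_hpoly E w)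
  finally show ?thesis .
qed

section \<open>The horizontal exterior covariant derivative as a cochain map\<close>

lemma D_hor_cut: "coch E \<Longrightarrow> D_hor L \<omega> p q (cut p q E) = cut p (q + 1) (\<lambda>as. hpull as (dn E))"
  by (simp only: D_hor_def d_nabla_cut hproj_cut coch_dn)

text \<open>For an IM form the right side of the commutation is \<open>D_hor\<close> of 0.\<close>

lemma D_hor_zero: "D_hor L \<omega> p q 0 = 0"
proof -
  have w: "coch 0"
    by (rule cochI)
      (simp_all only: zero_fun_apply esym_zero esym_zero[folded zero_fun_def] subspace_0[OF subspace_KS])
  have dn: "dn 0 = 0"
    using d1_diff[of 0 0] d2_diff[of 0 0] sg_diff[of 0 0] unfolding dn_def by (simp only: diff_self)
  have "hpull as 0 bs Xs = 0" for as bs Xs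
    using hpull_add[OF w w, of as bs Xs] by simp
  moreover have "cut p q 0 = 0" for p q
    by (rule ext, rule ext, rule ext, rule ext) (simp add: cut_def)
  ultimately show ?thesis
    using D_hor_cut[OF w, of p q] by (simp only: dn) (simp add: cut_def fun_eq_iff)
qed

lemma D_hor_weil:
  assumes "c \<in> weil L K p q" shows "D_hor L \<omega> p q c \<in> weil L K p (q + 1)"
  using D_hor_cut[OF coch_tot[OF assms], of p q] hpull_cut_weil[OF coch_dn flin_dn, OF coch_tot coch_tot flin_tot, OF assms assms assms]
  by (simp only: cut_tot[OF assms])

lemma delta_D_hor:
  assumes "c \<in> weil L K p q"
  shows "delta L p (q + 1) (D_hor L \<omega> p q c) = D_hor L \<omega> (p + 1) q (delta L p q c)"
proof -
  let ?E = "tot c"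
  \<comment> \<open>Degree p would describe \<open>D_hor\<close> of \<open>c\<close> alone; with p +
    1 the same polynomial still represents \<open>hpull\<close> after \<open>del\<close>, which
    raises p by one.\<close>
  let ?n = "p + 1"
  let ?G = "(1 / fact ?n) *\<^sub>R hpoly ?n (dn ?E)"
  have E: "coch ?E" by (rule coch_tot[OF assms])
  have G: "coch ?G" by (intro coch_scaleR coch_hpoly coch_dn E)
  have "D_hor L \<omega> p q (cut p q ?E) = cut p (q + 1) ?G"
    unfolding D_hor_cut[OF E]
    by (rule cut_cong) (simp add: hpoly_eq_hpull[OF coch_dn[OF E]] del: fact_Suc hpoly.simps)
  then have "delta L p (q + 1) (D_hor L \<omega> p q c) = cut (p + 1) (q + 1) (del ?G)"
    by (simp only: cut_tot[OF assms] delta_cut[OF G])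
  also have "\<dots> = cut (p + 1) (q + 1) (\<lambda>as. hpull as (dn (del ?E)))"
  proof (rule cut_cong)
    fix as bs :: "('m, 'a) sect list" and Xs :: "'m vfield list"
    assume "length as + length bs = p + 1"
    then have "del ?G as bs Xs = hpull as (del (dn ?E)) bs Xs"
      using hpoly_eq_hpull[OF coch_del[OF coch_dn[OF E]], of as bs ?n Xs]
      by (simp add: del_scaleR del_hpoly[OF coch_dn[OF E]] del: fact_Suc hpoly.simps)
    then show "del ?G as bs Xs = hpull as (dn (del ?E)) bs Xs"
      by (simp only: hpull_del[OF coch_dn[OF E], symmetric] hpull_dn_del[OF E])
  qed
  also have "\<dots> = D_hor L \<omega> (p + 1) q (cut (p + 1) q (del ?E))"
    by (rule D_hor_cut[OF coch_del[OF E], symmetric])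
  also have "cut (p + 1) q (del ?E) = delta L p q c"
    using delta_cut[OF E, of p q] by (simp only: cut_tot[OF assms])
  finally show ?thesis .
qed

end

theorem theorem4p13:
  fixes L :: "('m::{t2_space,second_countable_topology}, 'e::real_normed_vector, 'a::real_vector) algebroid"
    and K :: "'m \<Rightarrow> 'a set"
    and \<omega> :: "('m, 'a) cochain"
  assumes "lie_algebroid L"
    and "bundle_of_ideals L K"
    and "\<omega> \<in> IM_connections L K"
  shows "(\<forall>p q. \<forall>c\<in>weil L K p q.
            D_hor L \<omega> p q c \<in> weil L K p (q + 1) \<and>
            delta L p (q + 1) (D_hor L \<omega> p q c) = D_hor L \<omega> (p + 1) q (delta L p q c)) \<and>
         (\<forall>q. \<forall>c\<in>IM_forms L K q. D_hor L \<omega> 1 q c \<in> IM_forms L K (q + 1))"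
proof -
  interpret im_setting L K \<omega> by (rule im_setting.intro) (rule assms)+
  have "D_hor L \<omega> 1 q c \<in> IM_forms L K (q + 1)" if "c \<in> IM_forms L K q" for c q
  proof -
    have c: "c \<in> weil L K 1 q" "delta L 1 q c = 0" using that by (simp_all add: IM_forms_def)
    have "delta L 1 (q + 1) (D_hor L \<omega> 1 q c) = 0"
      unfolding delta_D_hor[OF c(1)] c(2) by (rule D_hor_zero)
    with D_hor_weil[OF c(1)] show ?thesis
      unfolding IM_forms_def mem_Collect_eq by (rule conjI)
  qed
  then show ?thesis
    by (intro conjI allI ballI D_hor_weil delta_D_hor)
qed

end
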